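(* Let $p\in[1,\infty]$, $\lambda\in\mathbb{R}$, let $\alpha\in[0,1]$ be irrational with rational approximants $\alpha_m=\frac{p_m}{q_m}$, let $\theta\in[0,1)$, and let $H_{\lambda,\alpha,\theta}$ be the aperiodic Schrödinger operator on $\ell^p(\mathbb{Z})$ given by $(H_{\lambda,\alpha,\theta}x)_n=x_{n+1}+x_{n-1}+\lambda v_{\alpha,\theta}(n)x_n$. Then the finite section method for $H_{\lambda,\alpha,\theta}$ is applicable if and only if there exists $m_0\geq 0$ such that \[ \left|\operatorname{tr}\big(M_{\lambda,\alpha,0}(q_{m_0})\big)\right|>2\quad\text{and}\quad\left|\operatorname{tr}\big(M_{\lambda,\alpha,0}(q_{m_0+1})\big)\right|>2 \] and \[ \liminf_{m\to\infty}\operatorname{dist}(0,G_m)\neq 0, \] where \[ G_m:=\bigcup_{k=1}^{q_m}\Big\{E\in\sigma\Big(\big((A_m)_{ij}\big)_{i,j=k}^{q_m+k-2}\Big):\Big|\det\Big(\big((A_m)_{ij}-E\delta_{ij}\big)_{i,j=k}^{q_m+k-1}\Big)\Big|<1\Big\} \] and $A_m=((A_m)_{ij})_{i,j\in\mathbb{Z}}$ denotes the two-sided infinite matrix representing the periodic operator $H_{\lambda,\alpha_m,0}$ (defined by the same formula with $\alpha$ replaced by $\alpha_m$).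
   Context: Sturmian potential: for $\beta\in[0,1]$ and $\theta\in[0,1)$, $v_{\beta,\theta}(n)=\chi_{[1-\beta,1)}(n\beta+\theta \bmod 1)$, $n\in\mathbb{Z}$. Continued fraction: $\alpha=[a_1,a_2,\dots]=\cfrac{1}{a_1+\cfrac{1}{a_2+\cdots}}$ with $a_i\in\mathbb{N}$; with $a_0:=0$, $p_{-1}=1,p_0=0,p_n=a_np_{n-1}+p_{n-2}$, $q_{-1}=0,q_0=1,q_n=a_nq_{n-1}+q_{n-2}$, and $\alpha_n=p_n/q_n$ is the $n$-th rational approximant. For $q\in\mathbb{N}$, $M_{\lambda,\alpha,\theta}(q):=\begin{pmatrix}-\lambda v_{\alpha,\theta}(q)&-1\\1&0\end{pmatrix}\cdots\begin{pmatrix}-\lambda v_{\alpha,\theta}(2)&-1\\1&0\end{pmatrix}\begin{pmatrix}-\lambda v_{\alpha,\theta}(1)&-1\\1&0\end{pmatrix}$. Finite section method (FSM): for a bounded operator $A$ on $\ell^p(\mathbb{Z})$ with matrix $(a_{ij})_{i,j\in\mathbb{Z}}$ w.r.t. the canonical basis, let $A_n=(a_{ij})_{i,j=-n}^n$; the FSM for $A$ is called applicable if $A$ is invertible, the matrices $A_n$ are invertible for all sufficiently large $n$, and their inverses (embedded into two-sided infinite matrices) converge strongly to $A^{-1}$. $\sigma(\cdot)$ denotes the spectrum, $\delta_{ij}$ the Kronecker delta.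
   Formalization: For p = ∞ strong convergence of the inverses, which can never hold there, is replaced by P-strong convergence: ‖P_k(A_n^{-1}P_n − A^{-1})‖ → 0 and ‖(A_n^{-1}P_n − A^{-1})P_k‖ → 0 for every k; for p < ∞ it is ordinary strong convergence. *)

theory Defs
  imports "Jordan_Normal_Form.Spectral_Radius" "HOL-Analysis.Infinite_Sum"
    "HOL-Library.Liminf_Limsup" "HOL-Library.Extended_Real"
begin

definition sturm_v :: "real \<Rightarrow> real \<Rightarrow> int \<Rightarrow> real" where
  "sturm_v \<beta> \<theta> n = (if frac (of_int n * \<beta> + \<theta>) \<in> {1 - \<beta>..<1} then 1 else 0)"

definition cf_rem :: "real \<Rightarrow> nat \<Rightarrow> real" where
  "cf_rem \<alpha> k = ((\<lambda>t. frac (1 / t)) ^^ k) \<alpha>"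

definition cf_a :: "real \<Rightarrow> nat \<Rightarrow> nat" where
  "cf_a \<alpha> k = (if k = 0 then 0 else nat \<lfloor>1 / cf_rem \<alpha> (k - 1)\<rfloor>)"

fun cf_q :: "real \<Rightarrow> nat \<Rightarrow> nat" where
  "cf_q \<alpha> 0 = 1"
| "cf_q \<alpha> (Suc 0) = cf_a \<alpha> 1"
| "cf_q \<alpha> (Suc (Suc n)) = cf_a \<alpha> (n + 2) * cf_q \<alpha> (Suc n) + cf_q \<alpha> n"

fun cf_p :: "real \<Rightarrow> nat \<Rightarrow> nat" where
  "cf_p \<alpha> 0 = 0"
| "cf_p \<alpha> (Suc 0) = 1"
| "cf_p \<alpha> (Suc (Suc n)) = cf_a \<alpha> (n + 2) * cf_p \<alpha> (Suc n) + cf_p \<alpha> n"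

definition cf_approx :: "real \<Rightarrow> nat \<Rightarrow> real" where
  "cf_approx \<alpha> m = real (cf_p \<alpha> m) / real (cf_q \<alpha> m)"

definition transfer_step :: "real \<Rightarrow> real \<Rightarrow> real \<Rightarrow> int \<Rightarrow> real mat" where
  "transfer_step lam \<alpha> \<theta> n = mat_of_rows_list 2 [ [- lam * sturm_v \<alpha> \<theta> n, -1], [1, 0] ]"

fun transfer_M :: "real \<Rightarrow> real \<Rightarrow> real \<Rightarrow> nat \<Rightarrow> real mat" where
  "transfer_M lam \<alpha> \<theta> 0 = 1\<^sub>m 2"
| "transfer_M lam \<alpha> \<theta> (Suc q) = transfer_step lam \<alpha> \<theta> (int (Suc q)) * transfer_M lam \<alpha> \<theta> q"

definition trace2 :: "real mat \<Rightarrow> real" where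
  "trace2 M = M $$ (0, 0) + M $$ (1, 1)"

definition schroedinger :: "real \<Rightarrow> real \<Rightarrow> real \<Rightarrow> (int \<Rightarrow> complex) \<Rightarrow> (int \<Rightarrow> complex)" where
  "schroedinger lam \<alpha> \<theta> x n = x (n + 1) + x (n - 1) + complex_of_real (lam * sturm_v \<alpha> \<theta> n) * x n"

definition schroedinger_entry :: "real \<Rightarrow> real \<Rightarrow> real \<Rightarrow> int \<Rightarrow> int \<Rightarrow> complex" where
  "schroedinger_entry lam \<alpha> \<theta> i j =
     (if \<bar>i - j\<bar> = 1 then 1 else 0) + (if i = j then complex_of_real (lam * sturm_v \<alpha> \<theta> i) else 0)"

definition block_mat :: "(int \<Rightarrow> int \<Rightarrow> complex) \<Rightarrow> int \<Rightarrow> int \<Rightarrow> complex mat" where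
  "block_mat a k l = mat (nat (l - k + 1)) (nat (l - k + 1)) (\<lambda>(i, j). a (k + int i) (k + int j))"

definition G_set :: "real \<Rightarrow> real \<Rightarrow> nat \<Rightarrow> complex set" where
  "G_set lam \<alpha> m = (let q = int (cf_q \<alpha> m); a = schroedinger_entry lam (cf_approx \<alpha> m) 0 in
     (\<Union>k\<in>{1..q}. {E \<in> spectrum (block_mat a k (q + k - 2)).
        cmod (det (block_mat (\<lambda>i j. a i j - (if i = j then E else 0)) k (q + k - 1))) < 1}))"

definition dist0_G :: "real \<Rightarrow> real \<Rightarrow> nat \<Rightarrow> ereal" where
  "dist0_G lam \<alpha> m = (INF E\<in>G_set lam \<alpha> m. ereal (cmod E))"

definition lp_space :: "ereal \<Rightarrow> (int \<Rightarrow> complex) set" where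
  "lp_space p = (if p = \<infinity> then {x. bdd_above (range (\<lambda>n. cmod (x n)))}
                 else {x. (\<lambda>n. cmod (x n) powr real_of_ereal p) summable_on UNIV})"

definition lp_norm :: "ereal \<Rightarrow> (int \<Rightarrow> complex) \<Rightarrow> real" where
  "lp_norm p x = (if p = \<infinity> then (SUP n. cmod (x n))
                  else (\<Sum>\<^sub>\<infinity>n. cmod (x n) powr real_of_ereal p) powr (1 / real_of_ereal p))"

definition unit_seq :: "int \<Rightarrow> int \<Rightarrow> complex" where
  "unit_seq j = (\<lambda>k. if k = j then 1 else 0)"

definition op_entry :: "((int \<Rightarrow> complex) \<Rightarrow> (int \<Rightarrow> complex)) \<Rightarrow> int \<Rightarrow> int \<Rightarrow> complex" where
  "op_entry A i j = A (unit_seq j) i"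

definition proj :: "nat \<Rightarrow> (int \<Rightarrow> complex) \<Rightarrow> (int \<Rightarrow> complex)" where
  "proj n x = (\<lambda>i. if \<bar>i\<bar> \<le> int n then x i else 0)"

definition fsec :: "((int \<Rightarrow> complex) \<Rightarrow> (int \<Rightarrow> complex)) \<Rightarrow> nat \<Rightarrow> (int \<Rightarrow> complex) \<Rightarrow> (int \<Rightarrow> complex)" where
  "fsec A n x = (\<lambda>i. if \<bar>i\<bar> \<le> int n then (\<Sum>j\<in>{- int n..int n}. op_entry A i j * x j) else 0)"

definition fsec_invertible :: "((int \<Rightarrow> complex) \<Rightarrow> (int \<Rightarrow> complex)) \<Rightarrow> nat \<Rightarrow> bool" where
  "fsec_invertible A n = (det (block_mat (op_entry A) (- int n) (int n)) \<noteq> 0)"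

text \<open>Inverse of A_n, embedded into a two-sided infinite matrix (i.e. A_n^(-1) P_n).\<close>
definition fsec_inv :: "((int \<Rightarrow> complex) \<Rightarrow> (int \<Rightarrow> complex)) \<Rightarrow> nat \<Rightarrow> (int \<Rightarrow> complex) \<Rightarrow> (int \<Rightarrow> complex)" where
  "fsec_inv A n y = (THE x. proj n x = x \<and> fsec A n x = proj n y)"

definition is_inverse_on :: "ereal \<Rightarrow> ((int \<Rightarrow> complex) \<Rightarrow> (int \<Rightarrow> complex)) \<Rightarrow> ((int \<Rightarrow> complex) \<Rightarrow> (int \<Rightarrow> complex)) \<Rightarrow> bool" where
  "is_inverse_on p A B =
     ((\<forall>x\<in>lp_space p. B x \<in> lp_space p \<and> A (B x) = x \<and> B (A x) = x)
      \<and> (\<exists>C. \<forall>x\<in>lp_space p. lp_norm p (B x) \<le> C * lp_norm p x))"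

definition invertible_on :: "ereal \<Rightarrow> ((int \<Rightarrow> complex) \<Rightarrow> (int \<Rightarrow> complex)) \<Rightarrow> bool" where
  "invertible_on p A = (\<exists>B. is_inverse_on p A B)"

text \<open>Strong convergence R_n -> B on l^p; for p = infinity in the P-strong sense.\<close>
definition strong_conv :: "ereal \<Rightarrow> (nat \<Rightarrow> (int \<Rightarrow> complex) \<Rightarrow> (int \<Rightarrow> complex)) \<Rightarrow> ((int \<Rightarrow> complex) \<Rightarrow> (int \<Rightarrow> complex)) \<Rightarrow> bool" where
  "strong_conv p R B =
    (if p = \<infinity> then
       (\<forall>k. \<forall>\<epsilon>>0. eventually (\<lambda>n. \<forall>x\<in>lp_space p. lp_norm p x \<le> 1 \<longrightarrow>
            lp_norm p (proj k (\<lambda>i. R n x i - B x i)) \<le> \<epsilon>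
          \<and> lp_norm p (\<lambda>i. R n (proj k x) i - B (proj k x) i) \<le> \<epsilon>) sequentially)
     else
       (\<forall>x\<in>lp_space p. (\<lambda>n. lp_norm p (\<lambda>i. R n x i - B x i)) \<longlonglongrightarrow> 0))"

definition fsm_applicable :: "ereal \<Rightarrow> ((int \<Rightarrow> complex) \<Rightarrow> (int \<Rightarrow> complex)) \<Rightarrow> bool" where
  "fsm_applicable p A =
     (\<exists>B. is_inverse_on p A B \<and> (\<exists>N. \<forall>n\<ge>N. fsec_invertible A n)
          \<and> strong_conv p (fsec_inv A) B)"

end

theory Submission
  imports Defs "HOL-Analysis.Convex" "HOL-Analysis.Elementary_Metric_Spaces"
begin

text \<open>
  If two consecutive traces exceed 2, the trace map escapes and the traces tend to infinity. Every place of a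
  Sturmian word lies near the centre of a square of some period \<open>q m\<close>, where the Cayley-Hamilton theorem with a
  large trace bounds \<open>x\<close> locally by \<open>3/4\<close> of its maximum nearby plus a multiple of \<open>H x\<close>. This local inequality
  holds uniformly for all phases, for small energies and for the periodic approximants, it passes to all \<open>l^p\<close>, and it
  gives invertibility of \<open>H\<close> with exponentially decaying solutions. Otherwise infinitely many approximants have traces
  in \<open>[-2, 2]\<close>, hence bounded solutions, which occur on long windows of \<open>H\<close> and produce approximate null vectors.

  Given the trace condition, the finite sections are stable unless some solution with a Dirichlet condition at a
  window end stays bounded on a long window. Such a window also occurs in a periodic approximant, whose decaying half-line
  solution then almost satisfies the Dirichlet condition; moving the energy slightly (the Wronskian identity
  makes the boundary value depend strictly on the energy) produces an element of \<open>G_m\<close> near zero. The windows at the right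
  end are reflections of those at the left end. Conversely, elements of \<open>G_m\<close> tending to zero give, by recurrence, sections
  on which the Dirichlet solution from the left end stays bounded up to the middle. If the method were applicable, the
  columns 0 and 1 of the inverse sections would be small at that end, hence small left of their poles, and this is
  impossible because right of their poles the two columns are proportional.
\<close>

section \<open>Continued fraction denominators and best approximation\<close>

text \<open>Every estimate is about finite words, with constants depending only on the words of a
  given length. This is why one local inequality can serve all phases, both window ends, the
  periodic approximants and all \<open>p\<close> including infinity. The trace threshold 4 leaves
  room: the two outer terms of a square give the factor 2/4, and raising it to 3/4 absorbs a small
  energy. This is needed because elements of \<open>G_set\<close> are energies near zero and not
  zero itself.

  The obstacle in the necessity part is the length of the left half of a section. Recurrence places
  a matched word of length about \<open>q (Suc k)\<close> only at some \<open>- n\<close> with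
  \<open>n\<close> up to about \<open>q (Suc k) + q k\<close>, so the matched word need not reach
  the centre. The Dirichlet solution must be carried over a further stretch, shorter than one
  period, on which the word repeats its beginning up to two adjacent letters. Crude growth bounds
  would lose an exponential factor there; the product of the decaying solution and the continued one
  stays under control.\<close>

locale irrational_slope =
  fixes \<alpha> :: real
  assumes slope_pos: "0 < \<alpha>" and slope_less_1: "\<alpha> < 1" and irrational: "\<alpha> \<notin> \<rat>"
begin

lemma cf_rem_Suc: "cf_rem \<alpha> (Suc k) = frac (1 / cf_rem \<alpha> k)"
  by (simp add: cf_rem_def)

text \<open>Irrationality survives inversion and removal of the integer part, so no remainder is
  zero and the expansion never stops.\<close>

lemma cf_rem_props: "cf_rem \<alpha> k \<notin> \<rat> \<and> 0 < cf_rem \<alpha> k \<and> cf_rem \<alpha> k < 1"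
proof (induction k)
  case 0
  then show ?case using slope_pos slope_less_1 irrational by (simp add: cf_rem_def)
next
  case (Suc k)
  let ?r = "cf_rem \<alpha> k"
  have "1 / ?r \<notin> \<rat>"
    using Suc Rats_divide[of 1 "1 / ?r"] by auto
  then have nr: "frac (1 / ?r) \<notin> \<rat>"
    unfolding frac_def using Rats_add[of "1 / ?r - of_int \<lfloor>1 / ?r\<rfloor>" "of_int \<lfloor>1 / ?r\<rfloor>"] by auto
  then have "frac (1 / ?r) \<noteq> 0" using Rats_0 by metis
  then have "0 < frac (1 / ?r)" using frac_ge_0[of "1 / ?r"] by linarith
  then show ?case unfolding cf_rem_Suc using nr frac_lt_1 by blast
qed

lemma cf_rem_pos: "0 < cf_rem \<alpha> k" and cf_rem_less_1: "cf_rem \<alpha> k < 1"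
  using cf_rem_props by auto

lemma cf_a_Suc: "real (cf_a \<alpha> (Suc k)) = 1 / cf_rem \<alpha> k - cf_rem \<alpha> (Suc k)"
proof -
  have "0 \<le> \<lfloor>1 / cf_rem \<alpha> k\<rfloor>" using cf_rem_pos[of k] by simp
  then show ?thesis by (simp add: cf_a_def cf_rem_Suc frac_def)
qed

lemma cf_a_pos: "1 \<le> cf_a \<alpha> (Suc k)"
proof -
  have "1 < 1 / cf_rem \<alpha> k" using cf_rem_pos[of k] cf_rem_less_1[of k] by simp
  then have "1 \<le> \<lfloor>1 / cf_rem \<alpha> k\<rfloor>" by linarith
  then have "nat 1 \<le> nat \<lfloor>1 / cf_rem \<alpha> k\<rfloor>" by (rule nat_mono)
  then show ?thesis by (simp add: cf_a_def)
qed

abbreviation q :: "nat \<Rightarrow> nat" where "q \<equiv> cf_q \<alpha>"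
abbreviation p :: "nat \<Rightarrow> nat" where "p \<equiv> cf_p \<alpha>"

text \<open>Known quantity: the distance from \<open>q m * \<alpha>\<close> to \<open>p m\<close>,
  see \<open>q_mult_slope\<close>. The product form makes positivity and monotonicity
  immediate.\<close>

definition err :: "nat \<Rightarrow> real" where "err m = (\<Prod>k\<le>m. cf_rem \<alpha> k)"

lemma err_pos: "0 < err m"
  unfolding err_def by (intro prod_pos) (simp add: cf_rem_pos)

lemma err_0: "err 0 = \<alpha>" by (simp add: err_def cf_rem_def)

lemma err_Suc: "err (Suc m) = err m * cf_rem \<alpha> (Suc m)"
  by (simp add: err_def)

lemma err_Suc_less: "err (Suc m) < err m"
  unfolding err_Suc using err_pos[of m] cf_rem_less_1[of "Suc m"]
  by (simp add: mult_less_cancel_left1)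

lemma err_decreasing: "m < n \<Longrightarrow> err n < err m"
  using lift_Suc_mono_less[of "\<lambda>m. - err m" m n] err_Suc_less by auto

lemma err_rec: "err (Suc (Suc m)) = err m - cf_a \<alpha> (Suc (Suc m)) * err (Suc m)"
proof -
  have "cf_a \<alpha> (Suc (Suc m)) * err (Suc m) = err (Suc m) / cf_rem \<alpha> (Suc m) - err (Suc (Suc m))"
    unfolding cf_a_Suc err_Suc[of "Suc m"] by (simp add: algebra_simps)
  also have "err (Suc m) / cf_rem \<alpha> (Suc m) = err m"
    unfolding err_Suc using cf_rem_pos[of "Suc m"] by simp
  finally show ?thesis by simp
qed

lemma err_1: "err (Suc 0) = 1 - cf_a \<alpha> 1 * \<alpha>"
proof -
  have "real (cf_a \<alpha> 1) * \<alpha> = 1 - err (Suc 0)"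
    using cf_a_Suc[of 0] slope_pos by (simp add: err_Suc err_0 field_simps cf_rem_def)
  then show ?thesis by simp
qed

lemma q_mult_slope: "real (q m) * \<alpha> - real (p m) = (-1) ^ m * err m"
proof (induction m rule: induct_nat_012)
  case 0 then show ?case by (simp add: err_0)
next
  case 1 then show ?case by (simp add: err_1)
next
  case (ge2 n)
  have "real (q (Suc (Suc n))) * \<alpha> - real (p (Suc (Suc n)))
      = cf_a \<alpha> (Suc (Suc n)) * (real (q (Suc n)) * \<alpha> - real (p (Suc n))) + (real (q n) * \<alpha> - real (p n))"
    by (simp add: algebra_simps)
  then show ?case unfolding ge2 by (simp add: err_rec algebra_simps)
qed

lemma q_mult_slope_even: "even m \<Longrightarrow> real (q m) * \<alpha> = real (p m) + err m"
  and q_mult_slope_odd: "odd m \<Longrightarrow> real (q m) * \<alpha> = real (p m) - err m"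
  using q_mult_slope[of m] by auto

lemma q_pos: "1 \<le> q m"
proof (induction m rule: induct_nat_012)
  case 1 then show ?case using cf_a_pos[of 0] by simp
next
  case (ge2 n)
  then show ?case using cf_a_pos[of "Suc n"] by simp
qed simp

lemma q_Suc_Suc_ge: "q (Suc m) + q m \<le> q (Suc (Suc m))"
  using cf_a_pos[of "Suc m"] by simp

lemma q_Suc_mono: "q m \<le> q (Suc m)"
proof (cases m)
  case 0 then show ?thesis using q_pos[of 1] by simp
next
  case (Suc k) show ?thesis unfolding Suc using q_Suc_Suc_ge[of k] by linarith
qed

lemma q_mono: "m \<le> n \<Longrightarrow> q m \<le> q n"
  using lift_Suc_mono_le[of q] q_Suc_mono by blast

lemma q_ge: "m \<le> q (Suc m)"
proof (induction m)
  case 0 then show ?case by simp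
next
  case (Suc m) then show ?case using q_Suc_Suc_ge[of m] q_pos[of m] by linarith
qed

lemma q_det: "int (p (Suc m)) * int (q m) - int (p m) * int (q (Suc m)) = (-1) ^ m"
proof (induction m)
  case 0 then show ?case by simp
next
  case (Suc m)
  then show ?case by (simp add: algebra_simps)
qed

lemma q_err: "real (q (Suc m)) * err m + real (q m) * err (Suc m) = 1"
proof (induction m)
  case 0 then show ?case by (simp add: err_0 err_1)
next
  case (Suc m)
  then show ?case by (simp add: err_rec algebra_simps)
qed

lemma err_less_inverse: "err m * q (Suc m) < 1"
proof -
  have "0 < real (q m) * err (Suc m)" using q_pos[of m] err_pos[of "Suc m"] by simp
  then show ?thesis using q_err[of m] by (simp add: mult.commute)
qed

text \<open>Partial quotients are at least 1. Bad places of two consecutive levels are compared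
  through the sum of their errors, which must not exceed the error of the level before.\<close>

lemma err_rec_ge: "err (Suc m) + err (Suc (Suc m)) \<le> err m"
proof -
  have "1 * err (Suc m) \<le> real (cf_a \<alpha> (Suc (Suc m))) * err (Suc m)"
    using cf_a_pos[of "Suc m"] err_pos[of "Suc m"] by (intro mult_right_mono) auto
  then show ?thesis by (simp add: err_rec)
qed

text \<open>Write \<open>(k, l)\<close> in the unimodular basis \<open>(q m, p m), (q (m+1), p (m+1))\<close>: for \<open>k < q (m+1)\<close> the two
  coefficients have opposite signs, so the two errors add up.\<close>
lemma best_approximation:
  fixes k l :: int
  assumes "k \<noteq> 0" "\<bar>k\<bar> < int (q (Suc m))"
  shows "err m \<le> \<bar>of_int k * \<alpha> - of_int l\<bar>"
proof -
  define s :: int where "s = (-1) ^ m"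
  have ss: "s * s = 1" by (simp add: s_def flip: power_add)
  define x y where "x = s * (int (p (Suc m)) * k - int (q (Suc m)) * l)"
    and "y = s * (int (q m) * l - int (p m) * k)"
  have det: "int (p (Suc m)) * int (q m) - int (p m) * int (q (Suc m)) = s"
    unfolding s_def by (rule q_det)
  have k: "k = x * int (q m) + y * int (q (Suc m))"
  proof -
    have "x * int (q m) + y * int (q (Suc m)) =
        s * (int (p (Suc m)) * int (q m) - int (p m) * int (q (Suc m))) * k"
      by (simp add: x_def y_def algebra_simps)
    then show ?thesis unfolding det ss by simp
  qed
  have l: "l = x * int (p m) + y * int (p (Suc m))"
  proof -
    have "x * int (p m) + y * int (p (Suc m)) =
        s * (int (p (Suc m)) * int (q m) - int (p m) * int (q (Suc m))) * l"
      by (simp add: x_def y_def algebra_simps)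
    then show ?thesis unfolding det ss by simp
  qed
  have "of_int k * \<alpha> - of_int l
      = of_int x * (q m * \<alpha> - p m) + of_int y * (q (Suc m) * \<alpha> - p (Suc m))"
    by (simp add: k l algebra_simps)
  also have "\<dots> = (-1) ^ m * (of_int x * err m - of_int y * err (Suc m))"
    unfolding q_mult_slope by (simp add: algebra_simps)
  finally have abs_eq: "\<bar>of_int k * \<alpha> - of_int l\<bar> = \<bar>of_int x * err m - of_int y * err (Suc m)\<bar>"
    by (simp add: abs_mult)
  have Q: "0 < int (q m)" "0 < int (q (Suc m))" using q_pos[of m] q_pos[of "Suc m"] by auto
  have x0: "x \<noteq> 0"
  proof
    assume "x = 0"
    then have "\<bar>k\<bar> = \<bar>y\<bar> * int (q (Suc m))" by (simp add: k abs_mult)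
    moreover have "y \<noteq> 0" using assms(1) \<open>x = 0\<close> k by auto
    then have "1 * int (q (Suc m)) \<le> \<bar>y\<bar> * int (q (Suc m))" using Q by (intro mult_right_mono) auto
    ultimately show False using assms(2) by linarith
  qed
  have e: "0 < err m" "0 < err (Suc m)" by (rule err_pos)+
  have "(1 \<le> x \<and> y \<le> 0) \<or> (x \<le> -1 \<and> 0 \<le> y)"
  proof (rule ccontr)
    assume "\<not> ?thesis"
    then have "(1 \<le> x \<and> 1 \<le> y) \<or> (x \<le> -1 \<and> y \<le> -1)" using x0 by linarith
    then show False
    proof
      assume a: "1 \<le> x \<and> 1 \<le> y"
      then have "0 \<le> x * int (q m)" "1 * int (q (Suc m)) \<le> y * int (q (Suc m))"
        using Q by (auto intro!: mult_right_mono)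
      then show False using k assms(2) by linarith
    next
      assume a: "x \<le> -1 \<and> y \<le> -1"
      then have "0 \<le> (- x) * int (q m)" "1 * int (q (Suc m)) \<le> (- y) * int (q (Suc m))"
        using Q by (auto intro!: mult_right_mono simp: mult_nonneg_nonneg simp del: mult_minus_left)
      then show False using k assms(2) by simp
    qed
  qed
  then show ?thesis
  proof
    assume a: "1 \<le> x \<and> y \<le> 0"
    then have "1 * err m \<le> of_int x * err m" "of_int y * err (Suc m) \<le> 0"
      using e by (auto intro!: mult_right_mono simp: mult_nonpos_nonneg)
    then show ?thesis unfolding abs_eq by linarith
  next
    assume a: "x \<le> -1 \<and> 0 \<le> y"
    then have "of_int x * err m \<le> (-1) * err m" "0 \<le> of_int y * err (Suc m)"
      using e by (auto intro!: mult_right_mono simp del: mult_minus1 mult_minus_left)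
    then show ?thesis unfolding abs_eq by linarith
  qed
qed

end

section \<open>Local periods of Sturmian words\<close>

text \<open>Adding \<open>\<beta>\<close> raises the floor exactly when the fractional part lies in
  \<open>[1 - \<beta>, 1)\<close>. In this form, periods and approximations reduce to comparing
  single floor values.\<close>

lemma sturm_v_floor:
  assumes "0 < \<beta>" "\<beta> < 1"
  shows "sturm_v \<beta> \<theta> n = of_int (\<lfloor>of_int (n + 1) * \<beta> + \<theta>\<rfloor> - \<lfloor>of_int n * \<beta> + \<theta>\<rfloor>)"
proof -
  define x where "x = of_int n * \<beta> + \<theta>"
  have e: "of_int (n + 1) * \<beta> + \<theta> = x + \<beta>" by (simp add: x_def algebra_simps)
  show ?thesis
  proof (cases "1 - \<beta> \<le> frac x")
    case True
    then have "\<lfloor>x + \<beta>\<rfloor> = \<lfloor>x\<rfloor> + 1"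
      using assms unfolding frac_def by linarith
    then show ?thesis unfolding e sturm_v_def x_def[symmetric] using True frac_lt_1[of x] by simp
  next
    case False
    then have "\<lfloor>x + \<beta>\<rfloor> = \<lfloor>x\<rfloor>"
      using assms unfolding frac_def by linarith
    then show ?thesis unfolding e sturm_v_def x_def[symmetric] using False by simp
  qed
qed

lemma sturm_v_add: "sturm_v \<beta> \<theta> (i + j) = sturm_v \<beta> (\<theta> + of_int i * \<beta>) j"
  by (simp add: sturm_v_def algebra_simps)

lemma sturm_v_bounds: "0 \<le> sturm_v \<beta> \<theta> n" "sturm_v \<beta> \<theta> n \<le> 1"
  by (simp_all add: sturm_v_def)

section \<open>Places where translation by a convergent denominator fails\<close>

context irrational_slope
begin

lemma slope_multiple_not_int: "of_int k * \<alpha> = of_int l \<Longrightarrow> k = 0"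
proof (rule ccontr)
  assume "of_int k * \<alpha> = of_int l" "k \<noteq> 0"
  then have "\<alpha> = of_int l / of_int k" by (simp add: field_simps)
  then show False using irrational by (metis Rats_divide Rats_of_int)
qed

lemma err_less_1: "err m < 1"
  using err_decreasing[of 0 m] err_0 slope_less_1 by (cases m) auto

definition fl :: "real \<Rightarrow> int \<Rightarrow> int" where "fl \<theta> k = \<lfloor>of_int k * \<alpha> + \<theta>\<rfloor>"

lemma sturm_v_fl: "sturm_v \<alpha> \<theta> n = of_int (fl \<theta> (n + 1) - fl \<theta> n)"
  unfolding fl_def by (rule sturm_v_floor[OF slope_pos slope_less_1])

text \<open>\<open>bad m \<theta> k\<close>: translation by \<open>q m\<close> does not commute with the floor at \<open>k\<close>. The Sturmian word has
  the local period \<open>q m\<close> away from these rare places.\<close>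
definition bad :: "nat \<Rightarrow> real \<Rightarrow> int \<Rightarrow> bool" where
  "bad m \<theta> k \<longleftrightarrow> fl \<theta> (k + int (q m)) \<noteq> fl \<theta> k + int (p m)"

text \<open>Modulo integers, translation by \<open>q m\<close> moves the orbit point up by
  \<open>err m\<close> for even \<open>m\<close> and down by \<open>err m\<close> for odd
  \<open>m\<close>. A bad place is thus a visit to a half-open interval of length
  \<open>err m\<close> on one fixed side of the integers.\<close>

lemma bad_even:
  assumes "even m"
  shows "bad m \<theta> k \<longleftrightarrow> (\<exists>l. of_int l - err m \<le> of_int k * \<alpha> + \<theta> \<and> of_int k * \<alpha> + \<theta> < of_int l)"
proof -
  define x where "x = of_int k * \<alpha> + \<theta>"
  have e: "of_int (k + int (q m)) * \<alpha> + \<theta> = x + err m + of_int (int (p m))"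
    using q_mult_slope_even[OF assms] by (simp add: x_def algebra_simps)
  have b: "bad m \<theta> k \<longleftrightarrow> \<lfloor>x + err m\<rfloor> \<noteq> \<lfloor>x\<rfloor>"
    unfolding bad_def fl_def e floor_add_int[symmetric] by (simp add: x_def)
  show ?thesis unfolding b x_def[symmetric]
  proof
    assume "\<lfloor>x + err m\<rfloor> \<noteq> \<lfloor>x\<rfloor>"
    then have "of_int (\<lfloor>x\<rfloor> + 1) - err m \<le> x \<and> x < of_int (\<lfloor>x\<rfloor> + 1)"
      using err_pos[of m] by linarith
    then show "\<exists>l. of_int l - err m \<le> x \<and> x < of_int l" by blast
  next
    assume "\<exists>l. of_int l - err m \<le> x \<and> x < of_int l"
    then obtain l :: int where "of_int l - err m \<le> x" "x < of_int l" by blast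
    then have "l \<le> \<lfloor>x + err m\<rfloor>" "\<lfloor>x\<rfloor> < l" by (simp_all add: le_floor_iff floor_less_iff)
    then show "\<lfloor>x + err m\<rfloor> \<noteq> \<lfloor>x\<rfloor>" by simp
  qed
qed

lemma bad_odd:
  assumes "odd m"
  shows "bad m \<theta> k \<longleftrightarrow> (\<exists>l. of_int l \<le> of_int k * \<alpha> + \<theta> \<and> of_int k * \<alpha> + \<theta> < of_int l + err m)"
proof -
  define x where "x = of_int k * \<alpha> + \<theta>"
  have e: "of_int (k + int (q m)) * \<alpha> + \<theta> = x - err m + of_int (int (p m))"
    using q_mult_slope_odd[OF assms] by (simp add: x_def algebra_simps)
  have b: "bad m \<theta> k \<longleftrightarrow> \<lfloor>x - err m\<rfloor> \<noteq> \<lfloor>x\<rfloor>"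
    unfolding bad_def fl_def e floor_add_int[symmetric] by (simp add: x_def)
  show ?thesis unfolding b x_def[symmetric]
  proof
    assume "\<lfloor>x - err m\<rfloor> \<noteq> \<lfloor>x\<rfloor>"
    then have "of_int \<lfloor>x\<rfloor> \<le> x \<and> x < of_int \<lfloor>x\<rfloor> + err m"
      using err_pos[of m] by linarith
    then show "\<exists>l. of_int l \<le> x \<and> x < of_int l + err m" by blast
  next
    assume "\<exists>l. of_int l \<le> x \<and> x < of_int l + err m"
    then obtain l :: int where "of_int l \<le> x" "x < of_int l + err m" by blast
    then have "l \<le> \<lfloor>x\<rfloor>" "\<lfloor>x - err m\<rfloor> < l" by (simp_all add: le_floor_iff floor_less_iff)
    then show "\<lfloor>x - err m\<rfloor> \<noteq> \<lfloor>x\<rfloor>" by simp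
  qed
qed

text \<open>Two visits to the same interval of length \<open>err m\<close> have a difference of
  positions that approximates an integer better than \<open>err m\<close>, so
  \<open>best_approximation\<close> bounds it from below.\<close>

lemma bad_gap:
  assumes "bad m \<theta> k" "bad m \<theta> k'" "k < k'"
  shows "int (q (Suc m)) \<le> k' - k"
proof (rule ccontr)
  assume n: "\<not> ?thesis"
  have "\<exists>l l'. \<bar>(of_int k' * \<alpha> + \<theta> - of_int l') - (of_int k * \<alpha> + \<theta> - of_int l)\<bar> < err m"
  proof (cases "even m")
    case True
    obtain l l' where "of_int l - err m \<le> of_int k * \<alpha> + \<theta>" "of_int k * \<alpha> + \<theta> < of_int l"
      "of_int l' - err m \<le> of_int k' * \<alpha> + \<theta>" "of_int k' * \<alpha> + \<theta> < of_int l'"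
      using assms(1,2) bad_even[OF True] by meson
    then show ?thesis by (intro exI[of _ l] exI[of _ l']) linarith
  next
    case False
    obtain l l' where "of_int l \<le> of_int k * \<alpha> + \<theta>" "of_int k * \<alpha> + \<theta> < of_int l + err m"
      "of_int l' \<le> of_int k' * \<alpha> + \<theta>" "of_int k' * \<alpha> + \<theta> < of_int l' + err m"
      using assms(1,2) bad_odd[OF False] by meson
    then show ?thesis by (intro exI[of _ l] exI[of _ l']) linarith
  qed
  then obtain l l' where "\<bar>(of_int k' * \<alpha> + \<theta> - of_int l') - (of_int k * \<alpha> + \<theta> - of_int l)\<bar> < err m" by blast
  then have "\<bar>of_int (k' - k) * \<alpha> - of_int (l' - l)\<bar> < err m" by (simp add: algebra_simps)
  moreover have "err m \<le> \<bar>of_int (k' - k) * \<alpha> - of_int (l' - l)\<bar>"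
    using assms(3) n by (intro best_approximation) auto
  ultimately show False by simp
qed

lemma sturm_v_period: "\<not> bad m \<theta> k \<Longrightarrow> \<not> bad m \<theta> (k + 1) \<Longrightarrow> sturm_v \<alpha> \<theta> (k + int (q m)) = sturm_v \<alpha> \<theta> k"
  unfolding sturm_v_fl bad_def by (simp add: algebra_simps)

text \<open>With phase 0 the orbit starts at an integer, so a bad \<open>k\<close> would itself be a
  denominator of a good approximation.\<close>

lemma bad_zero_phase:
  assumes "bad m 0 k" "1 \<le> k"
  shows "int (q (Suc m)) \<le> k"
proof (rule ccontr)
  assume n: "\<not> ?thesis"
  have ge: "err m \<le> \<bar>of_int k * \<alpha> - of_int l\<bar>" for l
    using n assms(2) by (intro best_approximation) auto
  show False
  proof (cases "even m")
    case True
    then obtain l where l: "of_int l - err m \<le> of_int k * \<alpha>" "of_int k * \<alpha> < of_int l"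
      using assms(1) bad_even[OF True] by auto
    \<comment> \<open>The bad interval is closed at this end, so equality with \<open>err m\<close>
      survives \<open>best_approximation\<close>; irrationality excludes it.\<close>
    then have "of_int k * \<alpha> = of_int l - err m" using ge[of l] by linarith
    then have "of_int (k + int (q m)) * \<alpha> = of_int (l + int (p m))"
      using q_mult_slope_even[OF True] by (simp add: algebra_simps)
    then have "k + int (q m) = 0" by (rule slope_multiple_not_int)
    then show False using assms(2) by simp
  next
    case False
    then obtain l where l: "of_int l \<le> of_int k * \<alpha>" "of_int k * \<alpha> < of_int l + err m"
      using assms(1) bad_odd[OF False] by auto
    then show False using ge[of l] by linarith
  qed
qed

text \<open>The bad intervals of consecutive levels lie on opposite sides of the integers. The
  difference therefore has a sign fixed by the parity, and only the two lengths together bound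
  it.\<close>

lemma bad_difference:
  assumes "bad m \<theta> k" "bad (Suc m) \<theta> k'"
  shows "\<exists>l t. 0 < t \<and> t < err m + err (Suc m) \<and> of_int (k' - k) * \<alpha> - of_int l = (-1) ^ m * t"
proof (cases "even m")
  case True
  then have o: "odd (Suc m)" by simp
  obtain l l' where "of_int l - err m \<le> of_int k * \<alpha> + \<theta>" "of_int k * \<alpha> + \<theta> < of_int l"
      "of_int l' \<le> of_int k' * \<alpha> + \<theta>" "of_int k' * \<alpha> + \<theta> < of_int l' + err (Suc m)"
    using assms bad_even[OF True] bad_odd[OF o] by meson
  then show ?thesis using True
    by (intro exI[of _ "l' - l"] exI[of _ "of_int (k' - k) * \<alpha> - of_int (l' - l)"])
      (auto simp: algebra_simps)
next
  case False
  then have o: "even (Suc m)" by simp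
  obtain l l' where "of_int l \<le> of_int k * \<alpha> + \<theta>" "of_int k * \<alpha> + \<theta> < of_int l + err m"
      "of_int l' - err (Suc m) \<le> of_int k' * \<alpha> + \<theta>" "of_int k' * \<alpha> + \<theta> < of_int l'"
    using assms bad_odd[OF False] bad_even[OF o] by meson
  then show ?thesis using False
    by (intro exI[of _ "l' - l"] exI[of _ "- (of_int (k' - k) * \<alpha> - of_int (l' - l))"])
      (auto simp: algebra_simps)
qed

text \<open>\<open>c\<close> is the centre of a square: every letter of the block of length
  \<open>q m\<close> ending at \<open>c\<close> recurs \<open>q m\<close> places later. A letter
  uses the floors at two places, hence the range up to \<open>c + 1\<close>.\<close>

definition clear :: "nat \<Rightarrow> real \<Rightarrow> int \<Rightarrow> bool" where
  "clear m \<theta> c \<longleftrightarrow> (\<forall>k. c - int (q m) + 1 \<le> k \<longrightarrow> k \<le> c + 1 \<longrightarrow> \<not> bad m \<theta> k)"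

text \<open>The complement of the displacement \<open>k' - k\<close> to \<open>q m\<close> would
  approximate an integer too well for a number of its size, if necessary after removing
  \<open>q (Suc m)\<close>. Only a bad place at the right end \<open>c + 1\<close> is compatible
  with this.\<close>

lemma bad_consecutive_levels:
  fixes c k k' :: int and n :: nat
  defines "m \<equiv> Suc n"
  assumes b: "bad m \<theta> k" "bad (Suc m) \<theta> k'"
    and k: "c - int (q m) + 1 \<le> k" "k \<le> c + 1"
    and k': "c - int (q (Suc m)) + 1 \<le> k'" "k' \<le> c + 1"
  shows "k = c + 1 \<or> k' = c + 1"
proof (rule ccontr)
  assume neg: "\<not> ?thesis"
  obtain l t where t: "0 < t" "t < err m + err (Suc m)"
    and lt: "of_int (k' - k) * \<alpha> - of_int l = (-1) ^ m * t"
    using bad_difference[OF b] by blast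
  have small: "err m + err (Suc m) \<le> err n" unfolding m_def by (rule err_rec_ge)
  define e where "e = int (q m) - (k' - k)"
  have e: "1 \<le> e" "e \<le> int (q m) + int (q (Suc m)) - 1" using k k' neg by (auto simp: e_def)
  have ev: "of_int e * \<alpha> - of_int (int (p m) - l) = (-1) ^ m * (err m - t)"
    using q_mult_slope[of m] lt by (simp add: e_def algebra_simps)
  show False
  proof (cases "e < int (q (Suc m))")
    case True
    then have "err m \<le> \<bar>of_int e * \<alpha> - of_int (int (p m) - l)\<bar>"
      using e by (intro best_approximation) auto
    then have "err m \<le> \<bar>err m - t\<bar>" unfolding ev by (simp add: abs_mult)
    then show False using t err_Suc_less[of m] by linarith
  next
    case False
    define e' where "e' = e - int (q (Suc m))"
    define l' where "l' = int (p m) - l - int (p (Suc m))"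
    have e': "0 \<le> e'" "e' < int (q m)" using False e by (auto simp: e'_def)
    have "of_int e' * \<alpha> - of_int l' = (-1) ^ m * (err m + err (Suc m) - t)"
      using q_mult_slope[of "Suc m"] ev by (simp add: e'_def l'_def algebra_simps)
    then have v: "\<bar>of_int e' * \<alpha> - of_int l'\<bar> = err m + err (Suc m) - t"
      using t by (simp add: abs_mult)
    show False
    proof (cases "e' = 0")
      case True
      then have "\<bar>of_int l'\<bar> = err m + err (Suc m) - t" using v by simp
      then have "0 < real_of_int \<bar>l'\<bar>" "real_of_int \<bar>l'\<bar> < 1"
        unfolding of_int_abs using t small err_less_1[of n] by linarith+
      then have "0 < \<bar>l'\<bar>" "\<bar>l'\<bar> < 1" by (simp_all only: of_int_0_less_iff of_int_less_1_iff)
      then show False by linarith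
    next
      case False
      then have "err n \<le> \<bar>of_int e' * \<alpha> - of_int l'\<bar>"
        using e' by (intro best_approximation) (auto simp: m_def)
      then show False using v t small by linarith
    qed
  qed
qed

text \<open>If all four choices failed, there would be bad places at both \<open>i\<close> and
  \<open>i + 1\<close>. On one level they are too close for \<open>bad_gap\<close>; on different
  levels a single step would approximate an integer to within less than
  \<open>err n\<close>.\<close>

lemma clear_exists:
  assumes "2 \<le> q (Suc n)"
  shows "\<exists>c\<in>{i - 1, i}. \<exists>m\<in>{Suc n, Suc (Suc n)}. clear m \<theta> c"
proof (rule ccontr)
  assume neg: "\<not> ?thesis"
  have *: "\<exists>m\<in>{Suc n, Suc (Suc n)}. bad m \<theta> (c + 1)" if "c \<in> {i - 1, i}" for c
  proof -
    have "\<not> clear (Suc n) \<theta> c" "\<not> clear (Suc (Suc n)) \<theta> c" using neg that by blast+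
    then obtain k k' where "bad (Suc n) \<theta> k" "c - int (q (Suc n)) + 1 \<le> k" "k \<le> c + 1"
      "bad (Suc (Suc n)) \<theta> k'" "c - int (q (Suc (Suc n))) + 1 \<le> k'" "k' \<le> c + 1"
      unfolding clear_def by metis
    then show ?thesis using bad_consecutive_levels[of n \<theta> k k' c] by blast
  qed
  have q2: "2 \<le> q (Suc (Suc n))" "2 \<le> q (Suc (Suc (Suc n)))"
    using assms q_mono[of "Suc n" "Suc (Suc n)"] q_mono[of "Suc n" "Suc (Suc (Suc n))"] by linarith+
  have same: False if "bad m \<theta> (i - 1 + 1)" "bad m \<theta> (i + 1)" "m \<in> {Suc n, Suc (Suc n)}" for m
    using bad_gap[OF that(1,2)] that(3) q2 by auto
  have cross: False if kk: "bad (Suc n) \<theta> k" "bad (Suc (Suc n)) \<theta> k'" "\<bar>k' - k\<bar> = 1" for k k'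
  proof -
    obtain l t where t: "0 < t" "t < err (Suc n) + err (Suc (Suc n))"
      and lt: "of_int (k' - k) * \<alpha> - of_int l = (-1) ^ Suc n * t"
      using bad_difference[OF kk(1,2)] by blast
    have "err n \<le> \<bar>of_int (k' - k) * \<alpha> - of_int l\<bar>"
      using kk(3) assms by (intro best_approximation) auto
    also have "\<dots> = t" unfolding lt using t by (simp add: abs_mult)
    finally show False using t err_rec_ge[of n] by linarith
  qed
  obtain m1 where m1: "m1 \<in> {Suc n, Suc (Suc n)}" "bad m1 \<theta> (i - 1 + 1)" using *[of "i - 1"] by blast
  obtain m2 where m2: "m2 \<in> {Suc n, Suc (Suc n)}" "bad m2 \<theta> (i + 1)" using *[of i] by blast
  show False
  proof (cases "m1 = m2")
    case True then show False using same m1 m2 by blast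
  next
    case False
    then consider "m1 = Suc n" "m2 = Suc (Suc n)" | "m2 = Suc n" "m1 = Suc (Suc n)"
      using m1(1) m2(1) by blast
    then show False
    proof cases
      case 1 then show False using cross[of "i - 1 + 1" "i + 1"] m1(2) m2(2) by simp
    next
      case 2 then show False using cross[of "i + 1" "i - 1 + 1"] m1(2) m2(2) by simp
    qed
  qed
qed

text \<open>The mechanical word of slope \<open>p m / q m\<close> and phase \<open>r / q m\<close>,
  in integer arithmetic so that its period is exact.\<close>

definition per_word :: "nat \<Rightarrow> int \<Rightarrow> int \<Rightarrow> real" where
  "per_word m r j = of_int (((j + 1) * int (p m) + r) div int (q m) - (j * int (p m) + r) div int (q m))"

lemma per_word_period: "per_word m r (j + int (q m)) = per_word m r j"
proof -
  have q0: "int (q m) \<noteq> 0" using q_pos[of m] by simp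
  have e: "(j + int (q m) + 1) * int (p m) + r = ((j + 1) * int (p m) + r) + int (p m) * int (q m)"
    "(j + int (q m)) * int (p m) + r = (j * int (p m) + r) + int (p m) * int (q m)"
    by (simp_all add: algebra_simps)
  show ?thesis unfolding per_word_def e div_mult_self1[OF q0] by simp
qed

lemma bezout: "\<exists>s w. r = s * int (p (Suc m)) + w * int (q (Suc m))"
proof -
  have "r = r * (-1) ^ m * (int (p (Suc m)) * int (q m) - int (p m) * int (q (Suc m)))"
    unfolding q_det by (simp add: mult.assoc flip: power_add)
  also have "\<dots> = (r * (-1) ^ m * int (q m)) * int (p (Suc m)) + (- r * (-1) ^ m * int (p m)) * int (q (Suc m))"
    by (simp add: algebra_simps)
  finally show ?thesis by blast
qed

text \<open>\<open>p\<close> and \<open>q\<close> are coprime, so modulo \<open>q\<close> every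
  integer phase is reached from phase 0 by a translation. This is why \<open>clear_trace\<close>
  yields one trace for all clear blocks of a level.\<close>

lemma per_word_shift: "\<exists>s. \<forall>j. per_word (Suc m) r j = per_word (Suc m) 0 (j + s)"
proof -
  obtain s w where r: "r = s * int (p (Suc m)) + w * int (q (Suc m))" using bezout by blast
  have q0: "int (q (Suc m)) \<noteq> 0" using q_pos[of "Suc m"] by simp
  have "per_word (Suc m) r j = per_word (Suc m) 0 (j + s)" for j
  proof -
    have "(j + 1) * int (p (Suc m)) + r = ((j + s + 1) * int (p (Suc m)) + 0) + w * int (q (Suc m))"
      "j * int (p (Suc m)) + r = ((j + s) * int (p (Suc m)) + 0) + w * int (q (Suc m))"
      by (simp_all add: r algebra_simps)
    then show ?thesis unfolding per_word_def using q0 by simp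
  qed
  then show ?thesis by blast
qed

text \<open>Replacing \<open>\<alpha>\<close> by \<open>p m / q m\<close> moves the points by at
  most \<open>err m\<close>, always in the same direction because the motion is measured from the
  right end \<open>c + 1\<close>. If it crossed an integer, the place would be bad.\<close>

lemma clear_per_word:
  assumes "clear m \<theta> c"
  shows "\<exists>r. \<forall>j. c - int (q m) < j \<longrightarrow> j \<le> c \<longrightarrow> sturm_v \<alpha> \<theta> j = per_word m r j"
proof -
  define Q where "Q = real (q m)"
  have Q: "0 < Q" using q_pos[of m] by (simp add: Q_def)
  define x where "x = of_int (c + 1) * \<alpha> + \<theta>"
  \<comment> \<open>The phase of the rational rotation that starts at the orbit point of
    \<open>c + 1\<close>, rounded down to a multiple of \<open>1 / q m\<close>.\<close>
  define r where "r = \<lfloor>Q * x\<rfloor> - (c + 1) * int (p m)"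
  have main: "fl \<theta> k = (k * int (p m) + r) div int (q m)"
    if k: "c + 1 - int (q m) \<le> k" "k \<le> c + 1" for k
  proof -
    define t where "t = real_of_int (c + 1 - k)"
    define y where "y = x - t * real (p m) / Q"
    define s where "s = t * err m / Q"
    have t: "0 \<le> t" "t \<le> Q" using k by (auto simp: t_def Q_def)
    have s: "0 \<le> s" "s \<le> err m"
      using t Q err_pos[of m] by (auto simp: s_def field_simps mult_right_mono)
    have nb: "\<not> bad m \<theta> k" using assms k unfolding clear_def by auto
    have kx: "of_int k * \<alpha> + \<theta> = x - t * \<alpha>" by (simp add: x_def t_def algebra_simps)
    have "\<lfloor>y\<rfloor> = \<lfloor>Q * x - of_int ((c + 1 - k) * int (p m))\<rfloor> div int (q m)"
    proof -
      have "y = (Q * x - of_int ((c + 1 - k) * int (p m))) / of_int (int (q m))"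
        using Q by (simp add: y_def t_def Q_def field_simps)
      then show ?thesis using floor_divide_real_eq_div[of "int (q m)"] by simp
    qed
    also have "\<lfloor>Q * x - of_int ((c + 1 - k) * int (p m))\<rfloor> = k * int (p m) + r"
      unfolding floor_diff_of_int r_def by (simp add: algebra_simps)
    finally have fy: "\<lfloor>y\<rfloor> = (k * int (p m) + r) div int (q m)" .
    have "fl \<theta> k = \<lfloor>y\<rfloor>"
    proof (cases "even m")
      case True
      have a: "\<alpha> = real (p m) / Q + err m / Q"
        using q_mult_slope_even[OF True] Q by (simp add: Q_def field_simps)
      have "t * \<alpha> = t * (real (p m) / Q + err m / Q)" using a by (rule arg_cong)
      then have ky: "of_int k * \<alpha> + \<theta> = y - s" unfolding kx y_def s_def by (simp add: algebra_simps)
      show ?thesis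
      proof (rule ccontr)
        assume "fl \<theta> k \<noteq> \<lfloor>y\<rfloor>"
        then have "\<lfloor>y - s\<rfloor> \<noteq> \<lfloor>y\<rfloor>" unfolding fl_def ky .
        then have "of_int \<lfloor>y\<rfloor> - err m \<le> y - s \<and> y - s < of_int \<lfloor>y\<rfloor>" using s by linarith
        then have "bad m \<theta> k" unfolding bad_even[OF True] ky by blast
        then show False using nb by simp
      qed
    next
      case False
      have a: "\<alpha> = real (p m) / Q - err m / Q"
        using q_mult_slope_odd[OF False] Q by (simp add: Q_def field_simps)
      have "t * \<alpha> = t * (real (p m) / Q - err m / Q)" using a by (rule arg_cong)
      then have ky: "of_int k * \<alpha> + \<theta> = y + s" unfolding kx y_def s_def by (simp add: algebra_simps)
      show ?thesis
      proof (rule ccontr)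
        assume "fl \<theta> k \<noteq> \<lfloor>y\<rfloor>"
        then have "\<lfloor>y + s\<rfloor> \<noteq> \<lfloor>y\<rfloor>" unfolding fl_def ky .
        then have "of_int \<lfloor>y + s\<rfloor> \<le> y + s \<and> y + s < of_int \<lfloor>y + s\<rfloor> + err m" using s by linarith
        then have "bad m \<theta> k" unfolding bad_odd[OF False] ky by blast
        then show False using nb by simp
      qed
    qed
    then show ?thesis using fy by simp
  qed
  have "sturm_v \<alpha> \<theta> j = per_word m r j" if "c - int (q m) < j" "j \<le> c" for j
    unfolding sturm_v_fl per_word_def using main[of j] main[of "j + 1"] that by simp
  then show ?thesis by blast
qed

lemma p_less_q: "2 \<le> m \<Longrightarrow> p m < q m"
proof -
  \<comment> \<open>Equality is possible at \<open>m = 1\<close>, namely if the first partial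
    quotient is 1; the induction has to carry this exception.\<close>
  have "p m \<le> q m \<and> (m \<noteq> 1 \<longrightarrow> p m < q m)" for m
  proof (induction m rule: induct_nat_012)
    case 1 then show ?case using q_pos[of 1] by simp
  next
    case (ge2 n)
    let ?a = "cf_a \<alpha> (Suc (Suc n))"
    have a: "1 \<le> ?a" by (rule cf_a_pos)
    have "?a * p (Suc n) + p n < ?a * q (Suc n) + q n"
    proof (cases "n = 1")
      case True
      then have "p (Suc n) < q (Suc n)" "p n \<le> q n" using ge2 by auto
      moreover from this a have "?a * p (Suc n) < ?a * q (Suc n)" by simp
      ultimately show ?thesis by linarith
    next
      case False
      then have "p n < q n" "p (Suc n) \<le> q (Suc n)" using ge2 by auto
      moreover from this have "?a * p (Suc n) \<le> ?a * q (Suc n)" by simp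
      ultimately show ?thesis by linarith
    qed
    then show ?case by simp
  qed simp
  then show "2 \<le> m \<Longrightarrow> p m < q m" by auto
qed

lemma p_pos: "1 \<le> m \<Longrightarrow> 1 \<le> p m"
proof -
  have "1 \<le> p (Suc m)" for m
  proof (induction m)
    case (Suc m) then show ?case using cf_a_pos[of "Suc m"] by (simp add: add_increasing2)
  qed simp
  then show "1 \<le> m \<Longrightarrow> 1 \<le> p m" by (cases m) auto
qed

lemma cf_approx_bounds: "2 \<le> m \<Longrightarrow> 0 < cf_approx \<alpha> m" "2 \<le> m \<Longrightarrow> cf_approx \<alpha> m < 1"
  using p_less_q[of m] p_pos[of m] by (auto simp: cf_approx_def)

lemma sturm_v_approx: "2 \<le> m \<Longrightarrow> sturm_v (cf_approx \<alpha> m) 0 j = per_word m 0 j"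
proof -
  assume m: "2 \<le> m"
  have f: "\<lfloor>of_int k * cf_approx \<alpha> m + 0\<rfloor> = (k * int (p m) + 0) div int (q m)" for k
  proof -
    have "of_int k * cf_approx \<alpha> m + 0 = of_int (k * int (p m)) / real_of_int (int (q m))"
      by (simp add: cf_approx_def)
    then show ?thesis using floor_divide_of_int_eq by (metis add_0_right)
  qed
  show ?thesis unfolding per_word_def sturm_v_floor[OF cf_approx_bounds[OF m]] f ..
qed

text \<open>The phases with a given floor pattern form a half-open interval starting at the largest
  jump point \<open>a j\<close>. Jump points differ modulo integers by multiples
  \<open>(j1 - j) * \<alpha>\<close> with \<open>\<bar>j1 - j\<bar> < q (Suc N)\<close>, so by
  \<open>best_approximation\<close> the next one is at least \<open>err N\<close> away.\<close>

lemma floor_pattern_interval: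
  "\<exists>A. \<forall>z. A \<le> z \<longrightarrow> z < A + err N \<longrightarrow>
    (\<forall>j::int. 0 \<le> j \<longrightarrow> j < int (q (Suc N)) \<longrightarrow> \<lfloor>z + of_int j * \<alpha>\<rfloor> = \<lfloor>y + of_int j * \<alpha>\<rfloor>)"
proof -
  define J where "J = {0..<int (q (Suc N))}"
  define a where "a j = of_int \<lfloor>y + of_int j * \<alpha>\<rfloor> - of_int j * \<alpha>" for j :: int
  define A where "A = Max (a ` J)"
  have J: "finite (a ` J)" "a ` J \<noteq> {}" using q_pos[of "Suc N"] by (auto simp: J_def)
  obtain j1 where j1: "j1 \<in> J" "A = a j1" using Max_in[OF J] unfolding A_def by blast
  have le: "a j \<le> A" if "j \<in> J" for j unfolding A_def using J that by simp
  have "\<lfloor>z + of_int j * \<alpha>\<rfloor> = \<lfloor>y + of_int j * \<alpha>\<rfloor>"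
    if z: "A \<le> z" "z < A + err N" and j: "j \<in> J" for z j
  proof (rule floor_unique)
    show "of_int \<lfloor>y + of_int j * \<alpha>\<rfloor> \<le> z + of_int j * \<alpha>"
      using le[OF j] z(1) by (simp add: a_def)
    show "z + of_int j * \<alpha> < of_int \<lfloor>y + of_int j * \<alpha>\<rfloor> + 1"
    proof (rule ccontr)
      assume neg: "\<not> ?thesis"
      define d where "d = (a j + 1) - a j1"
      have "y < a j + 1" "a j1 \<le> y" unfolding a_def by linarith+
      then have d0: "0 < d" by (simp add: d_def)
      have dN: "d < err N" using neg z(2) j1(2) by (simp add: d_def a_def)
      have d: "d = of_int (j1 - j) * \<alpha> - of_int (\<lfloor>y + of_int j1 * \<alpha>\<rfloor> - \<lfloor>y + of_int j * \<alpha>\<rfloor> - 1)"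
        by (simp add: d_def a_def algebra_simps)
      show False
      proof (cases "j1 = j")
        case True
        then show False using dN err_less_1[of N] by (simp add: d_def)
      next
        case False
        then have "err N \<le> \<bar>d\<bar>" unfolding d
          using j j1(1) by (intro best_approximation) (auto simp: J_def)
        then show False using d0 dN by simp
      qed
    qed
  qed
  then show ?thesis unfolding J_def by (intro exI[of _ A]) auto
qed

text \<open>A move by \<open>q N\<close> in one direction lowers the orbit point by
  \<open>err N\<close>, a move by \<open>q (Suc N)\<close> in the opposite direction lowers it by
  \<open>err (Suc N)\<close>. The block length is what guarantees that at least one of the moves
  stays inside.\<close>

lemma orbit_neighbour:
  assumes "X \<le> n" "n < X + int (q (Suc N)) + int (q N)"
  shows "\<exists>n' t i. X \<le> n' \<and> n' < X + int (q (Suc N)) + int (q N) \<and> 0 < t \<and> t \<le> err N \<and>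
    of_int n' * \<alpha> = of_int n * \<alpha> - t + of_int i"
proof -
  have e: "0 < err N" "0 < err (Suc N)" "err (Suc N) \<le> err N"
    using err_pos err_Suc_less[of N] by (auto intro: less_imp_le)
  show ?thesis
  proof (cases "even N")
    case True
    note qa = q_mult_slope_even[OF True] q_mult_slope_odd[of "Suc N"]
    show ?thesis
    proof (cases "X + int (q N) \<le> n")
      case t: True
      then show ?thesis using assms e qa
        by (intro exI[of _ "n - int (q N)"] exI[of _ "err N"] exI[of _ "- int (p N)"])
          (simp add: algebra_simps)
    next
      case False
      then show ?thesis using assms e qa True
        by (intro exI[of _ "n + int (q (Suc N))"] exI[of _ "err (Suc N)"] exI[of _ "int (p (Suc N))"])
          (simp add: algebra_simps del: cf_q.simps cf_p.simps)
    qed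
  next
    case False
    note qa = q_mult_slope_odd[OF False] q_mult_slope_even[of "Suc N"]
    show ?thesis
    proof (cases "n < X + int (q (Suc N))")
      case t: True
      then show ?thesis using assms e qa
        by (intro exI[of _ "n + int (q N)"] exI[of _ "err N"] exI[of _ "int (p N)"])
          (simp add: algebra_simps)
    next
      case f: False
      then show ?thesis using assms e qa False
        by (intro exI[of _ "n - int (q (Suc N))"] exI[of _ "err (Suc N)"] exI[of _ "- int (p (Suc N))"])
          (simp add: algebra_simps del: cf_q.simps cf_p.simps)
    qed
  qed
qed

text \<open>Minimise the fractional part of \<open>A - \<theta> + n * \<alpha>\<close> over the
  block. The lower neighbour from \<open>orbit_neighbour\<close> would have a smaller one unless it
  drops below an integer, and the size of this drop is the required offset from
  \<open>A\<close>.\<close>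

lemma orbit_hits_interval:
  "\<exists>n l. X \<le> n \<and> n < X + int (q (Suc N)) + int (q N) \<and>
     A \<le> \<theta> - of_int n * \<alpha> - of_int l \<and> \<theta> - of_int n * \<alpha> - of_int l < A + err N"
proof -
  define I where "I = {X..<X + int (q (Suc N)) + int (q N)}"
  define f where "f n = frac (A - \<theta> + of_int n * \<alpha>)" for n :: int
  have I: "finite (f ` I)" "f ` I \<noteq> {}" using q_pos[of N] by (auto simp: I_def)
  obtain n where n: "n \<in> I" "Min (f ` I) = f n" using Min_in[OF I] by blast
  have mn: "f n \<le> f k" if "k \<in> I" for k using I that n(2) by (metis Min_le imageI)
  define i0 where "i0 = \<lfloor>A - \<theta> + of_int n * \<alpha>\<rfloor>"
  have fn: "A - \<theta> + of_int n * \<alpha> = of_int i0 + f n" by (simp add: f_def frac_def i0_def)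
  have f0: "0 \<le> f n" "f n < 1" by (simp_all add: f_def frac_lt_1)
  show ?thesis
  proof (cases "f n = 0")
    case True
    then show ?thesis using fn n(1) err_pos[of N]
      by (intro exI[of _ n] exI[of _ "- i0"]) (auto simp: I_def)
  next
    case False
    obtain n' t i where n': "n' \<in> I" "0 < t" "t \<le> err N"
      "of_int n' * \<alpha> = of_int n * \<alpha> - t + of_int i"
      using orbit_neighbour[of X n N] n(1) by (auto simp: I_def)
    have v: "A - \<theta> + of_int n' * \<alpha> = of_int (i0 + i) + (f n - t)" using n'(4) fn by simp
    have lt: "f n < t"
    proof (rule ccontr)
      assume "\<not> f n < t"
      then have fl: "\<lfloor>A - \<theta> + of_int n' * \<alpha>\<rfloor> = i0 + i"
        unfolding v using f0 n'(2) by (intro floor_unique) auto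
      have "f n' = f n - t" unfolding f_def[of n'] frac_def fl using v by simp
      then show False using mn[OF n'(1)] n'(2) by simp
    qed
    then show ?thesis using v n' False f0
      by (intro exI[of _ n'] exI[of _ "- i0 - i"]) (auto simp: I_def)
  qed
qed

text \<open>The orbit is run backwards because \<open>- n\<close> will be the left end of a finite
  section. The range of \<open>n\<close> matters in \<open>fsm_necessary\<close>: it limits how far
  the section can extend beyond the matched word.\<close>

lemma sturm_v_recurrence:
  "\<exists>n. X \<le> n \<and> n < X + int (q (Suc N)) + int (q N) \<and>
     (\<forall>j. 0 \<le> j \<longrightarrow> j \<le> int (q (Suc N)) - 2 \<longrightarrow> sturm_v \<alpha> \<theta> (- n + j) = sturm_v \<alpha> y j)"
proof -
  obtain A where A: "\<And>z j. A \<le> z \<Longrightarrow> z < A + err N \<Longrightarrow> 0 \<le> j \<Longrightarrow> j < int (q (Suc N)) \<Longrightarrow>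
      \<lfloor>z + of_int j * \<alpha>\<rfloor> = \<lfloor>y + of_int j * \<alpha>\<rfloor>"
    using floor_pattern_interval[of N y] by blast
  obtain n l where n: "X \<le> n" "n < X + int (q (Suc N)) + int (q N)"
    "A \<le> \<theta> - of_int n * \<alpha> - of_int l" "\<theta> - of_int n * \<alpha> - of_int l < A + err N"
    using orbit_hits_interval by blast
  have F: "fl \<theta> (- n + j) = fl y j + l" if "0 \<le> j" "j < int (q (Suc N))" for j
  proof -
    have "of_int (- n + j) * \<alpha> + \<theta> = (\<theta> - of_int n * \<alpha> - of_int l + of_int j * \<alpha>) + of_int l"
      by (simp add: algebra_simps)
    then have "fl \<theta> (- n + j) = \<lfloor>\<theta> - of_int n * \<alpha> - of_int l + of_int j * \<alpha>\<rfloor> + l"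
      unfolding fl_def by (metis floor_add_int)
    then show ?thesis using A[OF n(3,4) that] by (simp add: fl_def add.commute)
  qed
  have "sturm_v \<alpha> \<theta> (- n + j) = sturm_v \<alpha> y j" if "0 \<le> j" "j \<le> int (q (Suc N)) - 2" for j
    unfolding sturm_v_fl using F[of j] F[of "j + 1"] that by (simp add: algebra_simps)
  then show ?thesis using n by blast
qed

section \<open>Words of the approximants and of the irrational slope\<close>

lemma cf_approx_dist: "\<bar>\<alpha> - cf_approx \<alpha> m\<bar> = err m / real (q m)"
proof -
  have q0: "0 < real (q m)" using q_pos[of m] by simp
  have "\<alpha> - cf_approx \<alpha> m = (-1) ^ m * err m / real (q m)"
    using q_mult_slope[of m] q0 by (simp add: cf_approx_def field_simps)
  then show ?thesis using err_pos[of m] q0 by (simp add: abs_mult)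
qed

text \<open>Over \<open>L\<close> letters the two rotations drift apart by less than half the
  spacing \<open>1 / q m\<close> of the rational orbit.\<close>

lemma approx_window_is_sturmian:
  assumes m: "2 \<le> m" and L: "2 * L < int (q (Suc m))" "0 \<le> L"
  shows "\<exists>y. \<forall>j. 0 \<le> j \<longrightarrow> j < L \<longrightarrow> sturm_v (cf_approx \<alpha> m) 0 (k + j) = sturm_v \<alpha> y j"
proof -
  define \<beta> where "\<beta> = cf_approx \<alpha> m"
  define g where "g = \<bar>\<alpha> - \<beta>\<bar>"
  \<comment> \<open>Raising the phase by the maximal drift keeps the irrational orbit at or above
    the rational one, where the floor does not change before the next multiple of
    \<open>1 / q m\<close>.\<close>
  define y where "y = of_int k * \<beta> + of_int L * g"
  have q0: "0 < real (q m)" using q_pos[of m] by simp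
  have g: "g * real (q m) = err m" using q0 by (simp add: g_def \<beta>_def cf_approx_dist)
  have F: "fl y j = \<lfloor>of_int (k + j) * \<beta> + 0\<rfloor>" if j: "0 \<le> j" "j \<le> L" for j
  proof -
    define s where "s = of_int L * g + of_int j * (\<alpha> - \<beta>)"
    have e: "of_int j * \<alpha> + y = of_int (k + j) * \<beta> + s" by (simp add: y_def s_def algebra_simps)
    have "\<bar>of_int j * (\<alpha> - \<beta>)\<bar> \<le> of_int L * g"
      unfolding abs_mult g_def using j by (intro mult_mono) auto
    then have s: "0 \<le> s" "s \<le> 2 * of_int L * g" unfolding s_def mult.assoc by linarith+
    have "s * real (q m) \<le> 2 * of_int L * (g * real (q m))" using s(2) q0 by simp
    also have "\<dots> \<le> of_int (int (q (Suc m))) * err m"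
    proof -
      have "2 * real_of_int L \<le> of_int (int (q (Suc m)))" using L(1) by linarith
      then show ?thesis unfolding g using err_pos[of m] by (intro mult_right_mono) auto
    qed
    also have "\<dots> < 1" using err_less_inverse[of m] by (simp add: mult.commute)
    finally have sq: "s * real (q m) < 1" .
    have "of_int (k + j) * \<beta> + s = (of_int ((k + j) * int (p m)) + s * real (q m)) / of_int (int (q m))"
      using q0 by (simp add: \<beta>_def cf_approx_def field_simps)
    then have "\<lfloor>of_int (k + j) * \<beta> + s\<rfloor> = \<lfloor>of_int ((k + j) * int (p m)) + s * real (q m)\<rfloor> div int (q m)"
      using floor_divide_real_eq_div[of "int (q m)"] by simp
    also have "\<lfloor>of_int ((k + j) * int (p m)) + s * real (q m)\<rfloor> = (k + j) * int (p m)"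
      using sq s(1) q0 by (intro floor_unique) auto
    also have "(k + j) * int (p m) div int (q m) = \<lfloor>of_int (k + j) * \<beta> + 0\<rfloor>"
    proof -
      have "of_int (k + j) * \<beta> + 0 = of_int ((k + j) * int (p m)) / real_of_int (int (q m))"
        by (simp add: \<beta>_def cf_approx_def)
      then show ?thesis using floor_divide_of_int_eq by metis
    qed
    finally show ?thesis unfolding fl_def e .
  qed
  have "sturm_v (cf_approx \<alpha> m) 0 (k + j) = sturm_v \<alpha> y j" if "0 \<le> j" "j < L" for j
    unfolding sturm_v_fl sturm_v_floor[OF cf_approx_bounds[OF m]]
    using F[of j] F[of "j + 1"] that by (simp add: \<beta>_def add.assoc)
  then show ?thesis by blast
qed

text \<open>The phases of the given word contain an interval whose length \<open>d\<close> depends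
  only on \<open>L\<close>. For large \<open>m\<close> it contains a multiple of
  \<open>1 / q m\<close> well inside, and by coprimality a shift \<open>k\<close> reaches this
  multiple.\<close>

lemma sturmian_window_in_approx:
  "\<exists>M. \<forall>m\<ge>M. \<forall>\<theta>. \<exists>k. \<forall>j. 0 \<le> j \<longrightarrow> j < int L \<longrightarrow> sturm_v (cf_approx \<alpha> m) 0 (k + j) = sturm_v \<alpha> \<theta> j"
proof -
  define d where "d = err (L + 1)"
  have d: "0 < d" by (simp add: d_def err_pos)
  \<comment> \<open>Makes \<open>q m * d\<close> exceed \<open>4 * (L + 1)\<close>, so that a
    quarter of the interval pays for the drift, with the rounding of \<open>s\<close>
    included.\<close>
  define M where "M = nat \<lceil>4 * (real L + 1) / d\<rceil> + 2"
  show ?thesis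
  proof (intro exI[of _ M] allI impI)
    fix m \<theta> assume mM: "M \<le> m"
    then have m2: "2 \<le> m" by (simp add: M_def)
    obtain m' where m': "m = Suc m'" using m2 by (cases m) auto
    have "4 * (real L + 1) / d < real m'" using mM m' unfolding M_def by linarith
    also have "real m' \<le> real (q m)" using q_ge[of m'] m' by simp
    finally have qd: "4 * (real L + 1) < real (q m) * d" using d by (simp add: field_simps)
    define \<beta> where "\<beta> = cf_approx \<alpha> m"
    have q0: "0 < real (q m)" using q_pos[of m] by simp
    have g: "\<bar>\<alpha> - \<beta>\<bar> * real (q m) < 1" unfolding \<beta>_def cf_approx_dist using q0 err_less_1 by simp
    obtain A where A: "\<And>z j. A \<le> z \<Longrightarrow> z < A + d \<Longrightarrow> 0 \<le> j \<Longrightarrow> j < int (q (Suc (L + 1))) \<Longrightarrow>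
        \<lfloor>z + of_int j * \<alpha>\<rfloor> = \<lfloor>\<theta> + of_int j * \<alpha>\<rfloor>"
      using floor_pattern_interval[of "L + 1" \<theta>] unfolding d_def by blast
    define s where "s = \<lceil>real (q m) * (A + d / 4)\<rceil>"
    have s: "real (q m) * (A + d / 4) \<le> of_int s" "of_int s < real (q m) * (A + d / 4) + 1"
      unfolding s_def by linarith+
    obtain k l where kl: "s = k * int (p m) + l * int (q m)" using bezout[of s m'] m' by blast
    have F: "\<lfloor>of_int (k + j) * \<beta> + 0\<rfloor> = fl \<theta> j - l" if j: "0 \<le> j" "j \<le> int L" for j
    proof -
      define z where "z = of_int s / real (q m) + of_int j * (\<beta> - \<alpha>)"
      have e: "of_int (k + j) * \<beta> + 0 = (z + of_int j * \<alpha>) - of_int l"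
        using q0 by (simp add: z_def kl \<beta>_def cf_approx_def field_simps)
      have "\<bar>of_int j * (\<beta> - \<alpha>)\<bar> * real (q m) = of_int j * (\<bar>\<alpha> - \<beta>\<bar> * real (q m))"
        using j by (simp add: abs_mult abs_minus_commute)
      also have "\<dots> \<le> of_int (int L) * 1" using j g by (intro mult_mono) auto
      finally have b: "\<bar>of_int j * (\<beta> - \<alpha>) * real (q m)\<bar> \<le> real L" by (simp add: abs_mult)
      have zq: "z * real (q m) = of_int s + of_int j * (\<beta> - \<alpha>) * real (q m)"
        using q0 by (simp add: z_def field_simps)
      have "A * real (q m) \<le> z * real (q m)"
        unfolding zq using s(1) b qd by (simp add: algebra_simps abs_le_iff)
      then have z1: "A \<le> z" using q0 by simp
      have "z * real (q m) < (A + d) * real (q m)"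
        unfolding zq using s(2) b qd by (simp add: algebra_simps abs_le_iff)
      then have z2: "z < A + d" using q0 by simp
      have "j < int (q (Suc (L + 1)))" using q_ge[of "L + 1"] j by linarith
      from A[OF z1 z2 j(1) this] have "\<lfloor>z + of_int j * \<alpha>\<rfloor> = fl \<theta> j" by (simp add: fl_def add.commute)
      then show ?thesis unfolding e floor_diff_of_int by simp
    qed
    have "sturm_v (cf_approx \<alpha> m) 0 (k + j) = sturm_v \<alpha> \<theta> j" if "0 \<le> j" "j < int L" for j
      unfolding sturm_v_fl sturm_v_floor[OF cf_approx_bounds[OF m2]]
      using F[of j] F[of "j + 1"] that by (simp add: \<beta>_def add.assoc)
    then show "\<exists>k. \<forall>j. 0 \<le> j \<longrightarrow> j < int L \<longrightarrow> sturm_v (cf_approx \<alpha> m) 0 (k + j) = sturm_v \<alpha> \<theta> j" by blast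
  qed
qed

text \<open>Reflection turns floors into ceilings, that is, the half-open coding interval changes
  its closed end. On finitely many places a phase lowered by a small \<open>h\<close> undoes this,
  since the floor then equals the ceiling minus 1.\<close>

lemma sturm_v_reflect:
  "\<exists>y. \<forall>j. 0 \<le> j \<longrightarrow> j \<le> int L \<longrightarrow> sturm_v \<alpha> \<theta> (- j) = sturm_v \<alpha> y j"
proof -
  define z where "z j = of_int (j - 1) * \<alpha> - \<theta>" for j :: int
  define J where "J = {0..int L + 1}"
  define e where "e j = z j - (of_int \<lceil>z j\<rceil> - 1)" for j :: int
  have e0: "0 < e j" for j unfolding e_def by linarith
  define h where "h = Min (e ` J)"
  have J: "finite (e ` J)" "e ` J \<noteq> {}" by (auto simp: J_def)
  have h0: "0 < h" unfolding h_def using Min_in[OF J] e0 by auto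
  have hle: "h \<le> e j" if "j \<in> J" for j unfolding h_def using J that by simp
  define y where "y = - \<alpha> - \<theta> - h"
  have F: "fl y j = - fl \<theta> (1 - j) - 1" if "j \<in> J" for j
  proof -
    have 1: "of_int j * \<alpha> + y = z j - h" by (simp add: y_def z_def algebra_simps)
    have "\<lfloor>z j - h\<rfloor> = \<lceil>z j\<rceil> - 1"
      using hle[OF that] h0 unfolding e_def by (intro floor_unique) (auto, linarith)
    moreover have "of_int (1 - j) * \<alpha> + \<theta> = - z j" by (simp add: z_def algebra_simps)
    ultimately show ?thesis unfolding fl_def 1 by (simp add: ceiling_def)
  qed
  have "sturm_v \<alpha> \<theta> (- j) = sturm_v \<alpha> y j" if "0 \<le> j" "j \<le> int L" for j
    unfolding sturm_v_fl using F[of j] F[of "j + 1"] that by (simp add: J_def)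
  then show ?thesis by blast
qed

end

section \<open>The trace map\<close>

text \<open>A fixed type in the class \<open>monoid_mult\<close>, so that powers of transfer
  matrices and their laws are available as \<open>^\<close>.\<close>

datatype m2 = M2 complex complex complex complex

instantiation m2 :: monoid_mult
begin

definition one_m2 :: m2 where "one_m2 = M2 1 0 0 1"

fun times_m2 :: "m2 \<Rightarrow> m2 \<Rightarrow> m2" where
  "times_m2 (M2 a b c d) (M2 a' b' c' d') =
     M2 (a * a' + b * c') (a * b' + b * d') (c * a' + d * c') (c * b' + d * d')"

instance
proof
  fix x y z :: m2
  show "x * y * z = x * (y * z)"
    by (cases x; cases y; cases z) (simp add: algebra_simps)
  show "1 * x = x" "x * 1 = x"
    by (cases x; simp add: one_m2_def)+
qed

end

fun mtr :: "m2 \<Rightarrow> complex" where "mtr (M2 a b c d) = a + d"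
fun mdet :: "m2 \<Rightarrow> complex" where "mdet (M2 a b c d) = a * d - b * c"

lemma mdet_mult: "mdet (A * B) = mdet A * mdet B"
  by (cases A; cases B) (simp add: algebra_simps)

lemma mdet_one: "mdet 1 = 1" by (simp add: one_m2_def)

lemma mtr_commute: "mtr (A * B) = mtr (B * A)"
  by (cases A; cases B) (simp add: algebra_simps)

text \<open>The Cayley-Hamilton identity for determinant 1, multiplied by \<open>B\<close> and
  traced; it turns traces along powers of \<open>A\<close> into a linear recurrence of order
  two.\<close>

lemma mtr_cayley_hamilton:
  assumes "mdet A = 1"
  shows "mtr (B * A * A) = mtr A * mtr (B * A) - mtr B"
proof (cases A; cases B)
  fix a b c d a' b' c' d' assume A: "A = M2 a b c d" and B: "B = M2 a' b' c' d'"
  have "a * d - b * c = 1" using assms A by simp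
  then have "mtr B * (a * d - b * c) = mtr B" by simp
  then show ?thesis unfolding A B by (simp add: algebra_simps)
qed

definition step_mat :: "complex \<Rightarrow> m2" where "step_mat v = M2 (- v) (- 1) 1 0"

text \<open>The product over the places \<open>i + 1, ..., i + n\<close>. It maps the pair
  \<open>(u (i + 1), u i)\<close> of a solution to \<open>(u (i + n + 1), u (i + n))\<close>, see
  \<open>tmat_apply\<close>.\<close>

fun tmat :: "(int \<Rightarrow> complex) \<Rightarrow> int \<Rightarrow> nat \<Rightarrow> m2" where
  "tmat V i 0 = 1"
| "tmat V i (Suc n) = step_mat (V (i + int n + 1)) * tmat V i n"

lemma mdet_tmat: "mdet (tmat V i n) = 1"
  by (induction n) (simp_all add: mdet_mult mdet_one step_mat_def)

lemma tmat_add: "tmat V i (m + n) = tmat V (i + int m) n * tmat V i m"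
  by (induction n) (simp_all add: algebra_simps mult.assoc)

lemma tmat_cong: "(\<And>j. i < j \<Longrightarrow> j \<le> i + int n \<Longrightarrow> V j = V' j) \<Longrightarrow> tmat V i n = tmat V' i n"
  by (induction n) simp_all

lemma tmat_shift: "tmat (\<lambda>j. V (j + s)) i n = tmat V (i + s) n"
  by (induction n) (simp_all add: algebra_simps)

text \<open>Moving the starting point by one conjugates the product over a period by a step
  matrix.\<close>

lemma mtr_tmat_periodic:
  assumes "\<And>j. V (j + int n) = V j"
  shows "mtr (tmat V i n) = mtr (tmat V 0 n)"
proof -
  have step: "mtr (tmat V (i + 1) n) = mtr (tmat V i n)" for i
  proof (cases n)
    case (Suc k)
    have "tmat V i n = tmat V (i + 1) k * step_mat (V (i + 1))"
      using tmat_add[of V i 1 k] Suc by simp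
    then have "mtr (tmat V i n) = mtr (step_mat (V (i + 1)) * tmat V (i + 1) k)"
      by (simp only: mtr_commute)
    moreover have "V (i + 1) = V (i + 1 + int k + 1)" using assms[of "i + 1"] Suc by (simp add: algebra_simps)
    ultimately show ?thesis using Suc by simp
  qed simp
  show ?thesis
  proof (induction i rule: int_induct[where k = 0])
    case (step1 i) then show ?case using step by simp
  next
    case (step2 i) then show ?case using step[of "i - 1"] by simp
  qed simp
qed

text \<open>With a multiplier of modulus at least 2, the triangle inequality does not let the moduli
  turn back once they increase. The recurrence is symmetric in time, which gives
  \<open>rec_abs_decreasing\<close>.\<close>

lemma rec_abs_increasing:
  fixes y :: "nat \<Rightarrow> complex"
  assumes "\<And>n. y (Suc (Suc n)) = t * y (Suc n) - y n" "2 \<le> cmod t" "cmod (y 0) < cmod (y 1)"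
  shows "cmod (y n) < cmod (y (Suc n))" "(cmod t - 1) * cmod (y (Suc n)) \<le> cmod (y (Suc (Suc n)))"
proof -
  have *: "cmod t * cmod (y (Suc n)) \<le> cmod (y (Suc (Suc n))) + cmod (y n)" for n
    using norm_triangle_ineq[of "y (Suc (Suc n))" "y n"] assms(1)[of n] by (simp add: norm_mult)
  have **: "2 * cmod (y (Suc n)) \<le> cmod t * cmod (y (Suc n))" for n
    using assms(2) by (intro mult_right_mono) auto
  show 1: "cmod (y n) < cmod (y (Suc n))" for n
  proof (induction n)
    case 0 then show ?case using assms(3) by simp
  next
    case (Suc n) then show ?case using *[of n] **[of n] by linarith
  qed
  show "(cmod t - 1) * cmod (y (Suc n)) \<le> cmod (y (Suc (Suc n)))"
    using *[of n] 1[of n] by (simp add: algebra_simps)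
qed

lemma rec_abs_decreasing:
  fixes y :: "nat \<Rightarrow> complex"
  assumes "\<And>n. y (Suc (Suc n)) = t * y (Suc n) - y n" "2 \<le> cmod t" "cmod (y (Suc b)) < cmod (y b)" "n \<le> b"
  shows "cmod (y (Suc n)) < cmod (y n)"
  using assms(4)
proof (induction rule: inc_induct)
  case base then show ?case by (rule assms(3))
next
  case (step n)
  have "cmod t * cmod (y (Suc n)) \<le> cmod (y (Suc (Suc n))) + cmod (y n)"
    using norm_triangle_ineq[of "y (Suc (Suc n))" "y n"] assms(1)[of n] by (simp add: norm_mult)
  moreover have "2 * cmod (y (Suc n)) \<le> cmod t * cmod (y (Suc n))"
    using assms(2) by (intro mult_right_mono) auto
  ultimately show ?case using step by linarith
qed

text \<open>A pair of large consecutive traces can only be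
  left towards growth in one of the two directions; backward growth is excluded by the initial
  condition.\<close>
locale trace_map =
  fixes M :: "nat \<Rightarrow> m2" and a :: "nat \<Rightarrow> nat"
  assumes M_rec: "M (Suc (Suc m)) = M m * M (Suc m) ^ a m"
    and a_pos: "1 \<le> a m" and det_M: "mdet (M m) = 1"
begin

definition x :: "nat \<Rightarrow> complex" where "x m = mtr (M m)"
definition z :: "nat \<Rightarrow> complex" where "z m = mtr (M m * M (Suc m))"
text \<open>For fixed \<open>m\<close> this interpolates between neighbouring levels: at
  \<open>n = 0, 1, a m, a m + 1\<close> it equals \<open>x m\<close>, \<open>z m\<close>,
  \<open>x (m + 2)\<close>, \<open>z (m + 1)\<close>, and it satisfies a recurrence with multiplier
  \<open>x (m + 1)\<close>.\<close>

definition y :: "nat \<Rightarrow> nat \<Rightarrow> complex" where "y m n = mtr (M m * M (Suc m) ^ n)"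

lemma y_rec: "y m (Suc (Suc n)) = x (Suc m) * y m (Suc n) - y m n"
  using mtr_cayley_hamilton[OF det_M, of "M m * M (Suc m) ^ n" "Suc m"]
  by (simp add: y_def x_def mult.assoc power_commutes)

lemma y_0: "y m 0 = x m" by (simp add: y_def x_def)
lemma y_1: "y m (Suc 0) = z m" by (simp add: y_def z_def)
lemma y_a: "y m (a m) = x (Suc (Suc m))" by (simp add: y_def x_def M_rec)
lemma y_Suc_a: "y m (Suc (a m)) = z (Suc m)"
proof -
  have "y m (Suc (a m)) = mtr (M (Suc (Suc m)) * M (Suc m))"
    by (simp add: y_def M_rec mult.assoc power_commutes)
  then show ?thesis by (simp add: z_def mtr_commute)
qed

text \<open>The recurrence of \<open>y m\<close> has a multiplier of modulus at least 2 and already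
  grows at its first step. The last conjunct makes the traces themselves increase.\<close>

definition esc :: "nat \<Rightarrow> bool" where
  "esc m \<longleftrightarrow> 2 \<le> cmod (x (Suc m)) \<and> cmod (x m) < cmod (z m) \<and> cmod (x (Suc m)) < cmod (z m)"

lemma esc_Suc:
  assumes "esc m"
  shows "esc (Suc m)" "cmod (z m) \<le> cmod (x (Suc (Suc m)))"
    "(cmod (x (Suc m)) - 1) * cmod (x (Suc (Suc m))) \<le> cmod (z (Suc m))"
proof -
  have t: "2 \<le> cmod (x (Suc m))" and i: "cmod (y m 0) < cmod (y m 1)"
    using assms by (auto simp: esc_def y_0 y_1)
  note inc = rec_abs_increasing[of "y m", OF y_rec t i]
  have "strict_mono (\<lambda>n. cmod (y m n))" using inc(1) by (simp add: strict_mono_Suc_iff)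
  then have "cmod (y m 1) \<le> cmod (y m (a m))" using a_pos strict_mono_less_eq by fastforce
  then show zx: "cmod (z m) \<le> cmod (x (Suc (Suc m)))" by (simp add: y_1 y_a)
  obtain b where b: "a m = Suc b" using a_pos[of m] by (cases "a m") auto
  show "(cmod (x (Suc m)) - 1) * cmod (x (Suc (Suc m))) \<le> cmod (z (Suc m))"
    using inc(2)[of b] y_a[of m] y_Suc_a[of m] b by simp
  have "cmod (x (Suc (Suc m))) < cmod (z (Suc m))" using inc(1)[of "a m"] by (simp add: y_a y_Suc_a)
  then show "esc (Suc m)" using zx assms by (auto simp: esc_def)
qed

lemma esc_growth:
  assumes "esc m0"
  shows "\<exists>m1. \<forall>m\<ge>m1. R \<le> cmod (x m)"
proof -
  \<comment> \<open>One level later the modulus strictly exceeds 2, so that the growth factor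
    \<open>r - 1\<close> exceeds 1.\<close>
  define n0 where "n0 = Suc m0"
  define r where "r = cmod (x (Suc n0))"
  have e: "esc (m0 + n)" for n by (induction n) (use assms esc_Suc(1) in auto)
  have xs: "cmod (x (Suc m)) < cmod (x (Suc (Suc m)))" if "m0 \<le> m" for m
    using e[of "m - m0"] that esc_Suc(2)[of m] unfolding esc_def by auto
  have r2: "2 < r" using xs[of m0] assms unfolding esc_def r_def n0_def by auto
  have xr: "r \<le> cmod (x (Suc n0 + n))" for n
  proof (induction n)
    case (Suc n)
    then show ?case using xs[of "n0 + n"] by (simp add: n0_def)
  qed (simp add: r_def)
  have g: "(r - 1) * cmod (x (Suc n0 + Suc n)) \<le> cmod (x (Suc n0 + Suc (Suc n)))" for n
  proof -
    have ee: "esc (n0 + n)" using e[of "Suc n"] by (simp add: n0_def)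
    have "(r - 1) * cmod (x (Suc n0 + Suc n)) \<le> (cmod (x (Suc (n0 + n))) - 1) * cmod (x (Suc (Suc (n0 + n))))"
      using xr[of n] by (auto intro!: mult_right_mono)
    also have "\<dots> \<le> cmod (z (Suc (n0 + n)))" by (rule esc_Suc(3)[OF ee])
    also have "\<dots> \<le> cmod (x (Suc (Suc (Suc (n0 + n)))))" using esc_Suc(2)[OF esc_Suc(1)[OF ee]] .
    finally show ?thesis by simp
  qed
  have geo: "(r - 1) ^ n * r \<le> cmod (x (Suc n0 + Suc n))" for n
  proof (induction n)
    case 0 then show ?case using xr[of 1] by simp
  next
    case (Suc n)
    have "(r - 1) ^ Suc n * r \<le> (r - 1) * cmod (x (Suc n0 + Suc n))"
      using Suc r2 by (simp add: mult.assoc)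
    then show ?case using g[of n] by linarith
  qed
  have "1 < r - 1" using r2 by simp
  then obtain n1 where n1: "R < (r - 1) ^ n1" using real_arch_pow by blast
  show ?thesis
  proof (intro exI[of _ "n0 + 2 + n1"] allI impI)
    fix m assume "n0 + 2 + n1 \<le> m"
    then obtain n where n: "m = Suc n0 + Suc n" "n1 \<le> n"
      by (intro that[of "m - n0 - 2"]) auto
    have "(r - 1) ^ n1 \<le> (r - 1) ^ n" using n(2) r2 by (intro power_increasing) auto
    also have "\<dots> \<le> (r - 1) ^ n * r" using r2 by (simp add: mult_le_cancel_left1)
    also have "\<dots> \<le> cmod (x m)" unfolding n(1) by (rule geo)
    finally show "R \<le> cmod (x m)" using n1 by simp
  qed
qed

text \<open>Such a configuration would, by the recurrence run backwards, reproduce itself one level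
  lower, and so down to level 0, where the trace is at most 2.\<close>

lemma no_backward_growth:
  assumes x0: "cmod (x 0) \<le> 2"
  shows "\<not> (2 < cmod (x (Suc m)) \<and> 2 < cmod (x m) \<and> cmod (z m) < cmod (x m))"
proof (induction m)
  case 0 then show ?case using x0 by simp
next
  case (Suc m)
  show ?case
  proof
    assume B: "2 < cmod (x (Suc (Suc m))) \<and> 2 < cmod (x (Suc m)) \<and> cmod (z (Suc m)) < cmod (x (Suc m))"
    obtain b where b: "a m = Suc b" using a_pos[of m] by (cases "a m") auto
    let ?t = "cmod (x (Suc m))" and ?v = "cmod (x (Suc (Suc m)))"
    have "z (Suc m) = x (Suc m) * x (Suc (Suc m)) - y m b"
      using y_rec[of m b] y_a[of m] y_Suc_a[of m] b by simp
    then have "x (Suc m) * x (Suc (Suc m)) = z (Suc m) + y m b" by simp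
    then have "?t * ?v \<le> cmod (z (Suc m)) + cmod (y m b)"
      using norm_triangle_ineq[of "z (Suc m)" "y m b"] by (simp add: norm_mult[symmetric])
    moreover have "2 * (?v - 1) < ?t * (?v - 1)" using B by (intro mult_strict_right_mono) auto
    ultimately have "cmod (y m (Suc b)) < cmod (y m b)"
      using B y_a[of m] b by (simp add: algebra_simps)
    note dec = rec_abs_decreasing[of "y m", OF y_rec _ this]
    have t2: "2 \<le> ?t" using B by simp
    have "cmod (y m b) \<le> cmod (y m 0)"
    proof -
      have "cmod (y m n) \<le> cmod (y m 0)" if "n \<le> b" for n
        using that
      proof (induction n)
        case (Suc n) then show ?case using dec[OF t2, of n] by force
      qed simp
      then show ?thesis by simp
    qed
    then have "2 < cmod (x m)" using \<open>cmod (y m (Suc b)) < cmod (y m b)\<close> B y_a[of m] b by (simp add: y_0)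
    moreover have "cmod (z m) < cmod (x m)" using dec[OF t2, of 0] y_1[of m] by (simp add: y_0)
    ultimately show False using Suc B by simp
  qed
qed

text \<open>With \<open>b = a m - 1\<close> the product of the two traces is
  \<open>z (Suc m) + y m b\<close>, and its modulus exceeds twice that of either trace. Either
  \<open>z (Suc m)\<close> dominates, which is escape, or \<open>y m b\<close> does, which means
  growth towards lower levels.\<close>

lemma esc_of_two_large:
  assumes x0: "cmod (x 0) \<le> 2" and l: "2 < cmod (x (Suc m))" "2 < cmod (x (Suc (Suc m)))"
  shows "esc (Suc m)"
proof -
  obtain b where b: "a m = Suc b" using a_pos[of m] by (cases "a m") auto
  let ?t = "cmod (x (Suc m))" and ?v = "cmod (x (Suc (Suc m)))"
  have "z (Suc m) = x (Suc m) * x (Suc (Suc m)) - y m b"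
    using y_rec[of m b] y_a[of m] y_Suc_a[of m] b by simp
  then have "x (Suc m) * x (Suc (Suc m)) = z (Suc m) + y m b" by simp
  then have s: "?t * ?v \<le> cmod (z (Suc m)) + cmod (y m b)"
    using norm_triangle_ineq[of "z (Suc m)" "y m b"] by (simp add: norm_mult[symmetric])
  have p: "2 * ?v < ?t * ?v" "?t * 2 < ?t * ?v"
    using l by (auto intro!: mult_strict_right_mono mult_strict_left_mono)
  show ?thesis
  proof (cases "cmod (y m b) \<le> cmod (z (Suc m))")
    case True
    then show ?thesis using s p l unfolding esc_def by auto
  next
    case False
    then have d: "cmod (y m (Suc b)) < cmod (y m b)" using s p y_a[of m] b by simp
    have t2: "2 \<le> ?t" using l by simp
    note dec = rec_abs_decreasing[of "y m", OF y_rec t2 d]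
    have "cmod (y m n) \<le> cmod (y m 0)" if "n \<le> b" for n
      using that
    proof (induction n)
      case (Suc n) then show ?case using dec[of n] by force
    qed simp
    then have "2 < cmod (x m)" using d l y_a[of m] b by (force simp: y_0)
    moreover have "cmod (z m) < cmod (x m)" using dec[of 0] y_1[of m] by (simp add: y_0)
    ultimately show ?thesis using no_backward_growth[OF x0, of m] l by simp
  qed
qed

end

section \<open>Transfer matrices of the Sturmian potential\<close>

definition pot :: "real \<Rightarrow> real \<Rightarrow> real \<Rightarrow> int \<Rightarrow> complex" where
  "pot lam \<beta> \<theta> j = complex_of_real (lam * sturm_v \<beta> \<theta> j)"

lemma mat2_mult:
  "mat_of_rows_list 2 [[a, b], [c, d]] * mat_of_rows_list 2 [[a', b'], [c', d' :: real]] =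
   mat_of_rows_list 2 [[a * a' + b * c', a * b' + b * d'], [c * a' + d * c', c * b' + d * d']]"
  by (rule eq_matI) (auto simp: mat_of_rows_list_def scalar_prod_def less_Suc_eq numeral_2_eq_2)

text \<open>The real entries are part of the claim because a real trace in \<open>[-2, 2]\<close> is
  needed later for a Floquet multiplier on the unit circle.\<close>

lemma transfer_M_tmat:
  "\<exists>a b c d. transfer_M lam \<beta> \<theta> n = mat_of_rows_list 2 [[a, b], [c, d]] \<and>
     tmat (pot lam \<beta> \<theta>) 0 n = M2 (of_real a) (of_real b) (of_real c) (of_real d)"
proof (induction n)
  case 0
  have "1\<^sub>m 2 = mat_of_rows_list 2 [[1, 0], [0, 1 :: real]]"
    by (rule eq_matI) (auto simp: mat_of_rows_list_def less_Suc_eq numeral_2_eq_2)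
  then show ?case by (intro exI[of _ 1] exI[of _ 0] conjI) (auto simp: one_m2_def)
next
  case (Suc n)
  then obtain a b c d where IH: "transfer_M lam \<beta> \<theta> n = mat_of_rows_list 2 [[a, b], [c, d]]"
    "tmat (pot lam \<beta> \<theta>) 0 n = M2 (of_real a) (of_real b) (of_real c) (of_real d)" by blast
  have e: "0 + int n + 1 = int (Suc n)" by simp
  let ?v = "- lam * sturm_v \<beta> \<theta> (int (Suc n))"
  have "transfer_M lam \<beta> \<theta> (Suc n) = mat_of_rows_list 2 [[?v * a + (-1) * c, ?v * b + (-1) * d], [1 * a + 0 * c, 1 * b + 0 * d]]"
    unfolding transfer_M.simps IH(1) transfer_step_def mat2_mult ..
  moreover have "tmat (pot lam \<beta> \<theta>) 0 (Suc n) = M2 (of_real (?v * a + (-1) * c)) (of_real (?v * b + (-1) * d)) (of_real (1 * a + 0 * c)) (of_real (1 * b + 0 * d))"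
    unfolding tmat.simps IH(2) e by (simp add: step_mat_def pot_def)
  ultimately show ?case by blast
qed

lemma trace2_transfer_M: "\<bar>trace2 (transfer_M lam \<beta> \<theta> n)\<bar> = cmod (mtr (tmat (pot lam \<beta> \<theta>) 0 n))"
proof -
  obtain a b c d where "transfer_M lam \<beta> \<theta> n = mat_of_rows_list 2 [[a, b], [c, d]]"
    "tmat (pot lam \<beta> \<theta>) 0 n = M2 (of_real a) (of_real b) (of_real c) (of_real d)"
    using transfer_M_tmat by blast
  then show ?thesis by (simp add: trace2_def mat_of_rows_list_def flip: of_real_add)
qed

context irrational_slope
begin

definition trc :: "real \<Rightarrow> nat \<Rightarrow> complex" where
  "trc lam m = mtr (tmat (pot lam \<alpha> 0) 0 (q m))"

text \<open>Level 0 is the letter 0 and not the block of length \<open>q 0 = 1\<close>: if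
  \<open>q 1 = 1\<close>, the first letter is 1, but the recursion at level 0 still needs the letter
  0. The resulting trace 0 is also the initial condition that excludes backward growth.\<close>

definition Mat :: "real \<Rightarrow> nat \<Rightarrow> m2" where
  "Mat lam m = (if m = 0 then step_mat 0 else tmat (pot lam \<alpha> 0) 0 (q m))"

text \<open>For phase 0 there is no bad place of level \<open>m\<close> between 1 and
  \<open>q (Suc m) - 1\<close>, so inside the prefix of length \<open>q (Suc m)\<close> the period
  is undisturbed.\<close>

lemma sturm_v_prefix_period:
  assumes "2 \<le> q m" "1 \<le> j" "j + int k * int (q m) \<le> int (q (Suc m))"
  shows "sturm_v \<alpha> 0 (j + int k * int (q m)) = sturm_v \<alpha> 0 j"
  using assms(3)
proof (induction k)
  case (Suc k)
  let ?i = "j + int k * int (q m)"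
  have e: "j + int (Suc k) * int (q m) = ?i + int (q m)" by (simp add: algebra_simps)
  have i: "1 \<le> ?i" "?i + int (q m) \<le> int (q (Suc m))" using Suc.prems assms(2) e
    by (auto simp: add_increasing2)
  have "\<not> bad m 0 ?i" "\<not> bad m 0 (?i + 1)"
    using bad_zero_phase[of m ?i] bad_zero_phase[of m "?i + 1"] i assms(1) by linarith+
  then have "sturm_v \<alpha> 0 (?i + int (q m)) = sturm_v \<alpha> 0 ?i" by (rule sturm_v_period)
  moreover have "sturm_v \<alpha> 0 ?i = sturm_v \<alpha> 0 j" using i(2) by (intro Suc.IH) linarith
  ultimately show ?case unfolding e by simp
qed simp

lemma q_Suc_Suc_ge_2: "2 \<le> q (Suc (Suc m))"
  using q_Suc_Suc_ge[of m] q_pos[of m] q_pos[of "Suc m"] by linarith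

lemma sturm_v_one_small: "2 \<le> q 1 \<Longrightarrow> sturm_v \<alpha> 0 1 = 0"
proof -
  assume "2 \<le> q 1"
  then have "2 * \<alpha> \<le> cf_a \<alpha> 1 * \<alpha>" using slope_pos by (intro mult_right_mono) auto
  then have "2 * \<alpha> < 1" using err_1 err_pos[of "Suc 0"] by linarith
  then have "fl 0 2 = 0" "fl 0 1 = 0" using slope_pos slope_less_1 by (auto simp: fl_def floor_eq_iff)
  then show ?thesis by (simp add: sturm_v_fl)
qed

text \<open>Here \<open>err 1 = 1 - \<alpha>\<close>, so \<open>k * \<alpha>\<close> lies
  \<open>k * err 1\<close> below \<open>k\<close>. This deficit exceeds 1 for the first time at
  \<open>k = cf_a \<alpha> 2 + 2\<close>.\<close>

lemma sturm_v_large_slope: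
  assumes "q 1 = 1"
  shows "1 \<le> j \<Longrightarrow> j \<le> int (cf_a \<alpha> 2) \<Longrightarrow> sturm_v \<alpha> 0 j = 1"
    and "sturm_v \<alpha> 0 (int (cf_a \<alpha> 2) + 1) = 0"
proof -
  let ?a = "real (cf_a \<alpha> 2)"
  have e1: "err 1 = 1 - \<alpha>" using err_1 assms by simp
  have e2: "err 2 = \<alpha> - ?a * err 1" using err_rec[of 0] by (simp add: err_0 numeral_2_eq_2)
  have e: "0 < err 1" "0 < err 2" "err 2 < err 1" "err 1 < 1"
    using err_pos err_decreasing[of 1 2] err_less_1 by auto
  have f: "fl 0 k = k - 1" if "1 \<le> k" "k \<le> int (cf_a \<alpha> 2) + 1" for k
  proof -
    have "real_of_int k \<le> ?a + 1" using that(2) by linarith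
    then have "of_int k * err 1 \<le> (?a + 1) * err 1" using e by (intro mult_right_mono) auto
    also have "\<dots> = 1 - err 2" using e1 e2 by (simp add: algebra_simps)
    finally have u: "of_int k * err 1 < 1" using e by linarith
    have "0 < of_int k * err 1" using that e by simp
    moreover have "of_int k * err 1 = of_int k * (1 - \<alpha>)" using e1 by simp
    then have "of_int k * \<alpha> + 0 = of_int k - of_int k * err 1" by (simp add: algebra_simps)
    ultimately show ?thesis unfolding fl_def using u by (intro floor_unique) auto
  qed
  have f2: "fl 0 (int (cf_a \<alpha> 2) + 2) = int (cf_a \<alpha> 2)"
  proof -
    have "(?a + 2) * err 1 = (?a + 2) * (1 - \<alpha>)" using e1 by simp
    then have "of_int (int (cf_a \<alpha> 2) + 2) * \<alpha> + 0 = ?a + 2 - (?a + 2) * err 1"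
      by (simp add: algebra_simps)
    also have "(?a + 2) * err 1 = 1 - err 2 + err 1" using e1 e2 by (simp add: algebra_simps)
    finally show ?thesis unfolding fl_def using e by (intro floor_unique) auto
  qed
  show "sturm_v \<alpha> 0 j = 1" if "1 \<le> j" "j \<le> int (cf_a \<alpha> 2)"
    unfolding sturm_v_fl using f[of j] f[of "j + 1"] that by simp
  show "sturm_v \<alpha> 0 (int (cf_a \<alpha> 2) + 1) = 0"
    unfolding sturm_v_fl using f[of "int (cf_a \<alpha> 2) + 1"] f2 by (simp add: add.commute)
qed

text \<open>The prefix of length \<open>q (m + 2)\<close> consists of copies of the prefix of length
  \<open>q (m + 1)\<close> followed by that of length \<open>q m\<close>. The argument needs
  \<open>q (m + 1) \<ge> 2\<close>; the remaining case \<open>m = 0\<close>, \<open>q 1 = 1\<close>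
  is computed from the explicit word.\<close>

lemma Mat_rec: "Mat lam (Suc (Suc m)) = Mat lam m * Mat lam (Suc m) ^ cf_a \<alpha> (Suc (Suc m))"
proof (cases "2 \<le> q (Suc m)")
  case True
  let ?V = "pot lam \<alpha> 0" and ?q = "q (Suc m)" and ?a = "cf_a \<alpha> (Suc (Suc m))"
  have qq: "q (Suc (Suc m)) = ?a * ?q + q m" by simp
  have per: "tmat ?V (int (k * ?q)) n = tmat ?V 0 n" if "k * ?q + n \<le> ?a * ?q + q m" for k n
  proof -
    have "tmat (\<lambda>j. ?V (j + int (k * ?q))) 0 n = tmat ?V 0 n"
    proof (rule tmat_cong)
      fix j assume j: "0 < j" "j \<le> 0 + int n"
      have "j + int k * int ?q \<le> int (q (Suc (Suc m)))"
        using j that unfolding qq by (simp flip: of_nat_mult of_nat_add)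
      then show "?V (j + int (k * ?q)) = ?V j"
        using sturm_v_prefix_period[OF True, of j k] j by (simp add: pot_def)
    qed
    then show ?thesis by (simp add: tmat_shift)
  qed
  have pow: "tmat ?V 0 (k * ?q) = tmat ?V 0 ?q ^ k" if "k \<le> ?a" for k
    using that
  proof (induction k)
    case (Suc k)
    have "k * ?q + ?q \<le> ?a * ?q" using mult_le_mono1[OF Suc.prems, of ?q] by (simp add: add.commute)
    then have "tmat ?V (int (k * ?q)) ?q = tmat ?V 0 ?q" by (intro per) linarith
    then show ?case using tmat_add[of ?V 0 "k * ?q" ?q] Suc by (simp add: add.commute)
  qed simp
  have "tmat ?V 0 (q m) = Mat lam m"
  proof (cases m)
    case 0
    then show ?thesis using sturm_v_one_small True by (simp add: Mat_def pot_def)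
  qed (simp add: Mat_def)
  then show ?thesis
    using tmat_add[of ?V 0 "?a * ?q" "q m"] per[of ?a "q m"] pow[of ?a] qq
    by (simp add: Mat_def del: cf_q.simps)
next
  case False
  then have m0: "m = 0" using q_Suc_Suc_ge_2[of "m - 1"] by (cases m) auto
  have q1: "q 1 = 1" using False q_pos[of 1] m0 by simp
  let ?V = "pot lam \<alpha> 0" and ?a = "cf_a \<alpha> 2"
  note v = sturm_v_large_slope[OF q1]
  have a1: "1 \<le> ?a" using cf_a_pos[of 1] by (simp add: numeral_2_eq_2)
  have pow: "tmat ?V 0 k = step_mat (of_real lam) ^ k" if "k \<le> ?a" for k
    using that
  proof (induction k)
    case (Suc k)
    then show ?case using v(1)[of "int k + 1"] by (simp add: pot_def)
  qed simp
  have "tmat ?V 0 (Suc ?a) = step_mat 0 * step_mat (of_real lam) ^ ?a"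
    using pow[of ?a] v(2) by (simp add: pot_def)
  moreover have "tmat ?V 0 (q 1) = step_mat (of_real lam)" using pow[of 1] a1 q1 by simp
  moreover have "q (Suc (Suc 0)) = Suc ?a" using q1 by (simp add: numeral_2_eq_2)
  ultimately show ?thesis unfolding m0 Mat_def by (simp add: numeral_2_eq_2 del: cf_q.simps)
qed

lemma trc_growth:
  assumes "2 < cmod (trc lam m0)" "2 < cmod (trc lam (Suc m0))"
  shows "\<exists>m1. \<forall>m\<ge>m1. R \<le> cmod (trc lam m)"
proof -
  interpret trace_map "Mat lam" "\<lambda>m. cf_a \<alpha> (Suc (Suc m))"
    by unfold_locales (rule Mat_rec, rule cf_a_pos, simp add: Mat_def mdet_tmat step_mat_def)
  have x0: "x 0 = 0" by (simp add: x_def Mat_def step_mat_def)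
  have xS: "x (Suc m) = trc lam (Suc m)" for m by (simp add: x_def Mat_def trc_def)
  have "\<exists>m. esc m"
  proof (cases m0)
    case (Suc m)
    then show ?thesis using esc_of_two_large[of m] assms x0 xS by auto
  next
    \<comment> \<open>Level 0 of \<open>Mat\<close> is artificial, so a large trace of the true
      level 0 is used differently: it forces \<open>q 1 = 1\<close> and
      \<open>\<bar>lam\<bar> > 2\<close>, and escape is checked at level 1.\<close>
    case 0
    then have large: "2 < cmod (of_real (lam * sturm_v \<alpha> 0 1))"
      using assms(1) by (simp add: trc_def step_mat_def pot_def)
    then have "\<not> 2 \<le> q 1" using sturm_v_one_small by auto
    then have q1: "q 1 = 1" using q_pos[of 1] by linarith
    have v1: "sturm_v \<alpha> 0 1 = 1"
      using sturm_v_large_slope(1)[OF q1, of 1] cf_a_pos[of 1] by (simp add: numeral_2_eq_2)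
    have M1: "Mat lam 1 = step_mat (of_real lam)" using v1 q1 by (simp add: Mat_def pot_def)
    have x1: "x 1 = - of_real lam" by (simp add: x_def M1[simplified] step_mat_def)
    have z0: "z 0 = - 2" by (simp add: z_def M1[simplified]) (simp add: Mat_def step_mat_def)
    have t: "2 < cmod (x (Suc 0))" using large v1 x1 by simp
    have t2: "2 \<le> cmod (x (Suc 0))" and i: "cmod (y 0 0) < cmod (y 0 1)"
      using t x0 z0 by (auto simp: y_0 y_1)
    note inc = rec_abs_increasing[of "y 0", OF y_rec t2 i]
    have sm: "strict_mono (\<lambda>n. cmod (y 0 n))" using inc(1) by (simp add: strict_mono_Suc_iff)
    let ?a = "cf_a \<alpha> (Suc (Suc 0))"
    have "cmod (y 0 1) \<le> cmod (y 0 ?a)" "cmod (y 0 2) \<le> cmod (y 0 (Suc ?a))" "cmod (y 0 ?a) < cmod (y 0 (Suc ?a))"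
      using cf_a_pos[of 1] strict_mono_less_eq[OF sm] strict_mono_less[OF sm] by auto
    moreover have "y 0 2 = - 2 * x (Suc 0)" using y_rec[of 0 0] by (simp add: y_0 x0 y_1 z0 numeral_2_eq_2)
    ultimately have "esc 1" unfolding esc_def using y_a[of 0] y_Suc_a[of 0] y_1[of 0] z0 t by (simp add: norm_mult)
    then show ?thesis by blast
  qed
  then obtain m1 where m1: "\<And>m. m1 \<le> m \<Longrightarrow> R \<le> cmod (x m)" using esc_growth by blast
  have "R \<le> cmod (trc lam m)" if "Suc m1 \<le> m" for m
    using m1[of m] that xS[of "m - 1"] by auto
  then show ?thesis by blast
qed

definition per_trc :: "real \<Rightarrow> nat \<Rightarrow> complex" where
  "per_trc lam m = mtr (tmat (\<lambda>j. of_real (lam * per_word m 0 j)) 0 (q m))"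

text \<open>A clear block is one period of a translate of the approximant's word, and the trace over
  a period does not depend on the starting point.\<close>

lemma clear_trace:
  assumes "clear (Suc m) \<theta> c"
  shows "mtr (tmat (pot lam \<alpha> \<theta>) (c - int (q (Suc m))) (q (Suc m))) = per_trc lam (Suc m)"
proof -
  let ?n = "q (Suc m)" and ?W = "\<lambda>j. complex_of_real (lam * per_word (Suc m) 0 j)"
  obtain r where r: "\<And>j. c - int ?n < j \<Longrightarrow> j \<le> c \<Longrightarrow> sturm_v \<alpha> \<theta> j = per_word (Suc m) r j"
    using clear_per_word[OF assms] by blast
  obtain s where s: "\<And>j. per_word (Suc m) r j = per_word (Suc m) 0 (j + s)" using per_word_shift by blast
  have "tmat (pot lam \<alpha> \<theta>) (c - int ?n) ?n = tmat (\<lambda>j. ?W (j + s)) (c - int ?n) ?n"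
    by (rule tmat_cong) (simp add: pot_def r s)
  also have "\<dots> = tmat ?W (c - int ?n + s) ?n" by (rule tmat_shift)
  finally show ?thesis unfolding per_trc_def
    using mtr_tmat_periodic[of ?W ?n "c - int ?n + s"] per_word_period by simp
qed

text \<open>From level 3 on the prefix at phase 0 is itself a clear block. Hence large traces at
  phase 0 control the clear blocks of every phase.\<close>

lemma trc_eq_per_trc: "trc lam (Suc (Suc (Suc m))) = per_trc lam (Suc (Suc (Suc m)))"
proof -
  let ?m = "Suc (Suc m)"
  have "clear (Suc ?m) 0 (int (q (Suc ?m)))"
  proof -
    have "q (Suc ?m) + 1 < q (Suc (Suc ?m))"
      using q_Suc_Suc_ge[of ?m] q_Suc_Suc_ge_2[of m] by linarith
    then have "\<not> bad (Suc ?m) 0 k" if "1 \<le> k" "k \<le> int (q (Suc ?m)) + 1" for k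
      using bad_zero_phase[of "Suc ?m" k] that by linarith
    then show ?thesis unfolding clear_def by simp
  qed
  from clear_trace[OF this] show ?thesis by (simp add: trc_def)
qed

end

section \<open>Solutions and the local inequality\<close>

definition Lop :: "(int \<Rightarrow> complex) \<Rightarrow> (int \<Rightarrow> complex) \<Rightarrow> int \<Rightarrow> complex" where
  "Lop V x j = x (j + 1) + x (j - 1) + V j * x j"

lemma Lop_diff: "Lop V (\<lambda>j. x j - y j) j = Lop V x j - Lop V y j"
  by (simp add: Lop_def algebra_simps)

lemma Lop_scale: "Lop V (\<lambda>j. c * x j) j = c * Lop V x j"
  by (simp add: Lop_def algebra_simps)

lemma Lop_shift: "Lop (\<lambda>j. V (j + s)) (\<lambda>j. x (j + s)) j = Lop V x (j + s)"
  by (simp add: Lop_def algebra_simps)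

lemma Lop_reflect: "Lop (\<lambda>j. V (- j)) (\<lambda>j. x (- j)) j = Lop V x (- j)"
proof -
  have "- (j + 1) = - j - 1" "- (j - 1) = - j + 1" by simp_all
  then show ?thesis unfolding Lop_def by simp
qed

lemma Lop_energy: "Lop (\<lambda>j. V j - E) x j = Lop V x j - E * x j"
  by (simp add: Lop_def algebra_simps)

lemma sol_exists: "\<exists>u. (\<forall>j. Lop V u j = 0) \<and> u c = a \<and> u (c + 1) = b"
proof -
  define P where "P = rec_nat (a, b) (\<lambda>n s. (snd s, - V (c + int n + 1) * snd s - fst s))"
  define R where "R = rec_nat (a, b) (\<lambda>n s. (- V (c - int n) * fst s - snd s, fst s))"
  have P: "P 0 = (a, b)" "P (Suc n) = (snd (P n), - V (c + int n + 1) * snd (P n) - fst (P n))" for n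
    by (simp_all add: P_def)
  have R: "R 0 = (a, b)" "R (Suc n) = (- V (c - int n) * fst (R n) - snd (R n), fst (R n))" for n
    by (simp_all add: R_def)
  define u where "u j = (if c \<le> j then fst (P (nat (j - c))) else fst (R (nat (c - j))))" for j
  have up: "u (c + int n) = fst (P n)" for n by (simp add: u_def)
  have um: "u (c - int n) = fst (R n)" for n by (cases "n = 0") (simp_all add: u_def P R(1))
  have "Lop V u j = 0" for j
  proof (cases "c \<le> j")
    case True
    then obtain n where j: "j = c + int n" using zle_iff_zadd by auto
    show ?thesis
    proof (cases n)
      case 0
      then show ?thesis using up[of 1] um[of 1] up[of 0] j by (simp add: Lop_def P R)
    next
      case (Suc k)
      have "u (j + 1) = fst (P (Suc (Suc k)))" "u j = fst (P (Suc k))" "u (j - 1) = fst (P k)"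
        using up[of "Suc (Suc k)"] up[of "Suc k"] up[of k] j Suc by (simp_all add: algebra_simps)
      then show ?thesis using j Suc by (simp add: Lop_def P algebra_simps)
    qed
  next
    case False
    then obtain n where j: "j = c - int (Suc n)"
      by (metis add.commute diff_add_cancel diff_diff_eq2 int_one_le_iff_zero_less less_iff_diff_less_0 linorder_not_le
          nonneg_int_cases of_nat_Suc zle_diff1_eq zless_iff_Suc_zadd)
    have "j + 1 = c - int n" "j - 1 = c - int (Suc (Suc n))" using j by simp_all
    then have uu: "u (j + 1) = fst (R n)" "u j = fst (R (Suc n))" "u (j - 1) = fst (R (Suc (Suc n)))"
      using um j by metis+
    have "V (c - int (Suc n)) = V j" using j by simp
    then show ?thesis unfolding Lop_def uu R(2)[of "Suc n"] using R(2)[of n] by simp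
  qed
  moreover have "u c = a" "u (c + 1) = b" using up[of 0] up[of 1] by (simp_all add: P)
  ultimately show ?thesis by blast
qed

text \<open>The base \<open>Vb + 2\<close> counts the terms of the recurrence: the inhomogeneity,
  the previous value and the potential term.\<close>

lemma growth_forward:
  assumes V: "\<And>j. cmod (V j) \<le> Vb" and b: "cmod (x c) \<le> b" "cmod (x (c + 1)) \<le> b"
    and L: "\<And>j. c < j \<Longrightarrow> j \<le> c + int n \<Longrightarrow> cmod (Lop V x j) \<le> b"
  shows "cmod (x (c + int n)) \<le> (Vb + 2) ^ n * b \<and> cmod (x (c + int n + 1)) \<le> (Vb + 2) ^ n * b"
  using L
proof (induction n)
  case 0 then show ?case using b by simp
next
  case (Suc n)
  let ?Q = "Vb + 2" and ?j = "c + int n + 1"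
  have V0: "0 \<le> Vb" using V[of 0] norm_ge_zero order_trans by blast
  have b0: "0 \<le> b" using b(1) norm_ge_zero order_trans by blast
  have IH: "cmod (x (c + int n)) \<le> ?Q ^ n * b" "cmod (x ?j) \<le> ?Q ^ n * b" using Suc by auto
  have Q1: "1 \<le> ?Q ^ n" using V0 by (intro one_le_power) simp
  have bQ: "b \<le> ?Q ^ n * b" using mult_right_mono[OF Q1 b0] by simp
  have "x (?j + 1) = Lop V x ?j - x (c + int n) - V ?j * x ?j" by (simp add: Lop_def)
  then have "cmod (x (?j + 1)) \<le> cmod (Lop V x ?j - x (c + int n)) + cmod (V ?j * x ?j)"
    by (metis norm_triangle_ineq4)
  also have "\<dots> \<le> cmod (Lop V x ?j) + cmod (x (c + int n)) + cmod (V ?j) * cmod (x ?j)"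
    by (simp add: norm_mult norm_triangle_ineq4)
  also have "\<dots> \<le> ?Q ^ n * b + ?Q ^ n * b + Vb * (?Q ^ n * b)"
    using IH Suc.prems[of ?j] bQ V[of ?j] V0 by (intro add_mono mult_mono) auto
  also have "\<dots> = ?Q ^ Suc n * b" by (simp add: algebra_simps)
  finally have 1: "cmod (x (?j + 1)) \<le> ?Q ^ Suc n * b" .
  have "?Q ^ n * b \<le> ?Q ^ Suc n * b" using V0 b0 by (intro mult_right_mono power_increasing) auto
  then have 2: "cmod (x ?j) \<le> ?Q ^ Suc n * b" using IH(2) by linarith
  have e: "c + int (Suc n) = ?j" by simp
  show ?case unfolding e using 1 2 by blast
qed

lemma growth_backward:
  assumes V: "\<And>j. cmod (V j) \<le> Vb" and b: "cmod (x c) \<le> b" "cmod (x (c + 1)) \<le> b"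
    and L: "\<And>j. c - int n < j \<Longrightarrow> j \<le> c \<Longrightarrow> cmod (Lop V x j) \<le> b"
  shows "cmod (x (c - int n)) \<le> (Vb + 2) ^ n * b \<and> cmod (x (c - int n + 1)) \<le> (Vb + 2) ^ n * b"
proof -
  have "cmod (x (- (- (c + 1) + int n))) \<le> (Vb + 2) ^ n * b \<and> cmod (x (- (- (c + 1) + int n + 1))) \<le> (Vb + 2) ^ n * b"
    by (rule growth_forward[of "\<lambda>j. V (- j)" Vb "\<lambda>j. x (- j)"])
      (use assms in \<open>auto simp: Lop_reflect add.commute\<close>)
  then show ?thesis by (simp add: algebra_simps)
qed

lemma growth_both:
  assumes V: "\<And>j. cmod (V j) \<le> Vb" and b: "cmod (x c) \<le> b" "cmod (x (c + 1)) \<le> b"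
    and L: "\<And>j. lo \<le> j \<Longrightarrow> j \<le> hi \<Longrightarrow> cmod (Lop V x j) \<le> b"
    and c: "lo - 1 \<le> c" "c \<le> hi" and j: "lo - 1 \<le> j" "j \<le> hi + 1"
  shows "cmod (x j) \<le> (Vb + 2) ^ nat (hi - lo + 2) * b"
proof -
  have V0: "0 \<le> Vb" using V[of 0] norm_ge_zero order_trans by blast
  have b0: "0 \<le> b" using b(1) norm_ge_zero order_trans by blast
  have mono: "(Vb + 2) ^ n * b \<le> (Vb + 2) ^ nat (hi - lo + 2) * b" if "n \<le> nat (hi - lo + 2)" for n
    using that V0 b0 by (intro mult_right_mono power_increasing) auto
  consider "j \<le> c" | "c < j" by linarith
  then show ?thesis
  proof cases
    case 1
    define n where "n = nat (c - j)"
    have jn: "j = c - int n" using 1 by (simp add: n_def)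
    have "cmod (x j) \<le> (Vb + 2) ^ n * b"
      unfolding jn using growth_backward[of V, OF V b, of n] L jn j(1) c by auto
    moreover have "n \<le> nat (hi - lo + 2)" unfolding n_def using j c by (intro nat_mono) linarith
    ultimately show ?thesis using mono[of n] by linarith
  next
    case 2
    define n where "n = nat (j - 1 - c)"
    have jn: "j = c + int n + 1" using 2 by (simp add: n_def)
    have "cmod (x j) \<le> (Vb + 2) ^ n * b"
      unfolding jn using growth_forward[of V, OF V b, of n] L jn j(2) c by auto
    moreover have "n \<le> nat (hi - lo + 2)" unfolding n_def using j c by (intro nat_mono) linarith
    ultimately show ?thesis using mono[of n] by linarith
  qed
qed

text \<open>Uniqueness is \<open>growth_both\<close> for the difference, with inhomogeneity and
  initial data zero.\<close>

lemma sol_eq: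
  assumes V: "\<And>j. cmod (V j) \<le> Vb" and "\<And>j. lo \<le> j \<Longrightarrow> j \<le> hi \<Longrightarrow> Lop V x j = Lop V y j"
    and c: "lo - 1 \<le> c" "c \<le> hi" and "x c = y c" "x (c + 1) = y (c + 1)" and j: "lo - 1 \<le> j" "j \<le> hi + 1"
  shows "x j = y j"
  using growth_both[of V Vb "\<lambda>j. x j - y j" c 0 lo hi j] assms by (simp add: Lop_diff)

lemma tmat_apply:
  assumes "\<And>j. i < j \<Longrightarrow> j \<le> i + int n \<Longrightarrow> Lop V u j = 0" "tmat V i n = M2 a b c d"
  shows "u (i + int n + 1) = a * u (i + 1) + b * u i \<and> u (i + int n) = c * u (i + 1) + d * u i"
  using assms
proof (induction n arbitrary: a b c d)
  case 0
  then show ?case by (simp add: one_m2_def)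
next
  case (Suc n)
  obtain a' b' c' d' where M: "tmat V i n = M2 a' b' c' d'" by (cases "tmat V i n")
  have IH: "u (i + int n + 1) = a' * u (i + 1) + b' * u i" "u (i + int n) = c' * u (i + 1) + d' * u i"
    using Suc.IH[OF _ M] Suc.prems(1) by auto
  have "Lop V u (i + int n + 1) = 0" using Suc.prems(1) by simp
  then have u: "u (i + int n + 1 + 1) = - V (i + int n + 1) * u (i + int n + 1) - u (i + int n)"
    by (simp add: Lop_def algebra_simps eq_neg_iff_add_eq_0)
  have abcd: "a = - V (i + int n + 1) * a' - c'" "b = - V (i + int n + 1) * b' - d'" "c = a'" "d = b'"
    using Suc.prems(2) M by (auto simp: step_mat_def)
  have e: "i + int (Suc n) = i + int n + 1" by simp
  show ?case unfolding e by (simp only: abcd u IH) (simp add: algebra_simps)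
qed

text \<open>An eigenvector of the product over one period gives the initial data; both sides of the
  Floquet relation then solve the same equation with the same data.\<close>

lemma floquet:
  assumes V: "\<And>j. cmod (V j) \<le> Vb" and per: "\<And>j. V (j + int n) = V j" and n: "1 \<le> n"
    and z: "z * z - mtr (tmat V 0 n) * z + 1 = 0"
  shows "\<exists>u. (\<forall>j. Lop V u j = 0) \<and> (u 0 \<noteq> 0 \<or> u 1 \<noteq> 0) \<and> (\<forall>j. u (j + int n) = z * u j)"
proof -
  obtain A B C D where M: "tmat V 0 n = M2 A B C D" by (cases "tmat V 0 n")
  have det: "A * D - B * C = 1" using mdet_tmat[of V 0 n] M by simp
  have ch: "(A - z) * (D - z) = B * C" using z det M by (simp add: algebra_simps)
  have "\<exists>a b. (a \<noteq> 0 \<or> b \<noteq> 0) \<and> A * a + B * b = z * a \<and> C * a + D * b = z * b"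
  proof (cases "B = 0 \<and> A = z")
    case True
    show ?thesis
    proof (cases "C = 0 \<and> D = z")
      case t: True
      then show ?thesis using True by (intro exI[of _ 1] exI[of _ 0]) auto
    next
      case f: False
      then show ?thesis using True by (intro exI[of _ "z - D"] exI[of _ C]) (auto simp: algebra_simps)
    qed
  next
    case False
    then show ?thesis using ch by (intro exI[of _ B] exI[of _ "z - A"]) (auto simp: algebra_simps)
  qed
  then obtain a b where ab: "a \<noteq> 0 \<or> b \<noteq> 0" "A * a + B * b = z * a" "C * a + D * b = z * b" by blast
  obtain u where u: "\<And>j. Lop V u j = 0" "u 0 = b" "u 1 = a" using sol_exists[of V 0 b a] by auto
  have un: "u (int n + 1) = z * a" "u (int n) = z * b"
    using tmat_apply[of 0 n V u A B C D] u M ab by simp_all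
  have "u (j + int n) = z * u j" for j
  proof (rule sol_eq[OF V, where x = "\<lambda>j. u (j + int n)" and y = "\<lambda>j. z * u j" and c = 0
        and lo = "min 0 j" and hi = "max 0 j"])
    fix i
    have "Lop V (\<lambda>j. u (j + int n)) i = Lop (\<lambda>j. V (j + int n)) (\<lambda>j. u (j + int n)) i" by (simp add: per)
    then show "Lop V (\<lambda>j. u (j + int n)) i = Lop V (\<lambda>j. z * u j) i"
      unfolding Lop_shift Lop_scale by (simp add: u)
  qed (use un u in \<open>auto simp: add.commute\<close>)
  then show ?thesis using u ab by blast
qed

text \<open>The bounds are required only on the window around \<open>i\<close>. This locality makes
  the property depend on finitely many letters and lets it be iterated over growing windows.\<close>

definition loc_ineq :: "real \<Rightarrow> int \<Rightarrow> real \<Rightarrow> (int \<Rightarrow> complex) \<Rightarrow> (int \<Rightarrow> complex) \<Rightarrow> bool" where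
  "loc_ineq r N C x y \<longleftrightarrow> (\<forall>i \<eta> B. (\<forall>j. \<bar>j - i\<bar> \<le> N \<longrightarrow> cmod (y j) \<le> \<eta> \<and> cmod (x j) \<le> B) \<longrightarrow>
     cmod (x i) \<le> r * B + C * \<eta>)"

text \<open>Each step uses up a margin \<open>N\<close> of the window; the factor 4 is the sum of
  the powers of 3/4.\<close>

lemma loc_ineq_iterate:
  assumes "loc_ineq (3/4) N C x y" "0 \<le> N" "0 \<le> C"
    "\<And>j. \<bar>j - i\<bar> \<le> int k * N \<Longrightarrow> cmod (y j) \<le> \<eta> \<and> cmod (x j) \<le> B"
  shows "cmod (x i) \<le> (3/4) ^ k * B + 4 * C * \<eta>"
  using assms(4)
proof (induction k arbitrary: i)
  case 0
  then have "cmod (y i) \<le> \<eta>" "cmod (x i) \<le> B" by auto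
  moreover from this have "0 \<le> \<eta>" using norm_ge_zero order_trans by blast
  then have "0 \<le> 4 * C * \<eta>" using assms(3) by simp
  ultimately show ?case by simp
next
  case (Suc k)
  have "cmod (y j) \<le> \<eta> \<and> cmod (x j) \<le> (3/4) ^ k * B + 4 * C * \<eta>" if j: "\<bar>j - i\<bar> \<le> N" for j
  proof -
    have e: "int (Suc k) * N = N + int k * N" by (simp add: algebra_simps)
    have "cmod (y j') \<le> \<eta> \<and> cmod (x j') \<le> B" if "\<bar>j' - j\<bar> \<le> int k * N" for j'
      using that j by (intro Suc.prems) (unfold e, linarith)
    then show ?thesis using Suc.IH[of j] assms(2) by force
  qed
  then have "cmod (x i) \<le> 3/4 * ((3/4) ^ k * B + 4 * C * \<eta>) + C * \<eta>"
    using assms(1) unfolding loc_ineq_def by blast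
  then show ?case by (simp add: algebra_simps)
qed

lemma loc_ineq_bound:
  assumes "loc_ineq (3/4) N C x y" "0 \<le> N" "0 \<le> C" "\<And>j. cmod (x j) \<le> B" "\<And>j. cmod (y j) \<le> \<eta>"
  shows "cmod (x i) \<le> 4 * C * \<eta>"
proof (rule tendsto_lowerbound)
  have "(\<lambda>k. (3/4) ^ k * B + 4 * C * \<eta>) \<longlonglongrightarrow> 0 * B + 4 * C * \<eta>"
    by (intro tendsto_intros LIMSEQ_power_zero) simp
  then show "(\<lambda>k. (3/4) ^ k * B + 4 * C * \<eta>) \<longlonglongrightarrow> 4 * C * \<eta>" by simp
  show "\<forall>\<^sub>F k in sequentially. cmod (x i) \<le> (3/4) ^ k * B + 4 * C * \<eta>"
    using loc_ineq_iterate[OF assms(1-3)] assms(4,5) by (intro always_eventually) blast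
qed simp

text \<open>Two neighbouring values determine a solution, so this measures its size near
  \<open>p\<close>; a single value may vanish.\<close>

definition amp :: "(int \<Rightarrow> complex) \<Rightarrow> int \<Rightarrow> real" where
  "amp u p = max (cmod (u (p - 1))) (cmod (u p))"

lemma amp_ge: "cmod (u (p - 1)) \<le> amp u p" "cmod (u p) \<le> amp u p" and amp_nonneg: "0 \<le> amp u p"
  by (auto simp: amp_def le_max_iff_disj)

definition wronskian :: "(int \<Rightarrow> complex) \<Rightarrow> (int \<Rightarrow> complex) \<Rightarrow> int \<Rightarrow> complex" where
  "wronskian u y j = u (j + 1) * y j - u j * y (j + 1)"

text \<open>A potential is hyperbolic if the operator is bounded below in a local, quantitative form. The constants
  only depend on the finite words occurring in the potential.\<close>
locale hyperbolic =
  fixes V :: "int \<Rightarrow> complex" and N :: int and C Vb :: real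
  assumes loc: "loc_ineq (3/4) N C x (Lop V x)"
    and N_pos: "1 \<le> N" and C_ge_1: "1 \<le> C" and V_bound: "cmod (V j) \<le> Vb"
begin

lemma Vb_nonneg: "0 \<le> Vb" using V_bound[of 0] norm_ge_zero order_trans by blast

lemma global_bound:
  assumes "\<And>j. cmod (x j) \<le> B" "\<And>j. cmod (Lop V x j) \<le> \<eta>"
  shows "cmod (x i) \<le> 4 * C * \<eta>"
  using loc_ineq_bound[OF loc[of x], of B \<eta> i] N_pos C_ge_1 assms by simp

lemma decay:
  assumes "\<And>j. \<bar>j - i\<bar> \<le> int k * N \<Longrightarrow> Lop V x j = 0 \<and> cmod (x j) \<le> B"
  shows "cmod (x i) \<le> (3/4) ^ k * B"
  using loc_ineq_iterate[OF loc[of x], of i k 0 B] N_pos C_ge_1 assms by simp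

text \<open>Cutting a solution off to the left of \<open>p\<close> leaves an inhomogeneity only at
  \<open>p - 1\<close> and \<open>p\<close>, of size at most \<open>amp u p\<close>.\<close>

lemma forward_bound:
  assumes L: "\<And>j. p \<le> j \<Longrightarrow> Lop V u j = 0" and B: "\<And>j. p \<le> j \<Longrightarrow> cmod (u j) \<le> B" and "p \<le> j"
  shows "cmod (u j) \<le> 4 * C * amp u p"
proof -
  define x where "x j = (if p \<le> j then u j else 0)" for j
  have "cmod (Lop V x j) \<le> amp u p" for j
  proof -
    consider "j < p - 1" | "j = p - 1" | "j = p" | "p < j" by linarith
    then show ?thesis
    proof cases
      case 3
      then have "Lop V x j = Lop V u j - u (p - 1)" by (simp add: Lop_def x_def)
      then show ?thesis using L[of j] 3 amp_ge(1)[of u p] by simp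
    next
      case 4
      then have "Lop V x j = Lop V u j" by (simp add: Lop_def x_def)
      then show ?thesis using L[of j] 4 amp_nonneg by simp
    qed (use amp_nonneg amp_ge in \<open>auto simp: Lop_def x_def\<close>)
  qed
  moreover have "cmod (x j) \<le> \<bar>B\<bar>" for j using B[of j] by (auto simp: x_def)
  ultimately have "cmod (x j) \<le> 4 * C * amp u p" by (intro global_bound)
  then show ?thesis using assms(3) by (simp add: x_def)
qed

lemma forward_decay:
  assumes L: "\<And>j. p \<le> j \<Longrightarrow> Lop V u j = 0" and B: "\<And>j. p \<le> j \<Longrightarrow> cmod (u j) \<le> B"
    and j: "p + int k * N \<le> j"
  shows "cmod (u j) \<le> (3/4) ^ k * (4 * C * amp u p)"
  by (rule decay) (use j forward_bound[OF L B] L in \<open>auto simp: abs_le_iff\<close>)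

lemma amp_forward:
  assumes L: "\<And>j. p \<le> j \<Longrightarrow> Lop V u j = 0" and B: "\<And>j. p \<le> j \<Longrightarrow> cmod (u j) \<le> B" and "p \<le> j"
  shows "amp u j \<le> 4 * C * amp u p"
proof (cases "j = p")
  case True
  then show ?thesis using C_ge_1 amp_nonneg[of u p] mult_right_mono[of 1 "4 * C" "amp u p"] by simp
next
  case False
  then show ?thesis using forward_bound[of p u B, OF L B, of j] forward_bound[of p u B, OF L B, of "j - 1"] assms(3)
    unfolding amp_def[of u j] by simp
qed

text \<open>This is the boundedness of the Green function with pole \<open>i\<close>, cut off to the left of \<open>p\<close>.\<close>
lemma green_bound:
  assumes LU: "\<And>j. p \<le> j \<Longrightarrow> Lop V U j = 0" and BU: "\<And>j. p \<le> j \<Longrightarrow> cmod (U j) \<le> B"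
    and Ly: "\<And>j. p \<le> j \<Longrightarrow> j < i \<Longrightarrow> Lop V y j = 0" and pi: "p \<le> i"
  shows "cmod (y i) * cmod (U i) \<le> 4 * C * ((2 + 4 * C) * (amp U p * amp y p))"
    "cmod (y i) * cmod (U (i + 1)) \<le> 4 * C * ((2 + 4 * C) * (amp U p * amp y p))"
proof -
  let ?S = "amp U p" and ?Y = "amp y p"
  \<comment> \<open>Up to the factor of the Wronskian this is a Green function: the defect at the
    pole \<open>i\<close> is the Wronskian of \<open>U\<close> and \<open>y\<close>, which is
    constant and can be estimated at \<open>p\<close>. The other defects come from the cut at
    \<open>p\<close>.\<close>
  define g where "g j = (if j < p then 0 else if j \<le> i then y j * U i else y i * U j)" for j
  have SY: "0 \<le> ?S * ?Y" using amp_nonneg by simp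
  have C0: "0 \<le> C" using C_ge_1 by simp
  have c1: "c * (?S * ?Y) \<le> (2 + 4 * C) * (?S * ?Y)" if "c \<le> 2 + 4 * C" for c
    using that SY by (rule mult_right_mono)
  have Ui: "cmod (U i) \<le> 4 * C * ?S" using forward_bound[OF LU BU pi] .
  have e1: "cmod (y k * U i) \<le> (2 + 4 * C) * (?S * ?Y)" if "cmod (y k) \<le> ?Y" for k
  proof -
    have "cmod (y k * U i) \<le> ?Y * (4 * C * ?S)"
      unfolding norm_mult using that Ui amp_nonneg by (intro mult_mono) auto
    also have "\<dots> = 4 * C * (?S * ?Y)" by (simp add: algebra_simps)
    also have "\<dots> \<le> (2 + 4 * C) * (?S * ?Y)" by (rule c1) simp
    finally show ?thesis .
  qed
  have wr_step: "wronskian U y j = wronskian U y (j - 1)" if "p \<le> j" "j < i" for j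
  proof -
    have Uy: "U (j + 1) = - U (j - 1) - V j * U j" "y (j + 1) = - y (j - 1) - V j * y j"
      using LU[of j] Ly[of j] that unfolding Lop_def by (simp_all add: eq_diff_eq eq_neg_iff_add_eq_0 algebra_simps)
    show ?thesis unfolding wronskian_def by (simp only: Uy) (simp add: algebra_simps)
  qed
  have wr: "wronskian U y (p - 1 + int n) = wronskian U y (p - 1)" if "p - 1 + int n < i" for n
    using that
  proof (induction n)
    case (Suc n)
    then show ?case using wr_step[of "p + int n"] by (simp add: algebra_simps)
  qed simp
  have wr_i: "wronskian U y (i - 1) = wronskian U y (p - 1)"
    using wr[of "nat (i - p)"] pi by (simp add: algebra_simps)
  have wr_b: "cmod (wronskian U y (p - 1)) \<le> 2 * (?S * ?Y)"
  proof -
    have "cmod (wronskian U y (p - 1)) \<le> cmod (U p) * cmod (y (p - 1)) + cmod (U (p - 1)) * cmod (y p)"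
      unfolding wronskian_def using norm_triangle_ineq4[of "U p * y (p - 1)" "U (p - 1) * y p"] by (simp add: norm_mult)
    also have "\<dots> \<le> ?S * ?Y + ?S * ?Y" using amp_ge amp_nonneg by (intro add_mono mult_mono) auto
    finally show ?thesis by simp
  qed
  have Lg: "cmod (Lop V g j) \<le> (2 + 4 * C) * (?S * ?Y)" for j
  proof -
    have 0: "0 \<le> (2 + 4 * C) * (?S * ?Y)" using c1[of 0] C0 by simp
    consider "j < p - 1" | "j = p - 1" | "j = p" "p < i" | "p < j" "j < i" | "j = i" | "i < j" using pi by linarith
    then show ?thesis
    proof cases
      case 1 then show ?thesis using 0 by (simp add: Lop_def g_def)
    next
      case 2 then show ?thesis using e1[of p] amp_ge(2)[of y p] pi by (simp add: Lop_def g_def)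
    next
      case 3
      have "Lop V g j = Lop V y p * U i - y (p - 1) * U i"
        using 3 by (simp add: Lop_def g_def algebra_simps)
      then show ?thesis using Ly[of p] 3 e1[of "p - 1"] amp_ge(1)[of y p] by simp
    next
      case 4
      have "Lop V g j = Lop V y j * U i" using 4 by (simp add: Lop_def g_def algebra_simps)
      then show ?thesis using Ly[of j] 4 0 by simp
    next
      case 5
      have Ui1: "U (i + 1) = - U (i - 1) - V i * U i"
        using LU[of i] pi unfolding Lop_def by (simp add: eq_diff_eq eq_neg_iff_add_eq_0 algebra_simps)
      show ?thesis
      proof (cases "i = p")
        case True
        have "Lop V g j = y p * (U (i + 1) + V i * U i)"
          using 5 True by (simp add: Lop_def g_def algebra_simps)
        then have "Lop V g j = - (y p * U (p - 1))" unfolding Ui1 using True by simp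
        then have "cmod (Lop V g j) \<le> ?Y * ?S" using amp_ge amp_nonneg by (simp add: norm_mult mult_mono)
        then show ?thesis using c1[of 1] C0 by (simp add: mult.commute)
      next
        case False
        have "Lop V g j = y i * (U (i + 1) + V i * U i) + y (i - 1) * U i"
          using 5 False pi by (simp add: Lop_def g_def algebra_simps)
        then have "Lop V g j = wronskian U y (i - 1)"
          unfolding Ui1 by (simp add: wronskian_def algebra_simps)
        then show ?thesis using wr_i wr_b c1[of 2] C0 by simp
      qed
    next
      case 6
      have "g (j - 1) = y i * U (j - 1)" using 6 pi by (cases "j = i + 1") (auto simp: g_def)
      then have "Lop V g j = y i * Lop V U j" using 6 pi by (simp add: Lop_def g_def algebra_simps)
      then show ?thesis using LU[of j] 6 pi 0 by simp
    qed
  qed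
  have "\<exists>B'. \<forall>j. cmod (g j) \<le> B'"
  proof (intro exI allI)
    fix j
    have B0: "0 \<le> B" using BU[of p] norm_ge_zero order_trans by blast
    have s: "0 \<le> (\<Sum>j\<in>{p..i}. cmod (y j)) * cmod (U i)" "0 \<le> cmod (y i) * B"
      using B0 by (auto intro!: mult_nonneg_nonneg sum_nonneg)
    have "cmod (y j) \<le> (\<Sum>j\<in>{p..i}. cmod (y j))" if "p \<le> j" "j \<le> i"
      using that by (intro member_le_sum) auto
    then have "cmod (y j * U i) \<le> (\<Sum>j\<in>{p..i}. cmod (y j)) * cmod (U i)" if "p \<le> j" "j \<le> i"
      using that by (simp add: norm_mult mult_right_mono)
    moreover have "cmod (y i * U j) \<le> cmod (y i) * B" if "i < j"
      using BU[of j] pi that by (simp add: norm_mult mult_left_mono)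
    ultimately show "cmod (g j) \<le> (\<Sum>j\<in>{p..i}. cmod (y j)) * cmod (U i) + cmod (y i) * B"
      unfolding g_def using s by (auto simp: not_less not_le intro: add_increasing add_increasing2)
  qed
  then obtain B' where "\<And>j. cmod (g j) \<le> B'" by blast
  from global_bound[OF this Lg] have gb: "cmod (g j) \<le> 4 * C * ((2 + 4 * C) * (?S * ?Y))" for j .
  show "cmod (y i) * cmod (U i) \<le> 4 * C * ((2 + 4 * C) * (?S * ?Y))"
    using gb[of i] pi by (simp add: g_def norm_mult)
  show "cmod (y i) * cmod (U (i + 1)) \<le> 4 * C * ((2 + 4 * C) * (?S * ?Y))"
    using gb[of "i + 1"] pi by (simp add: g_def norm_mult)
qed

text \<open>\<open>green_bound\<close> at \<open>i\<close> and \<open>i - 1\<close> gives all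
  products of neighbouring values except \<open>y i\<close> with \<open>U (i - 1)\<close>. The
  recurrence for \<open>U\<close> expresses this one through the others, at the price of
  \<open>Vb + 1\<close>.\<close>

lemma amp_product_bound:
  assumes LU: "\<And>j. p \<le> j \<Longrightarrow> Lop V U j = 0" and BU: "\<And>j. p \<le> j \<Longrightarrow> cmod (U j) \<le> B"
    and Ly: "\<And>j. p \<le> j \<Longrightarrow> j < i \<Longrightarrow> Lop V y j = 0" and pi: "p \<le> i"
  shows "amp U i * amp y i \<le> (Vb + 1) * (4 * C * (2 + 4 * C)) * (amp U p * amp y p)"
proof -
  define G where "G = 4 * C * ((2 + 4 * C) * (amp U p * amp y p))"
  have SY: "0 \<le> amp U p * amp y p" using amp_nonneg by simp
  have C1: "1 \<le> 4 * C * (2 + 4 * C)" using C_ge_1 mult_mono[of 1 "4 * C" 1 "2 + 4 * C"] by simp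
  have K: "(Vb + 1) * (4 * C * (2 + 4 * C)) * (amp U p * amp y p) = (Vb + 1) * G" by (simp add: G_def algebra_simps)
  have G1: "amp U p * amp y p \<le> G" using mult_right_mono[OF C1 SY] by (simp add: G_def algebra_simps)
  have GK: "G \<le> (Vb + 1) * G" using Vb_nonneg G1 SY mult_right_mono[of 1 "Vb + 1" G] by simp
  show ?thesis
  proof (cases "i = p")
    case True
    then show ?thesis unfolding K using G1 GK by simp
  next
    case False
    note g1 = green_bound[OF LU BU Ly pi, folded G_def]
    have g2: "cmod (y (i - 1)) * cmod (U (i - 1)) \<le> G" "cmod (y (i - 1)) * cmod (U i) \<le> G"
      using green_bound[of p U B "i - 1" y, OF LU BU, folded G_def] Ly False pi by auto
    have U: "U (i - 1) = - U (i + 1) - V i * U i"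
      using LU[of i] pi unfolding Lop_def by (simp add: eq_diff_eq eq_neg_iff_add_eq_0 algebra_simps)
    have "cmod (U (i - 1)) \<le> cmod (U (i + 1)) + cmod (V i) * cmod (U i)"
      unfolding U using norm_triangle_ineq4[of "- U (i + 1)" "V i * U i"] by (simp add: norm_mult)
    also have "\<dots> \<le> cmod (U (i + 1)) + Vb * cmod (U i)" using V_bound[of i] by (simp add: mult_right_mono)
    finally have "cmod (y i) * cmod (U (i - 1)) \<le> cmod (y i) * (cmod (U (i + 1)) + Vb * cmod (U i))"
      by (rule mult_left_mono) simp
    also have "\<dots> = cmod (y i) * cmod (U (i + 1)) + Vb * (cmod (y i) * cmod (U i))" by (simp add: algebra_simps)
    also have "\<dots> \<le> G + Vb * G" using g1 Vb_nonneg by (intro add_mono mult_left_mono) auto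
    finally have g3: "cmod (y i) * cmod (U (i - 1)) \<le> (Vb + 1) * G" by (simp add: algebra_simps)
    show ?thesis unfolding K using g1 g2 g3 GK unfolding amp_def
      by (auto simp: max_def mult.commute split: if_splits)
  qed
qed

lemma forward_tendsto_0:
  assumes L: "\<And>j. p \<le> j \<Longrightarrow> Lop V u j = 0" and B: "\<And>j. p \<le> j \<Longrightarrow> cmod (u j) \<le> B"
  shows "(\<lambda>n. u (p + int n)) \<longlonglongrightarrow> 0"
proof (rule LIMSEQ_I)
  fix r :: real assume r: "0 < r"
  have "(\<lambda>k. (3/4::real) ^ k * (4 * C * amp u p)) \<longlonglongrightarrow> 0 * (4 * C * amp u p)"
    by (intro tendsto_intros LIMSEQ_power_zero) simp
  then have "eventually (\<lambda>k. (3/4::real) ^ k * (4 * C * amp u p) < r) sequentially"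
    using r by (intro order_tendstoD) auto
  then obtain k where k: "(3/4::real) ^ k * (4 * C * amp u p) < r"
    by (auto simp: eventually_sequentially)
  show "\<exists>n0. \<forall>n\<ge>n0. norm (u (p + int n) - 0) < r"
  proof (intro exI allI impI)
    fix n assume "nat (int k * N) \<le> n"
    then have "p + int k * N \<le> p + int n" by linarith
    from forward_decay[OF L B this] show "norm (u (p + int n) - 0) < r" using k by simp
  qed
qed

text \<open>Blocks of length \<open>N\<close> decay like powers of 3/4; the constant 16 is 4 from
  \<open>forward_bound\<close> times 4 from the geometric sum.\<close>

lemma forward_sum:
  assumes L: "\<And>j. p \<le> j \<Longrightarrow> Lop V u j = 0" and B: "\<And>j. p \<le> j \<Longrightarrow> cmod (u j) \<le> B"
  shows "(\<Sum>j<n. cmod (u (p + int j))) \<le> 16 * C * of_int N * amp u p"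
proof -
  define M where "M = nat N"
  have M: "1 \<le> M" "N = int M" using N_pos by (auto simp: M_def)
  let ?a = "4 * C * amp u p"
  have a0: "0 \<le> ?a" using C_ge_1 amp_nonneg[of u p] by simp
  have *: "(\<Sum>j<k * M. cmod (u (p + int j))) \<le> ?a * real M * (4 - 4 * (3/4) ^ k)" for k
  proof (induction k)
    case (Suc k)
    have "(\<Sum>j<Suc k * M. cmod (u (p + int j)))
        = (\<Sum>j<k * M. cmod (u (p + int j))) + (\<Sum>j\<in>{k * M..<k * M + M}. cmod (u (p + int j)))"
      by (subst sum.union_disjoint[symmetric]) (auto intro!: sum.cong)
    also have "(\<Sum>j\<in>{k * M..<k * M + M}. cmod (u (p + int j))) \<le> (\<Sum>j\<in>{k * M..<k * M + M}. (3/4) ^ k * ?a)"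
    proof (rule sum_mono)
      fix j assume "j \<in> {k * M..<k * M + M}"
      then have "p + int k * N \<le> p + int j" unfolding M(2) by (simp flip: of_nat_mult)
      then show "cmod (u (p + int j)) \<le> (3/4) ^ k * ?a" using forward_decay[of p u B, OF L B] by blast
    qed
    also have "\<dots> = ?a * real M * (3/4) ^ k" by simp
    finally show ?case using Suc by (simp add: algebra_simps)
  qed simp
  have "(\<Sum>j<n. cmod (u (p + int j))) \<le> (\<Sum>j<n * M. cmod (u (p + int j)))"
    using M by (intro sum_mono2) (auto intro: order_less_le_trans)
  also have "\<dots> \<le> ?a * real M * (4 - 4 * (3/4) ^ n)" by (rule *)
  also have "\<dots> \<le> ?a * real M * 4" using a0 by (intro mult_left_mono) auto
  finally show ?thesis using M by (simp add: algebra_simps)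
qed

end

section \<open>Uniform hyperbolicity from large traces\<close>

text \<open>\<open>E * x\<close> is treated as inhomogeneity, which adds at most 1/4 to the
  contraction factor.\<close>

lemma loc_ineq_perturb:
  assumes "loc_ineq (1/2) N C x (Lop V x)" "C * cmod E \<le> 1 / 4" "0 \<le> C" "0 \<le> N"
  shows "loc_ineq (3/4) N C x (Lop (\<lambda>j. V j - E) x)"
  unfolding loc_ineq_def
proof (intro allI impI)
  fix i \<eta> B
  assume h: "\<forall>j. \<bar>j - i\<bar> \<le> N \<longrightarrow> cmod (Lop (\<lambda>j. V j - E) x j) \<le> \<eta> \<and> cmod (x j) \<le> B"
  have "cmod (x i) \<le> B" using h assms(4) by simp
  then have B0: "0 \<le> B" using norm_ge_zero order_trans by blast
  have "cmod (Lop V x j) \<le> \<eta> + cmod E * B \<and> cmod (x j) \<le> B" if "\<bar>j - i\<bar> \<le> N" for j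
  proof -
    have "Lop V x j = Lop (\<lambda>j. V j - E) x j + E * x j" by (simp add: Lop_energy)
    then have "cmod (Lop V x j) \<le> cmod (Lop (\<lambda>j. V j - E) x j) + cmod E * cmod (x j)"
      by (metis norm_mult norm_triangle_ineq)
    also have "\<dots> \<le> \<eta> + cmod E * B" using h that by (intro add_mono mult_left_mono) auto
    finally show ?thesis using h that by blast
  qed
  then have "cmod (x i) \<le> 1/2 * B + C * (\<eta> + cmod E * B)"
    using assms(1) unfolding loc_ineq_def by blast
  also have "\<dots> = 1/2 * B + C * \<eta> + (C * cmod E) * B" by (simp add: algebra_simps)
  also have "\<dots> \<le> 1/2 * B + C * \<eta> + 1/4 * B" using mult_right_mono[OF assms(2) B0] by simp
  finally show "cmod (x i) \<le> 3/4 * B + C * \<eta>" by simp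
qed

text \<open>The inequality at \<open>i\<close> sees the potential only within distance
  \<open>N\<close>, so a different comparison potential may be used at every \<open>i\<close>. The
  periodic approximants, whose short windows are Sturmian, inherit the inequality this way.\<close>

lemma loc_ineq_Lop_cong:
  assumes "\<And>i. \<exists>V'. (\<forall>j. \<bar>j - i\<bar> \<le> N \<longrightarrow> V' j = V j) \<and> loc_ineq r N C x (Lop V' x)"
  shows "loc_ineq r N C x (Lop V x)"
  unfolding loc_ineq_def
proof (intro allI impI)
  fix i \<eta> B
  assume h: "\<forall>j. \<bar>j - i\<bar> \<le> N \<longrightarrow> cmod (Lop V x j) \<le> \<eta> \<and> cmod (x j) \<le> B"
  obtain V' where V': "\<And>j. \<bar>j - i\<bar> \<le> N \<Longrightarrow> V' j = V j" "loc_ineq r N C x (Lop V' x)"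
    using assms[of i] by blast
  have "cmod (Lop V' x j) \<le> \<eta> \<and> cmod (x j) \<le> B" if "\<bar>j - i\<bar> \<le> N" for j
    using h that V'(1)[OF that] by (simp add: Lop_def)
  then show "cmod (x i) \<le> r * B + C * \<eta>" using V'(2) unfolding loc_ineq_def by blast
qed

lemma pot_bound: "cmod (pot lam \<beta> \<theta> j) \<le> \<bar>lam\<bar>"
  using sturm_v_bounds[of \<beta> \<theta> j] by (simp add: pot_def norm_mult abs_mult mult_left_le)

lemma pot_add: "pot lam \<beta> \<theta> (i + j) = pot lam \<beta> (\<theta> + of_int i * \<beta>) j"
  by (simp add: pot_def sturm_v_add)

lemma pot_phase: "pot lam \<beta> (\<theta> - of_int i * \<beta>) j = pot lam \<beta> \<theta> (j - i)"
  using pot_add[of lam \<beta> \<theta> "- i" j] by simp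

context irrational_slope
begin

text \<open>Around the centre of a square with period \<open>q m\<close>, the Cayley-Hamilton theorem gives
  \<open>u (c + q m) + u (c - q m) = t * u c\<close> with the large trace \<open>t\<close>.\<close>
lemma square_estimate:
  assumes cl: "clear (Suc m) \<theta> c" and u: "\<And>j. Lop (pot lam \<alpha> \<theta>) u j = 0" and k: "k \<in> {c, c + 1}"
  shows "per_trc lam (Suc m) * u k = u (k + int (q (Suc m))) + u (k - int (q (Suc m)))"
proof -
  let ?V = "pot lam \<alpha> \<theta>" and ?n = "q (Suc m)"
  obtain A B C D where M: "tmat ?V (c - int ?n) ?n = M2 A B C D" by (cases "tmat ?V (c - int ?n) ?n")
  have "tmat (\<lambda>j. ?V (j + int ?n)) (c - int ?n) ?n = tmat ?V (c - int ?n) ?n"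
  proof (rule tmat_cong)
    fix j assume "c - int ?n < j" "j \<le> c - int ?n + int ?n"
    then have "\<not> bad (Suc m) \<theta> j" "\<not> bad (Suc m) \<theta> (j + 1)" using cl unfolding clear_def by auto
    then show "?V (j + int ?n) = ?V j" by (simp add: pot_def sturm_v_period)
  qed
  then have M': "tmat ?V c ?n = M2 A B C D" unfolding tmat_shift using M by simp
  have det: "A * D - B * C = 1" using mdet_tmat[of ?V c ?n] M' by simp
  have tr: "per_trc lam (Suc m) = A + D" using clear_trace[OF cl, of lam] M by simp
  define X Y where "X = u (c - int ?n + 1)" and "Y = u (c - int ?n)"
  have 1: "u (c + 1) = A * X + B * Y" "u c = C * X + D * Y"
    using tmat_apply[OF _ M, of u] u by (simp_all add: X_def Y_def)
  have 2: "u (c + int ?n + 1) = A * u (c + 1) + B * u c" "u (c + int ?n) = C * u (c + 1) + D * u c"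
    using tmat_apply[OF _ M', of u] u by simp_all
  have "(A + D) * u c = u (c + int ?n) + (A * D - B * C) * Y"
    unfolding 2 1 by (simp add: algebra_simps)
  then have c0: "(A + D) * u c = u (c + int ?n) + u (c - int ?n)" unfolding det Y_def by simp
  have "(A + D) * u (c + 1) = u (c + int ?n + 1) + (A * D - B * C) * X"
    unfolding 2 1 by (simp add: algebra_simps)
  then have c1: "(A + D) * u (c + 1) = u (c + int ?n + 1) + u (c - int ?n + 1)" unfolding det X_def by simp
  have e: "c + 1 + int ?n = c + int ?n + 1" "c + 1 - int ?n = c - int ?n + 1" by simp_all
  from k consider "k = c" | "k = c + 1" by blast
  then show ?thesis
  proof cases
    case 1 then show ?thesis unfolding tr using c0 by simp
  next
    case 2 show ?thesis unfolding tr 2 e by (rule c1)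
  qed
qed

text \<open>Near a centre \<open>c\<close>, \<open>x\<close> is compared with the exact solution
  \<open>u\<close> having the same values at \<open>c\<close> and \<open>c + 1\<close>, one of which
  is \<open>i\<close>. \<open>square_estimate\<close> controls \<open>u i\<close> by two distant
  values, and the comparison error is at most \<open>C * \<eta>\<close>.\<close>

lemma sturmian_loc_ineq:
  assumes "\<And>m. m1 \<le> m \<Longrightarrow> 4 \<le> cmod (trc lam m)"
  shows "\<exists>N C. 1 \<le> N \<and> 1 \<le> C \<and> (\<forall>\<theta> x. loc_ineq (1/2) N C x (Lop (pot lam \<alpha> \<theta>) x))"
proof -
  define n where "n = m1 + 2"
  \<comment> \<open>The window must contain \<open>i\<close> shifted by either period; the larger
    one is \<open>q (Suc (Suc n))\<close>.\<close>
  define N where "N = int (q (Suc (Suc n))) + 2"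
  define Q where "Q = \<bar>lam\<bar> + 2"
  define C where "C = Q ^ nat (2 * N + 2)"
  have Q1: "1 \<le> Q" by (simp add: Q_def)
  then have C1: "1 \<le> C" by (simp add: C_def)
  have big: "4 \<le> cmod (per_trc lam m)" if "m \<in> {Suc n, Suc (Suc n)}" for m
  proof -
    have "trc lam m = per_trc lam m"
      using that trc_eq_per_trc[of lam m1] trc_eq_per_trc[of lam "Suc m1"] by (auto simp: n_def)
    moreover have "m1 \<le> m" using that by (auto simp: n_def)
    ultimately show ?thesis using assms[of m] by simp
  qed
  have q2: "2 \<le> q (Suc n)" using q_Suc_Suc_ge_2[of "m1 + 1"] by (simp add: n_def del: cf_q.simps)
  have "loc_ineq (1/2) N C x (Lop (pot lam \<alpha> \<theta>) x)" for \<theta> x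
    unfolding loc_ineq_def
  proof (intro allI impI)
    fix i \<eta> B
    let ?V = "pot lam \<alpha> \<theta>"
    assume h: "\<forall>j. \<bar>j - i\<bar> \<le> N \<longrightarrow> cmod (Lop ?V x j) \<le> \<eta> \<and> cmod (x j) \<le> B"
    have N0: "0 \<le> N" by (simp add: N_def)
    have "cmod (Lop ?V x i) \<le> \<eta>" using h N0 by simp
    then have \<eta>0: "0 \<le> \<eta>" using norm_ge_zero order_trans by blast
    obtain c m where c: "c \<in> {i - 1, i}" and m: "m \<in> {Suc n, Suc (Suc n)}" and cl: "clear m \<theta> c"
      using clear_exists[OF q2, of i \<theta>] by blast
    obtain u where u: "\<And>j. Lop ?V u j = 0" "u c = x c" "u (c + 1) = x (c + 1)"
      using sol_exists[of ?V c "x c" "x (c + 1)"] by blast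
    have d: "cmod (x j - u j) \<le> C * \<eta>" if "\<bar>j - i\<bar> \<le> N" for j
    proof -
      have "cmod (x j - u j) \<le> (\<bar>lam\<bar> + 2) ^ nat ((i + N) - (i - N) + 2) * \<eta>"
        by (rule growth_both[where V = ?V and x = "\<lambda>j. x j - u j" and c = c, OF pot_bound])
          (use h u \<eta>0 that c N0 in \<open>auto simp: Lop_diff\<close>)
      then show ?thesis by (simp add: C_def Q_def)
    qed
    have ub: "cmod (u j) \<le> B + C * \<eta>" if "\<bar>j - i\<bar> \<le> N" for j
    proof -
      have "cmod (u j) \<le> cmod (x j) + cmod (x j - u j)" by (metis norm_minus_commute norm_triangle_sub)
      moreover have "cmod (x j) \<le> B" using h that by blast
      ultimately show ?thesis using d[OF that] by linarith
    qed
    have qm: "q m \<le> q (Suc (Suc n))" using m q_Suc_mono[of "Suc n"] by auto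
    have xi: "x i = u i" and ic: "i \<in> {c, c + 1}" using c u by auto
    obtain m' where m': "m = Suc m'" using m by auto
    have "4 * cmod (u i) \<le> cmod (per_trc lam m) * cmod (u i)"
      using big[OF m] by (rule mult_right_mono) simp
    also have "\<dots> = cmod (u (i + int (q m)) + u (i - int (q m)))"
      using square_estimate[of m' \<theta> c lam u i] cl u(1) ic m' by (simp add: norm_mult[symmetric])
    also have "\<dots> \<le> cmod (u (i + int (q m))) + cmod (u (i - int (q m)))" by (rule norm_triangle_ineq)
    also have "\<dots> \<le> (B + C * \<eta>) + (B + C * \<eta>)"
      using qm by (intro add_mono ub) (auto simp: N_def simp del: cf_q.simps)
    finally have "cmod (x i) \<le> 1/2 * B + 1/2 * (C * \<eta>)" using xi by simp
    moreover have "0 \<le> C * \<eta>" using C1 \<eta>0 by simp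
    ultimately show "cmod (x i) \<le> 1/2 * B + C * \<eta>" by simp
  qed
  moreover have "1 \<le> N" by (simp add: N_def)
  ultimately show ?thesis using C1 by blast
qed

lemma uniformly_hyperbolic:
  assumes "\<And>m. m1 \<le> m \<Longrightarrow> 4 \<le> cmod (trc lam m)"
  shows "\<exists>N C \<delta> M. 1 \<le> N \<and> 1 \<le> C \<and> 0 < \<delta> \<and> \<delta> \<le> 1 \<and>
    (\<forall>\<theta> E. cmod E \<le> \<delta> \<longrightarrow> hyperbolic (\<lambda>j. pot lam \<alpha> \<theta> j - E) N C (\<bar>lam\<bar> + 1)) \<and>
    (\<forall>m\<ge>M. \<forall>k E. cmod E \<le> \<delta> \<longrightarrow>
       hyperbolic (\<lambda>j. pot lam (cf_approx \<alpha> m) 0 (k + j) - E) N C (\<bar>lam\<bar> + 1))"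
proof -
  obtain N C where NC: "1 \<le> N" "1 \<le> C" and loc: "\<And>\<theta> x. loc_ineq (1/2) N C x (Lop (pot lam \<alpha> \<theta>) x)"
    using sturmian_loc_ineq[OF assms] by blast
  define \<delta> where "\<delta> = 1 / (4 * C)"
  have \<delta>: "0 < \<delta>" "\<delta> \<le> 1" "C * \<delta> = 1 / 4" using NC by (auto simp: \<delta>_def field_simps)
  have EC: "C * cmod E \<le> 1 / 4" if "cmod E \<le> \<delta>" for E
    using mult_left_mono[OF that, of C] NC \<delta> by simp
  have bd: "cmod (pot lam \<beta> \<theta> j - E) \<le> \<bar>lam\<bar> + 1" if "cmod E \<le> \<delta>" for E \<beta> \<theta> j
    using norm_triangle_ineq4[of "pot lam \<beta> \<theta> j" E] pot_bound[of lam \<beta> \<theta> j] that \<delta> by linarith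
  \<comment> \<open>The number of letters seen by the inequality at one place; \<open>M\<close>
    makes such windows short enough for \<open>approx_window_is_sturmian\<close>.\<close>
  define L where "L = 2 * N + 1"
  define M where "M = nat (2 * L) + 3"
  have locm: "loc_ineq (1/2) N C x (Lop (\<lambda>j. pot lam (cf_approx \<alpha> m) 0 (k + j)) x)" if m: "M \<le> m" for m x k
  proof (rule loc_ineq_Lop_cong)
    fix i
    have "2 \<le> m" "2 * L < int (q (Suc m))" "0 \<le> L"
      using m q_ge[of m] NC by (auto simp: M_def L_def)
    then obtain y where y: "\<And>j. 0 \<le> j \<Longrightarrow> j < L \<Longrightarrow> sturm_v (cf_approx \<alpha> m) 0 (k + (i - N) + j) = sturm_v \<alpha> y j"
      using approx_window_is_sturmian[of m L "k + (i - N)"] by blast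
    have "pot lam \<alpha> (y - of_int (i - N) * \<alpha>) j = pot lam (cf_approx \<alpha> m) 0 (k + j)" if "\<bar>j - i\<bar> \<le> N" for j
      unfolding pot_phase using y[of "j - (i - N)"] that by (simp add: pot_def L_def algebra_simps)
    then show "\<exists>V'. (\<forall>j. \<bar>j - i\<bar> \<le> N \<longrightarrow> V' j = pot lam (cf_approx \<alpha> m) 0 (k + j)) \<and> loc_ineq (1/2) N C x (Lop V' x)"
      using loc by blast
  qed
  show ?thesis
  proof (intro exI conjI allI impI)
    fix \<theta> E assume E: "cmod E \<le> \<delta>"
    show "hyperbolic (\<lambda>j. pot lam \<alpha> \<theta> j - E) N C (\<bar>lam\<bar> + 1)"
    proof
      show "loc_ineq (3/4) N C x (Lop (\<lambda>j. pot lam \<alpha> \<theta> j - E) x)" for x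
        using NC by (intro loc_ineq_perturb loc EC E) simp_all
    qed (fact NC bd[OF E])+
  next
    fix m k E assume m: "M \<le> m" and E: "cmod E \<le> \<delta>"
    show "hyperbolic (\<lambda>j. pot lam (cf_approx \<alpha> m) 0 (k + j) - E) N C (\<bar>lam\<bar> + 1)"
    proof
      show "loc_ineq (3/4) N C x (Lop (\<lambda>j. pot lam (cf_approx \<alpha> m) 0 (k + j) - E) x)" for x
        using NC by (intro loc_ineq_perturb locm m EC E) simp_all
    qed (fact NC bd[OF E])+
  qed (use NC \<delta> in auto)
qed

end

section \<open>Edge energies of half-line solutions\<close>

lemma floquet_forward_bounded:
  fixes u :: "int \<Rightarrow> complex"
  assumes n: "1 \<le> n" and u: "\<And>j. u (j + int n) = z * u j" and z: "cmod z \<le> 1"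
  shows "\<exists>B. \<forall>j\<ge>0. cmod (u j) \<le> B"
proof -
  define B where "B = (\<Sum>r<n. cmod (u (int r)))"
  have "cmod (u (int k)) \<le> B" for k
  proof (induction k rule: less_induct)
    case (less k)
    show ?case
    proof (cases "k < n")
      case True
      then show ?thesis unfolding B_def by (intro member_le_sum[where f = "\<lambda>r. cmod (u (int r))"]) auto
    next
      case False
      have "u (int k) = z * u (int (k - n))" using u[of "int (k - n)"] False by (simp add: of_nat_diff)
      then have "cmod (u (int k)) \<le> 1 * cmod (u (int (k - n)))"
        using z by (simp add: norm_mult mult_right_le_one_le mult_left_le_one_le)
      then show ?thesis using less[of "k - n"] False n by simp
    qed
  qed
  then have "cmod (u j) \<le> B" if "0 \<le> j" for j using that by (metis nonneg_int_cases)
  then show ?thesis by blast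
qed

lemma floquet_bounded:
  fixes u :: "int \<Rightarrow> complex"
  assumes n: "1 \<le> n" and u: "\<And>j. u (j + int n) = z * u j" and z: "cmod z = 1"
  shows "\<exists>B. \<forall>j. cmod (u j) \<le> B"
proof -
  define B where "B = (\<Sum>r<n. cmod (u (int r)))"
  have k: "cmod (u (j + int k * int n)) = cmod (u j)" for j k
  proof (induction k)
    case (Suc k)
    have e: "j + int (Suc k) * int n = (j + int k * int n) + int n" by (simp add: algebra_simps)
    show ?case unfolding e using Suc u[of "j + int k * int n"] z by (simp add: norm_mult)
  qed simp
  have "cmod (u j) \<le> B" for j
  proof -
    define r where "r = j mod int n"
    have r: "0 \<le> r" "r < int n" using n by (simp_all add: r_def)
    have jr: "j = r + (j div int n) * int n" by (simp add: r_def)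
    have "cmod (u j) = cmod (u r)"
    proof (cases "0 \<le> j div int n")
      case True
      then show ?thesis using k[of r "nat (j div int n)"] jr by simp
    next
      case False
      have "r = j + (- (j div int n)) * int n" using jr by (simp add: algebra_simps)
      then show ?thesis using k[of j "nat (- (j div int n))"] False by simp
    qed
    also have "\<dots> \<le> B" unfolding B_def using r member_le_sum[of "nat r" "{..<n}" "\<lambda>r. cmod (u (int r))"] by simp
    finally show ?thesis .
  qed
  then show ?thesis by blast
qed

lemma quadratic_roots_product_1:
  fixes t :: complex
  shows "\<exists>z w. z * z - t * z + 1 = 0 \<and> w * w - t * w + 1 = 0 \<and> z * w = 1"
proof -
  define s where "s = csqrt (t * t - 4)"
  have s: "s * s = t * t - 4" using power2_csqrt[of "t * t - 4"] by (simp add: s_def power2_eq_square)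
  define z w where "z = (t + s) / 2" and "w = (t - s) / 2"
  have "z * z - t * z + 1 = (s * s - (t * t - 4)) / 4" "w * w - t * w + 1 = (s * s - (t * t - 4)) / 4"
    "z * w = (t * t - s * s) / 4"
    unfolding z_def w_def by (simp_all add: field_simps)
  then have "z * z - t * z + 1 = 0" "w * w - t * w + 1 = 0" "z * w = 1" unfolding s by simp_all
  then show ?thesis by blast
qed

text \<open>A multiplier of modulus 1 would give a bounded nonzero solution, which
  \<open>global_bound\<close> excludes. The two multipliers have product 1, so one lies inside the
  unit circle.\<close>

lemma (in hyperbolic) stable_floquet:
  assumes n: "1 \<le> n" and per: "\<And>j. V (j + int n) = V j"
  shows "\<exists>u z. (\<forall>j. Lop V u j = 0) \<and> (\<forall>j. u (j + int n) = z * u j) \<and> cmod z < 1 \<and> 0 < amp u 0 \<and>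
    (\<exists>B. \<forall>j\<ge>0. cmod (u j) \<le> B)"
proof -
  obtain z w where zw: "z * z - mtr (tmat V 0 n) * z + 1 = 0" "w * w - mtr (tmat V 0 n) * w + 1 = 0" "z * w = 1"
    using quadratic_roots_product_1 by blast
  have ne1: "cmod z \<noteq> 1"
  proof
    assume z1: "cmod z = 1"
    obtain u where u: "\<And>j. Lop V u j = 0" "u 0 \<noteq> 0 \<or> u 1 \<noteq> 0" "\<And>j. u (j + int n) = z * u j"
      using floquet[OF V_bound per n zw(1)] by blast
    obtain B where "\<And>j. cmod (u j) \<le> B" using floquet_bounded[where u = u, OF n u(3) z1] by blast
    then have "cmod (u i) \<le> 4 * C * 0" for i by (rule global_bound) (simp add: u)
    then show False using u(2) by auto
  qed
  have "\<exists>z. cmod z < 1 \<and> z * z - mtr (tmat V 0 n) * z + 1 = 0"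
  proof (cases "cmod z < 1")
    case False
    have "cmod z * cmod w = 1" using zw(3) by (metis norm_mult norm_one)
    moreover have "cmod z * 1 \<le> cmod z * cmod w" if "1 \<le> cmod w" using that by (intro mult_left_mono) auto
    ultimately have "cmod w < 1" using False ne1 by fastforce
    then show ?thesis using zw by blast
  qed (use zw in blast)
  then obtain z where z: "cmod z < 1" "z * z - mtr (tmat V 0 n) * z + 1 = 0" by blast
  obtain u where u: "\<And>j. Lop V u j = 0" "u 0 \<noteq> 0 \<or> u 1 \<noteq> 0" "\<And>j. u (j + int n) = z * u j"
    using floquet[OF V_bound per n z(2)] by blast
  have "0 < amp u 0"
  proof (rule ccontr)
    assume "\<not> 0 < amp u 0"
    then have a0: "amp u 0 = 0" using amp_nonneg[of u 0] by linarith
    have "u (- 1) = 0" "u 0 = 0" using amp_ge[of u 0] unfolding a0 by simp_all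
    then have "u 1 = 0" using u(1)[of 0] by (simp add: Lop_def)
    with \<open>u 0 = 0\<close> show False using u(2) by simp
  qed
  then show ?thesis using u z floquet_forward_bounded[where u = u, OF n u(3)] by (meson less_imp_le)
qed

text \<open>Discrete Lagrange identity: the derivative of the Wronskian along the lattice is the
  energy difference times the product of the solutions.\<close>

lemma wronskian_energy:
  assumes "\<And>j. 0 \<le> j \<Longrightarrow> Lop (\<lambda>j. V j - E) u j = 0" "\<And>j. 0 \<le> j \<Longrightarrow> Lop (\<lambda>j. V j - E') u' j = 0"
  shows "wronskian u' u (- 1) = wronskian u' u (int n - 1) + (E - E') * (\<Sum>j<n. u (int j) * u' (int j))"
proof (induction n)
  case (Suc n)
  have 1: "u (int n + 1) = - u (int n - 1) - (V (int n) - E) * u (int n)"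
    "u' (int n + 1) = - u' (int n - 1) - (V (int n) - E') * u' (int n)"
    using assms(1)[of "int n"] assms(2)[of "int n"] unfolding Lop_def
    by (simp_all add: eq_diff_eq eq_neg_iff_add_eq_0 algebra_simps)
  have "wronskian u' u (int (Suc n) - 1) = u' (int n + 1) * u (int n) - u' (int n) * u (int n + 1)"
    by (simp add: wronskian_def add.commute)
  also have "\<dots> = wronskian u' u (int n - 1) - (E - E') * (u (int n) * u' (int n))"
    unfolding 1 by (simp add: wronskian_def algebra_simps)
  finally have "wronskian u' u (int n - 1) = wronskian u' u (int (Suc n) - 1) + (E - E') * (u (int n) * u' (int n))"
    by simp
  then show ?case using Suc by (simp add: distrib_left)
qed simp

text \<open>Normalise the decaying solution by \<open>u 0 = 1\<close> and follow its value at
  \<open>- 1\<close> as a function \<open>F\<close> of the energy. By the Wronskian identity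
  \<open>F E - F 0\<close> is \<open>E\<close> times a sum close to a sum of real squares starting
  with 1, so \<open>F\<close> has slope at least 1/2 and a zero within \<open>2 * \<tau>\<close>.
  The threshold depends only on \<open>N\<close>, \<open>C\<close> and \<open>\<delta>\<close> and
  hence serves all approximants.\<close>

lemma edge_energy:
  fixes N :: int and C \<delta> :: real
  assumes N: "1 \<le> N" and C: "1 \<le> C" and \<delta>: "0 < \<delta>"
  shows "\<exists>\<tau>0>0. \<forall>V n Vb \<tau> u0.
    (\<forall>E. cmod E \<le> \<delta> \<longrightarrow> hyperbolic (\<lambda>j. V j - E) N C Vb) \<longrightarrow> (\<forall>j. cnj (V j) = V j) \<longrightarrow>
    (\<forall>j. V (j + int n) = V j) \<longrightarrow> 1 \<le> n \<longrightarrow> 0 \<le> \<tau> \<longrightarrow> \<tau> \<le> \<tau>0 \<longrightarrow>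
    (\<forall>j. Lop V u0 j = 0) \<longrightarrow> (\<exists>B. \<forall>j\<ge>0. cmod (u0 j) \<le> B) \<longrightarrow> u0 0 = 1 \<longrightarrow> cmod (u0 (- 1)) \<le> \<tau> \<longrightarrow>
    (\<exists>E::real. \<bar>E\<bar> \<le> 2 * \<tau> \<and> (\<exists>u z. (\<forall>j. Lop (\<lambda>j. V j - of_real E) u j = 0) \<and> u (- 1) = 0 \<and> u 0 = 1 \<and>
       (\<forall>j. u (j + int n) = z * u j) \<and> cmod z < 1))"
proof -
  define rN where "rN = real_of_int N"
  have rN: "1 \<le> rN" using N by (simp add: rN_def)
  \<comment> \<open>\<open>c\<close> bounds Wronskians per unit of energy difference:
    \<open>4 * C\<close> for one solution times \<open>16 * C * rN\<close> for the sum of the other.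
    \<open>c'\<close> bounds the change of the normalised solution per unit of energy. In
    \<open>\<delta>1\<close> the second term keeps the value at 0 dominant over that at
    \<open>- 1\<close>, the third keeps the sum of products above 1/2.\<close>
  define c where "c = 64 * C * C * rN"
  define c' where "c' = 4 * C * (4 * C + c)"
  define \<delta>1 where "\<delta>1 = min \<delta> (min (1 / (2 * c)) (1 / (32 * C * rN * c')))"
  define \<tau>0 where "\<tau>0 = min (1/2) (\<delta>1 / 2)"
  have c0: "0 < c" using C rN by (simp add: c_def)
  have c'0: "0 < c'" using C c0 by (simp add: c'_def add_pos_pos)
  have \<delta>1: "0 < \<delta>1" "\<delta>1 \<le> \<delta>" "\<delta>1 \<le> 1 / (2 * c)" "\<delta>1 \<le> 1 / (32 * C * rN * c')"
    using \<delta> c0 c'0 C rN by (auto simp: \<delta>1_def)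
  have \<tau>0: "0 < \<tau>0" "\<tau>0 \<le> 1/2" "2 * \<tau>0 \<le> \<delta>1" using \<delta>1 by (auto simp: \<tau>0_def)
  show ?thesis
  proof (rule exI[of _ \<tau>0], intro conjI allI impI \<tau>0(1))
    fix V :: "int \<Rightarrow> complex" and n :: nat and Vb \<tau> :: real and u0 :: "int \<Rightarrow> complex"
    assume hyp: "\<forall>E. cmod E \<le> \<delta> \<longrightarrow> hyperbolic (\<lambda>j. V j - E) N C Vb"
      and Vr: "\<forall>j. cnj (V j) = V j" and per: "\<forall>j. V (j + int n) = V j" and n: "1 \<le> n"
      and \<tau>: "0 \<le> \<tau>" "\<tau> \<le> \<tau>0" and u0: "\<forall>j. Lop V u0 j = 0" "\<exists>B. \<forall>j\<ge>0. cmod (u0 j) \<le> B"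
        "u0 0 = 1" "cmod (u0 (- 1)) \<le> \<tau>"
    define st where "st E u \<longleftrightarrow> (\<forall>j. Lop (\<lambda>j. V j - of_real E) u j = 0) \<and> (\<exists>B. \<forall>j\<ge>0. cmod (u j) \<le> B)"
      for E :: real and u
    have h: "hyperbolic (\<lambda>j. V j - of_real E) N C Vb" if "\<bar>E\<bar> \<le> \<delta>" for E :: real
      using hyp that by simp

    \<comment> \<open>Decaying solutions at two energies\<close>
    have to0: "(\<lambda>k. u (int k)) \<longlonglongrightarrow> 0" if s: "\<bar>E\<bar> \<le> \<delta>" "st E u" for E u
    proof -
      interpret hyperbolic "\<lambda>j. V j - of_real E" N C Vb by (rule h[OF s(1)])
      obtain B where B: "\<And>j. 0 \<le> j \<Longrightarrow> cmod (u j) \<le> B" using s(2) unfolding st_def by blast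
      show ?thesis using forward_tendsto_0[of 0 u B] s(2) B unfolding st_def by simp
    qed
    have bd: "cmod (u j) \<le> 4 * C * amp u 0" if s: "\<bar>E\<bar> \<le> \<delta>" "st E u" "0 \<le> j" for E u j
    proof -
      interpret hyperbolic "\<lambda>j. V j - of_real E" N C Vb by (rule h[OF s(1)])
      obtain B where B: "\<And>j. 0 \<le> j \<Longrightarrow> cmod (u j) \<le> B" using s(2) unfolding st_def by blast
      show ?thesis using forward_bound[of 0 u B j] s B unfolding st_def by simp
    qed
    have sm: "(\<Sum>j<k. cmod (u (int j))) \<le> 16 * C * rN * amp u 0" if s: "\<bar>E\<bar> \<le> \<delta>" "st E u" for E u k
    proof -
      interpret hyperbolic "\<lambda>j. V j - of_real E" N C Vb by (rule h[OF s(1)])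
      obtain B where B: "\<And>j. 0 \<le> j \<Longrightarrow> cmod (u j) \<le> B" using s(2) unfolding st_def by blast
      show ?thesis using forward_sum[of 0 u B k] s B unfolding st_def rN_def by simp
    qed
    have wr0: "(\<lambda>k. wronskian u' u (int k - 1)) \<longlonglongrightarrow> 0"
      if "\<bar>E\<bar> \<le> \<delta>" "st E u" "\<bar>E'\<bar> \<le> \<delta>" "st E' u'" for E E' u u'
    proof -
      have a: "(\<lambda>k. u (int k)) \<longlonglongrightarrow> 0" "(\<lambda>k. u' (int k)) \<longlonglongrightarrow> 0" using to0 that by blast+
      have b: "(\<lambda>k. u (int (Suc k))) \<longlonglongrightarrow> 0" "(\<lambda>k. u' (int (Suc k))) \<longlonglongrightarrow> 0"
        using LIMSEQ_Suc[OF a(1)] LIMSEQ_Suc[OF a(2)] by blast+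
      have "(\<lambda>k. u' (int (Suc k)) * u (int k) - u' (int k) * u (int (Suc k))) \<longlonglongrightarrow> 0 * 0 - 0 * 0"
        by (intro tendsto_intros a b)
      then have "(\<lambda>k. wronskian u' u (int (Suc k) - 1)) \<longlonglongrightarrow> 0" by (simp add: wronskian_def add.commute)
      then show ?thesis by (rule LIMSEQ_imp_Suc)
    qed
    have wrE: "wronskian u' u (- 1) - wronskian u' u (int k - 1) = of_real (E - E') * (\<Sum>j<k. u (int j) * u' (int j))"
      if "st E u" "st E' u'" for E E' u u' k
      using wronskian_energy[of V "of_real E" u "of_real E'" u' k] that unfolding st_def by simp
    have lip: "cmod (wronskian u' u (- 1)) \<le> \<bar>E - E'\<bar> * (c * (amp u 0 * amp u' 0))"
      if s: "\<bar>E\<bar> \<le> \<delta>" "st E u" "\<bar>E'\<bar> \<le> \<delta>" "st E' u'" for E E' u u'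
    proof (rule tendsto_upperbound)
      show "(\<lambda>k. cmod (wronskian u' u (- 1) - wronskian u' u (int k - 1))) \<longlonglongrightarrow> cmod (wronskian u' u (- 1))"
        using tendsto_norm[OF tendsto_diff[OF tendsto_const wr0[OF s]]] by simp
      show "\<forall>\<^sub>F k in sequentially. cmod (wronskian u' u (- 1) - wronskian u' u (int k - 1))
          \<le> \<bar>E - E'\<bar> * (c * (amp u 0 * amp u' 0))"
      proof (intro always_eventually allI)
        fix k
        have "cmod (\<Sum>j<k. u (int j) * u' (int j)) \<le> (\<Sum>j<k. 4 * C * amp u 0 * cmod (u' (int j)))"
          using bd[OF s(1,2)] by (intro sum_norm_le) (simp add: norm_mult mult_right_mono)
        also have "\<dots> = 4 * C * amp u 0 * (\<Sum>j<k. cmod (u' (int j)))" by (simp add: sum_distrib_left)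
        also have "\<dots> \<le> 4 * C * amp u 0 * (16 * C * rN * amp u' 0)"
          using sm[OF s(3,4)] C amp_nonneg[of u 0] by (intro mult_left_mono) auto
        also have "\<dots> = c * (amp u 0 * amp u' 0)" by (simp add: c_def)
        finally have "cmod (\<Sum>j<k. u (int j) * u' (int j)) \<le> c * (amp u 0 * amp u' 0)" .
        then show "cmod (wronskian u' u (- 1) - wronskian u' u (int k - 1)) \<le> \<bar>E - E'\<bar> * (c * (amp u 0 * amp u' 0))"
          unfolding wrE[OF s(2,4)] norm_mult norm_of_real by (intro mult_left_mono) auto
      qed
    qed simp
    have st0: "st 0 u0" using u0 by (simp add: st_def)
    have amp0: "amp u0 0 = 1" using u0(3,4) \<tau> \<tau>0 by (simp add: amp_def)

    \<comment> \<open>The normalised real solution\<close>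
    have ex_f: "\<exists>u z. st E u \<and> (\<forall>j. u (j + int n) = z * u j) \<and> cmod z < 1 \<and> 0 < amp u 0" if "\<bar>E\<bar> \<le> \<delta>" for E
    proof -
      interpret hyperbolic "\<lambda>j. V j - of_real E" N C Vb by (rule h[OF that])
      show ?thesis using stable_floquet[OF n] per unfolding st_def by (metis (no_types, lifting))
    qed
    have ex: "\<exists>u. st E u \<and> u 0 = 1 \<and> (\<forall>j. cnj (u j) = u j) \<and> cmod (u (- 1)) \<le> 1" if E: "\<bar>E\<bar> \<le> \<delta>1" for E
    proof -
      have E\<delta>: "\<bar>E\<bar> \<le> \<delta>" using E \<delta>1 by simp
      obtain f z where f: "st E f" "0 < amp f 0" using ex_f[OF E\<delta>] by blast
      have "\<bar>E\<bar> * c \<le> 1 / 2"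
      proof -
        have "\<bar>E\<bar> * c \<le> 1 / (2 * c) * c" using E \<delta>1 c0 by (intro mult_right_mono) auto
        then show ?thesis using c0 by simp
      qed
      then have "\<bar>E\<bar> * c * amp f 0 \<le> 1 / 2 * amp f 0" using amp_nonneg by (intro mult_right_mono)
      moreover have "cmod (f (- 1) - f 0 * u0 (- 1)) \<le> \<bar>E - 0\<bar> * (c * (amp f 0 * amp u0 0))"
        using lip[OF E\<delta> f(1) _ st0] \<delta> u0(3) by (simp add: wronskian_def mult.commute)
      ultimately have w: "cmod (f (- 1) - f 0 * u0 (- 1)) \<le> 1 / 2 * amp f 0"
        unfolding amp0 by (simp only: diff_0_right mult_1_right mult.assoc)
      have w2: "cmod (f (- 1)) \<le> cmod (f 0) * (1/2) + 1 / 2 * amp f 0"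
      proof -
        have "cmod (f (- 1)) \<le> cmod (f 0 * u0 (- 1)) + cmod (f (- 1) - f 0 * u0 (- 1))"
          using norm_triangle_sub by blast
        moreover have "cmod (f 0 * u0 (- 1)) \<le> cmod (f 0) * (1/2)"
          unfolding norm_mult using u0(4) \<tau> \<tau>0 by (intro mult_left_mono) auto
        ultimately show ?thesis using w by linarith
      qed
      \<comment> \<open>If the value at \<open>- 1\<close> were the larger one, it would be
        \<open>amp f 0\<close>, and \<open>w2\<close> would bound half of it by half of the value at
        0.\<close>
      have le: "cmod (f (- 1)) \<le> cmod (f 0)"
        using w2 by (cases "cmod (f (- 1)) \<le> cmod (f 0)") (auto simp: amp_def)
      then have f0: "0 < cmod (f 0)" using f(2) by (simp add: amp_def)
      define g where "g j = f j / f 0" for j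
      have gL: "Lop (\<lambda>j. V j - of_real E) g j = 0" for j
      proof -
        have "g = (\<lambda>j. 1 / f 0 * f j)" by (auto simp: g_def)
        then show ?thesis using f(1) by (simp add: st_def Lop_scale del: times_divide_eq_left)
      qed
      have cL: "Lop (\<lambda>j. V j - of_real E) (\<lambda>j. cnj (g j)) j = 0" for j
      proof -
        have "Lop (\<lambda>j. V j - of_real E) (\<lambda>j. cnj (g j)) j = cnj (Lop (\<lambda>j. V j - of_real E) g j)"
          using Vr by (simp add: Lop_def)
        then show ?thesis using gL by simp
      qed
      \<comment> \<open>Potential and energy are real, so the conjugate is a solution as well. A
        real boundary value is needed for the intermediate value theorem.\<close>
      define u where "u j = complex_of_real (Re (g j))" for j
      have ug: "u j = 1 / 2 * (g j - - 1 * cnj (g j))" for j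
        by (simp add: u_def complex_eq_iff)
      have "Lop (\<lambda>j. V j - of_real E) u j = 0" for j
        unfolding ug Lop_scale Lop_diff using gL cL by simp
      moreover obtain B where B: "\<And>j. 0 \<le> j \<Longrightarrow> cmod (f j) \<le> B" using f(1) unfolding st_def by blast
      have ub: "cmod (u j) \<le> cmod (f j) / cmod (f 0)" for j
        unfolding u_def norm_of_real using abs_Re_le_cmod[of "g j"] by (simp add: g_def norm_divide)
      then have "cmod (u j) \<le> B / cmod (f 0)" if "0 \<le> j" for j
        using divide_right_mono[OF B[OF that], of "cmod (f 0)"] order_trans by fastforce
      ultimately have "st E u" unfolding st_def by blast
      moreover have "u 0 = 1" using f0 by (simp add: u_def g_def)
      moreover have "cmod (u (- 1)) \<le> 1" using ub[of "-1"] le f0 by (simp add: order_trans divide_le_eq)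
      moreover have "cnj (u j) = u j" for j by (simp add: u_def)
      ultimately show ?thesis by blast
    qed
    then obtain U where U: "\<And>E. \<bar>E\<bar> \<le> \<delta>1 \<Longrightarrow> st E (U E)" "\<And>E. \<bar>E\<bar> \<le> \<delta>1 \<Longrightarrow> U E 0 = 1"
      "\<And>E j. \<bar>E\<bar> \<le> \<delta>1 \<Longrightarrow> cnj (U E j) = U E j" "\<And>E. \<bar>E\<bar> \<le> \<delta>1 \<Longrightarrow> cmod (U E (- 1)) \<le> 1"
      by metis
    have ampU: "amp (U E) 0 = 1" if "\<bar>E\<bar> \<le> \<delta>1" for E using U(2,4)[OF that] by (simp add: amp_def)

    \<comment> \<open>The boundary value as a function of the energy\<close>
    define F where "F E = Re (U E (- 1))" for E
    have Lip: "cmod (U E (- 1) - U E' (- 1)) \<le> \<bar>E - E'\<bar> * c" if "\<bar>E\<bar> \<le> \<delta>1" "\<bar>E'\<bar> \<le> \<delta>1" for E E'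
      using lip[OF _ U(1)[OF that(1)] _ U(1)[OF that(2)]] that \<delta>1 U(2) ampU by (simp add: wronskian_def)
    have Flip: "\<bar>F E - F E'\<bar> \<le> \<bar>E - E'\<bar> * c" if "\<bar>E\<bar> \<le> \<delta>1" "\<bar>E'\<bar> \<le> \<delta>1" for E E'
      using Lip[OF that] abs_Re_le_cmod[of "U E (- 1) - U E' (- 1)"] by (simp add: F_def)
    have F0: "\<bar>F 0\<bar> \<le> \<tau>"
    proof -
      have "cmod (wronskian u0 (U 0) (- 1)) \<le> 0" using lip[OF _ U(1)[of 0] _ st0] \<delta> \<delta>1 by simp
      then have "U 0 (- 1) = u0 (- 1)" using U(2)[of 0] u0(3) \<delta>1 by (simp add: wronskian_def)
      then show ?thesis using u0(4) abs_Re_le_cmod[of "u0 (- 1)"] by (simp add: F_def)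
    qed
    have slope: "1/2 * (E * E) \<le> E * (F E - F 0)" if E: "\<bar>E\<bar> \<le> \<delta>1" for E
    proof -
      define u w where "u = U E" and "w = U 0"
      have z1: "\<bar>0\<bar> \<le> \<delta>1" using \<delta>1 by simp
      have E\<delta>: "\<bar>E\<bar> \<le> \<delta>" using E \<delta>1 by simp
      have su: "st E u" and sw: "st 0 w" using U(1)[OF E] U(1)[OF z1] by (auto simp: u_def w_def)
      have uw0: "u 0 = 1" "w 0 = 1" using U(2)[OF E] U(2)[OF z1] by (auto simp: u_def w_def)
      have aw: "amp w 0 = 1" "amp u 0 = 1" using ampU E z1 by (auto simp: u_def w_def)
      define d where "d j = u j - w j" for j
      \<comment> \<open>Since \<open>d 0 = 0\<close>, cutting off at 0 adds only the defect
        \<open>d (- 1)\<close> at place 0, which is already of order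
        \<open>\<bar>E\<bar>\<close>.\<close>
      define x where "x j = (if 0 \<le> j then d j else 0)" for j
      have dm: "cmod (d (- 1)) \<le> \<bar>E\<bar> * c" using Lip[OF E z1] by (simp add: d_def u_def w_def)
      have d0: "d 0 = 0" using uw0 by (simp add: d_def)
      have Ld: "Lop V d j = of_real E * u j" for j
      proof -
        have "Lop V u j = of_real E * u j" using su Lop_energy[of V "of_real E" u j] unfolding st_def by simp
        moreover have "Lop V w j = 0" using sw unfolding st_def by simp
        ultimately show ?thesis unfolding d_def Lop_diff by simp
      qed
      have Eu: "cmod (of_real E * u j) \<le> \<bar>E\<bar> * (4 * C)" if "0 \<le> j" for j
        unfolding norm_mult norm_of_real using bd[OF E\<delta> su that] aw by (intro mult_left_mono) auto
      have Lx: "cmod (Lop V x j) \<le> \<bar>E\<bar> * (4 * C + c)" for j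
      proof -
        have p: "0 \<le> \<bar>E\<bar> * c" "0 \<le> \<bar>E\<bar> * (4 * C)" using c0 C by auto
        consider "j < - 1" | "j = - 1" | "j = 0" | "0 < j" by linarith
        then show ?thesis
        proof cases
          case 3
          have "Lop V x j = Lop V d 0 - d (- 1)" using 3 d0 by (simp add: Lop_def x_def)
          then have "cmod (Lop V x j) \<le> cmod (of_real E * u 0) + cmod (d (- 1))"
            unfolding Ld using norm_triangle_ineq4 by metis
          then show ?thesis using Eu[of 0] dm by (simp add: algebra_simps)
        next
          case 4
          then have "Lop V x j = Lop V d j" by (simp add: Lop_def x_def)
          then show ?thesis using Eu[of j] 4 p unfolding Ld by (simp add: algebra_simps)
        qed (use p d0 in \<open>auto simp: Lop_def x_def algebra_simps\<close>)
      qed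
      interpret h0: hyperbolic V N C Vb using h[of 0] \<delta> by simp
      have xb: "cmod (x j) \<le> 8 * C" for j
      proof (cases "0 \<le> j")
        case True
        have "cmod (d j) \<le> cmod (u j) + cmod (w j)" unfolding d_def by (rule norm_triangle_ineq4)
        then show ?thesis using bd[OF E\<delta> su True] bd[OF _ sw True] \<delta> aw True by (simp add: x_def)
      qed (use C in \<open>simp add: x_def\<close>)
      have db: "cmod (d j) \<le> c' * \<bar>E\<bar>" if "0 \<le> j" for j
        using h0.global_bound[OF xb Lx, of j] that by (simp add: x_def c'_def algebra_simps)
      have Re_sum: "1/2 \<le> Re (\<Sum>j<k. u (int j) * w (int j))" if k: "1 \<le> k" for k
      proof -
        \<comment> \<open>Squares of real numbers; the term \<open>j = 0\<close> alone contributes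
          1.\<close>
        have 1: "1 \<le> Re (\<Sum>j<k. w (int j) * w (int j))"
        proof -
          have nn: "0 \<le> Re (w (int j) * w (int j))" for j
          proof -
            have "Im (w (int j)) = 0" using U(3)[OF z1, of "int j"] by (simp add: w_def complex_eq_iff)
            then show ?thesis by simp
          qed
          have "Re (w (int 0) * w (int 0)) \<le> (\<Sum>j<k. Re (w (int j) * w (int j)))"
            using k nn by (intro member_le_sum) auto
          then show ?thesis using uw0 by (simp add: Re_sum)
        qed
        have "cmod (\<Sum>j<k. d (int j) * w (int j)) \<le> (\<Sum>j<k. c' * \<bar>E\<bar> * cmod (w (int j)))"
          using db by (intro sum_norm_le) (simp add: norm_mult mult_right_mono)
        also have "\<dots> = c' * \<bar>E\<bar> * (\<Sum>j<k. cmod (w (int j)))" by (simp add: sum_distrib_left)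
        also have "\<dots> \<le> c' * \<bar>E\<bar> * (16 * C * rN * 1)"
          using sm[OF _ sw] \<delta> aw c'0 by (intro mult_left_mono) auto
        also have "\<dots> = \<bar>E\<bar> * (16 * C * rN * c')" by simp
        also have "\<dots> \<le> 1 / (32 * C * rN * c') * (16 * C * rN * c')"
          using E \<delta>1 C rN c'0 by (intro mult_right_mono) auto
        also have "\<dots> = 1 / 2" using C rN c'0 by simp
        finally have 2: "cmod (\<Sum>j<k. d (int j) * w (int j)) \<le> 1 / 2" .
        have "(\<Sum>j<k. u (int j) * w (int j)) = (\<Sum>j<k. w (int j) * w (int j)) + (\<Sum>j<k. d (int j) * w (int j))"
          by (simp add: d_def algebra_simps flip: sum.distrib)
        then show ?thesis using 1 2 abs_Re_le_cmod[of "\<Sum>j<k. d (int j) * w (int j)"] by simp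
      qed
      have "(\<lambda>k. E * Re (wronskian w u (- 1) - wronskian w u (int k - 1))) \<longlonglongrightarrow> E * Re (wronskian w u (- 1) - 0)"
        using wr0[OF E\<delta> su _ sw] \<delta> by (intro tendsto_intros) auto
      moreover have "\<forall>\<^sub>F k in sequentially. 1/2 * (E * E) \<le> E * Re (wronskian w u (- 1) - wronskian w u (int k - 1))"
      proof (rule eventually_sequentiallyI)
        fix k :: nat assume k: "1 \<le> k"
        have "E * E * (1/2) \<le> E * E * Re (\<Sum>j<k. u (int j) * w (int j))"
          using Re_sum[OF k] by (intro mult_left_mono) auto
        then show "1/2 * (E * E) \<le> E * Re (wronskian w u (- 1) - wronskian w u (int k - 1))"
          unfolding wrE[OF su sw] by (simp add: mult.assoc)
      qed
      ultimately have "1/2 * (E * E) \<le> E * Re (wronskian w u (- 1) - 0)"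
        by (rule tendsto_lowerbound) simp
      moreover have "Re (wronskian w u (- 1)) = F E - F 0" using uw0 by (simp add: wronskian_def F_def u_def w_def)
      ultimately show ?thesis by simp
    qed

    \<comment> \<open>The zero of the boundary value\<close>
    have t1: "\<bar>2 * \<tau>\<bar> \<le> \<delta>1" "\<bar>- (2 * \<tau>)\<bar> \<le> \<delta>1" using \<tau> \<tau>0 by auto
    have "\<exists>E. - (2 * \<tau>) \<le> E \<and> E \<le> 2 * \<tau> \<and> F E = 0"
    proof (rule IVT')
      have "0 \<le> F (2 * \<tau>) \<and> F (- (2 * \<tau>)) \<le> 0"
      proof (cases "\<tau> = 0")
        case True
        then show ?thesis using F0 by simp
      next
        case False
        then have tp: "0 < 2 * \<tau>" using \<tau> by simp
        have "\<tau> * (2 * \<tau>) \<le> (F (2 * \<tau>) - F 0) * (2 * \<tau>)" using slope[OF t1(1)] by (simp add: algebra_simps)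
        then have a: "\<tau> \<le> F (2 * \<tau>) - F 0" using tp by (rule mult_right_le_imp_le)
        have "\<tau> * (2 * \<tau>) \<le> (F 0 - F (- (2 * \<tau>))) * (2 * \<tau>)" using slope[OF t1(2)] by (simp add: algebra_simps)
        then have b: "\<tau> \<le> F 0 - F (- (2 * \<tau>))" using tp by (rule mult_right_le_imp_le)
        show ?thesis using a b F0 by linarith
      qed
      then show "F (- (2 * \<tau>)) \<le> 0" "0 \<le> F (2 * \<tau>)" by auto
      show "- (2 * \<tau>) \<le> 2 * \<tau>" using \<tau> by simp
      show "continuous_on {- (2 * \<tau>)..2 * \<tau>} F"
        unfolding continuous_on_iff
      proof (intro ballI allI impI)
        fix x e :: real assume x: "x \<in> {- (2 * \<tau>)..2 * \<tau>}" and e: "0 < e"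
        show "\<exists>d>0. \<forall>x'\<in>{- (2 * \<tau>)..2 * \<tau>}. dist x' x < d \<longrightarrow> dist (F x') (F x) < e"
        proof (intro exI[of _ "e / c"] conjI ballI impI)
          fix x' assume x': "x' \<in> {- (2 * \<tau>)..2 * \<tau>}" "dist x' x < e / c"
          have "\<bar>F x' - F x\<bar> \<le> \<bar>x' - x\<bar> * c" using x x' t1 by (intro Flip) auto
          also have "\<dots> < e" using x'(2) c0 by (simp add: dist_real_def field_simps)
          finally show "dist (F x') (F x) < e" by (simp add: dist_real_def)
        qed (use e c0 in auto)
      qed
    qed
    then obtain E where E: "- (2 * \<tau>) \<le> E" "E \<le> 2 * \<tau>" "F E = 0" by blast
    have E1: "\<bar>E\<bar> \<le> \<delta>1" "\<bar>E\<bar> \<le> \<delta>" "\<bar>E\<bar> \<le> 2 * \<tau>" using E t1 \<delta>1 by auto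
    have UE: "U E (- 1) = 0" using E(3) U(3)[OF E1(1), of "- 1"] by (simp add: F_def complex_eq_iff)
    \<comment> \<open>The zero belongs to the real normalised solution. At equal energies two
      decaying solutions have Wronskian zero, so the Floquet solution satisfies the same boundary
      condition.\<close>
    obtain f z where f: "st E f" "\<And>j. f (j + int n) = z * f j" "cmod z < 1" "0 < amp f 0" using ex_f[OF E1(2)] by blast
    have "cmod (wronskian (U E) f (- 1)) \<le> 0" using lip[OF E1(2) f(1) E1(2) U(1)[OF E1(1)]] by simp
    then have f1: "f (- 1) = 0" using U(2)[OF E1(1)] UE by (simp add: wronskian_def)
    then have f0: "f 0 \<noteq> 0" using f(4) by (auto simp: amp_def)
    show "\<exists>E::real. \<bar>E\<bar> \<le> 2 * \<tau> \<and> (\<exists>u z. (\<forall>j. Lop (\<lambda>j. V j - of_real E) u j = 0) \<and> u (- 1) = 0 \<and> u 0 = 1 \<and>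
       (\<forall>j. u (j + int n) = z * u j) \<and> cmod z < 1)"
    proof (intro exI[of _ E] exI[of _ "\<lambda>j. 1 / f 0 * f j"] exI[of _ z] conjI allI)
      fix j
      show "Lop (\<lambda>j. V j - of_real E) (\<lambda>j. 1 / f 0 * f j) j = 0"
        unfolding Lop_scale using f(1) by (simp add: st_def)
    qed (use E1 f f1 f0 in auto)
  qed
qed

section \<open>Finite sections and Dirichlet eigenvalues\<close>

definition tri :: "(int \<Rightarrow> complex) \<Rightarrow> int \<Rightarrow> int \<Rightarrow> complex" where
  "tri V i j = (if \<bar>i - j\<bar> = 1 then 1 else 0) + (if i = j then V i else 0)"

lemma tri_sum:
  assumes "lo \<le> i" "i \<le> hi" "x (lo - 1) = 0" "x (hi + 1) = 0"
  shows "(\<Sum>j\<in>{lo..hi}. tri V i j * x j) = Lop V x i"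
proof -
  have "(\<Sum>j\<in>{lo..hi}. tri V i j * x j) = (\<Sum>j\<in>{lo-1..hi+1}. tri V i j * x j)"
  proof (rule sum.mono_neutral_left)
    show "\<forall>j\<in>{lo-1..hi+1} - {lo..hi}. tri V i j * x j = 0"
    proof
      fix j assume "j \<in> {lo-1..hi+1} - {lo..hi}"
      then have "j = lo - 1 \<or> j = hi + 1" by auto
      then show "tri V i j * x j = 0" using assms by auto
    qed
  qed auto
  also have "\<dots> = (\<Sum>j\<in>{i - 1, i, i + 1}. tri V i j * x j)"
    using assms by (intro sum.mono_neutral_right) (auto simp: tri_def)
  also have "\<dots> = Lop V x i" by (simp add: tri_def Lop_def)
  finally show ?thesis .
qed

lemma block_mat_dim [simp]:
  "dim_row (block_mat a k l) = nat (l - k + 1)" "dim_col (block_mat a k l) = nat (l - k + 1)"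
  "block_mat a k l \<in> carrier_mat (nat (l - k + 1)) (nat (l - k + 1))"
  by (simp_all add: block_mat_def)

lemma block_mat_mult_vec:
  assumes "i < n"
  shows "(block_mat a k (k + int n - 1) *\<^sub>v vec n (\<lambda>i. x (k + int i))) $ i = (\<Sum>j\<in>{k..k + int n - 1}. a (k + int i) j * x j)"
proof -
  have "(block_mat a k (k + int n - 1) *\<^sub>v vec n (\<lambda>i. x (k + int i))) $ i = (\<Sum>j\<in>{0..<n}. a (k + int i) (k + int j) * x (k + int j))"
    using assms by (simp add: block_mat_def scalar_prod_def)
  also have "\<dots> = (\<Sum>j\<in>{k..k + int n - 1}. a (k + int i) j * x j)"
    by (rule sum.reindex_bij_witness[where i = "\<lambda>j. nat (j - k)" and j = "\<lambda>j. k + int j"]) auto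
  finally show ?thesis .
qed

text \<open>Multiplication by the unimodular \<open>P\<close> puts \<open>U\<close> into the first
  column, which then vanishes except for its last entry \<open>- U (k + n)\<close>. Deleting that
  row and column leaves a lower triangular matrix with ones on the diagonal.\<close>

lemma det_tri:
  assumes U: "U (k - 1) = 0" "U k = 1" and L: "\<And>j. k \<le> j \<Longrightarrow> j < k + int n \<Longrightarrow> Lop V U j = 0"
  shows "Determinant.det (block_mat (tri V) k (k + int n - 1)) = (-1) ^ n * U (k + int n)"
proof (cases n)
  case 0
  have "block_mat (tri V) k (k + int n - 1) = 1\<^sub>m 0"
    using 0 by (intro eq_matI) (auto simp: block_mat_def)
  then show ?thesis using 0 U by simp
next
  case (Suc m)
  define A where "A = block_mat (tri V) k (k + int n - 1)"
  have nn: "nat (k + int n - 1 - k + 1) = n" by simp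
  have A: "A \<in> carrier_mat n n" unfolding A_def using block_mat_dim(3)[of "tri V" k "k + int n - 1"] nn by simp
  have Aij: "A $$ (i, j) = tri V (k + int i) (k + int j)" if "i < n" "j < n" for i j
    using that by (simp add: A_def block_mat_def)
  define P where "P = mat n n (\<lambda>(i, j). if j = 0 then U (k + int i) else if i = j then 1 else 0)"
  have P: "P \<in> carrier_mat n n" by (simp add: P_def)
  have "Determinant.det P = prod_list (diag_mat P)"
    by (rule det_lower_triangular[OF _ P]) (auto simp: P_def)
  also have "\<dots> = 1"
    unfolding prod_list_diag_prod using U(2) by (intro prod.neutral) (auto simp: P_def)
  finally have detP: "Determinant.det P = 1" .
  define B where "B = A * P"
  have B: "B \<in> carrier_mat n n" using A P by (simp add: B_def)
  have Bij: "B $$ (i, j) = A $$ (i, j)" if "i < n" "j < n" "j \<noteq> 0" for i j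
  proof -
    have "B $$ (i, j) = (\<Sum>l\<in>{0..<n}. A $$ (i, l) * P $$ (l, j))"
      using that A P by (simp add: B_def scalar_prod_def)
    also have "\<dots> = (\<Sum>l\<in>{0..<n}. if l = j then A $$ (i, j) else 0)"
      using that by (intro sum.cong) (auto simp: P_def)
    finally show ?thesis using that by simp
  qed
  have Bi0: "B $$ (i, 0) = (if i = m then - U (k + int n) else 0)" if i: "i < n" for i
  proof -
    \<comment> \<open>Truncated so that \<open>tri_sum\<close> applies; the lost value is the defect
      in the last row.\<close>
    define x where "x j = (if j < k + int n then U j else 0)" for j
    have "B $$ (i, 0) = (\<Sum>l\<in>{0..<n}. A $$ (i, l) * P $$ (l, 0))"
      using that A P Suc by (simp add: B_def scalar_prod_def)
    also have "\<dots> = (\<Sum>l\<in>{0..<n}. tri V (k + int i) (k + int l) * x (k + int l))"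
      using that Suc by (intro sum.cong) (auto simp: P_def Aij x_def)
    also have "\<dots> = (\<Sum>j\<in>{k..k + int n - 1}. tri V (k + int i) j * x j)"
      by (rule sum.reindex_bij_witness[where i = "\<lambda>j. nat (j - k)" and j = "\<lambda>j. k + int j"]) auto
    also have "\<dots> = Lop V x (k + int i)"
      using i U by (intro tri_sum) (auto simp: x_def)
    also have "\<dots> = Lop V U (k + int i) - (if i = m then U (k + int n) else 0)"
      using i Suc by (cases "i = m") (auto simp: Lop_def x_def algebra_simps)
    finally show ?thesis using L[of "k + int i"] i by simp
  qed
  have md: "mat_delete B m 0 \<in> carrier_mat m m" using B Suc by (simp add: mat_delete_def)
  have mdij: "mat_delete B m 0 $$ (i, j) = tri V (k + int i) (k + int (Suc j))" if "i < m" "j < m" for i j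
    using that B Suc Bij[of i "Suc j"] Aij[of i "Suc j"] by (simp add: mat_delete_def)
  have "Determinant.det (mat_delete B m 0) = prod_list (diag_mat (mat_delete B m 0))"
    by (rule det_lower_triangular[OF _ md]) (auto simp: mdij tri_def)
  also have "\<dots> = 1"
    unfolding prod_list_diag_prod using md by (intro prod.neutral) (auto simp: mdij tri_def)
  finally have dmd: "Determinant.det (mat_delete B m 0) = 1" .
  have "Determinant.det B = (\<Sum>i<n. B $$ (i, 0) * cofactor B i 0)"
    using laplace_expansion_column[OF B, of 0] Suc by simp
  also have "\<dots> = (\<Sum>i<n. if i = m then - U (k + int n) * cofactor B m 0 else 0)"
    by (intro sum.cong) (auto simp: Bi0)
  also have "\<dots> = - U (k + int n) * cofactor B m 0" using Suc by simp
  also have "cofactor B m 0 = (-1) ^ m" by (simp add: cofactor_def dmd)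
  finally have "Determinant.det B = (-1) ^ n * U (k + int n)" using Suc by simp
  moreover have "Determinant.det B = Determinant.det A" unfolding B_def det_mult[OF A P] detP by simp
  ultimately show ?thesis by (simp add: A_def)
qed

lemma schroedinger_Lop: "schroedinger lam \<beta> \<theta> = Lop (pot lam \<beta> \<theta>)"
  by (intro ext) (simp add: schroedinger_def Lop_def pot_def)

lemma op_entry_Lop: "op_entry (Lop V) = tri V"
  by (intro ext) (auto simp: op_entry_def Lop_def tri_def unit_seq_def)

lemma schroedinger_entry_tri: "schroedinger_entry lam \<beta> \<theta> = tri (pot lam \<beta> \<theta>)"
  by (intro ext) (simp add: schroedinger_entry_def tri_def pot_def)

lemma proj_proj_zero: "proj n x = x \<longleftrightarrow> (\<forall>i. int n < \<bar>i\<bar> \<longrightarrow> x i = 0)"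
  by (auto simp: proj_def fun_eq_iff)

lemma fsec_Lop:
  assumes "proj n x = x" "\<bar>i\<bar> \<le> int n"
  shows "fsec (Lop V) n x i = Lop V x i"
  using assms tri_sum[of "- int n" i "int n" x V]
  by (simp add: fsec_def op_entry_Lop proj_proj_zero abs_le_iff)

text \<open>A vector on the window is taken as a sequence vanishing outside it. The section then
  acts as \<open>Lop V\<close>, and arguments about solutions apply directly.\<close>

definition fsec_sol :: "(int \<Rightarrow> complex) \<Rightarrow> nat \<Rightarrow> (int \<Rightarrow> complex) \<Rightarrow> (int \<Rightarrow> complex) \<Rightarrow> bool" where
  "fsec_sol V n y x \<longleftrightarrow> (\<forall>i. int n < \<bar>i\<bar> \<longrightarrow> x i = 0) \<and> (\<forall>i. \<bar>i\<bar> \<le> int n \<longrightarrow> Lop V x i = y i)"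

lemma fsec_sol_iff: "fsec_sol V n y x \<longleftrightarrow> proj n x = x \<and> fsec (Lop V) n x = proj n y"
proof -
  have "(\<forall>i. \<bar>i\<bar> \<le> int n \<longrightarrow> Lop V x i = y i) \<longleftrightarrow> fsec (Lop V) n x = proj n y" if "proj n x = x"
    using fsec_Lop[OF that] unfolding proj_def fun_eq_iff by (auto simp: fsec_def)
  then show ?thesis unfolding fsec_sol_def proj_proj_zero[symmetric] by blast
qed

lemma fsec_sol_vec:
  fixes n :: nat
  defines "d \<equiv> 2 * n + 1"
  assumes x: "\<forall>i. int n < \<bar>i\<bar> \<longrightarrow> x i = 0"
  shows "(\<forall>i. \<bar>i\<bar> \<le> int n \<longrightarrow> Lop V x i = y i) \<longleftrightarrow>
    block_mat (op_entry (Lop V)) (- int n) (int n) *\<^sub>v vec d (\<lambda>i. x (- int n + int i)) = vec d (\<lambda>i. y (- int n + int i))"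
proof -
  have e: "- int n + int d - 1 = int n" by (simp add: d_def)
  have row: "(block_mat (op_entry (Lop V)) (- int n) (int n) *\<^sub>v vec d (\<lambda>i. x (- int n + int i))) $ i = Lop V x (- int n + int i)"
    if "i < d" for i
    using block_mat_mult_vec[OF that, of "tri V" "- int n" x] tri_sum[of "- int n" "- int n + int i" "int n" x V] x that
    unfolding e op_entry_Lop by (simp add: d_def)
  show ?thesis
  proof
    assume h: "\<forall>i. \<bar>i\<bar> \<le> int n \<longrightarrow> Lop V x i = y i"
    show "block_mat (op_entry (Lop V)) (- int n) (int n) *\<^sub>v vec d (\<lambda>i. x (- int n + int i)) = vec d (\<lambda>i. y (- int n + int i))"
    proof (rule eq_vecI)
      fix i assume "i < dim_vec (vec d (\<lambda>i. y (- int n + int i)))"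
      then have i: "i < d" by simp
      then show "(block_mat (op_entry (Lop V)) (- int n) (int n) *\<^sub>v vec d (\<lambda>i. x (- int n + int i))) $ i = vec d (\<lambda>i. y (- int n + int i)) $ i"
        unfolding row[OF i] using h by (simp add: d_def)
    qed (simp add: d_def)
  next
    assume h: "block_mat (op_entry (Lop V)) (- int n) (int n) *\<^sub>v vec d (\<lambda>i. x (- int n + int i)) = vec d (\<lambda>i. y (- int n + int i))"
    show "\<forall>i. \<bar>i\<bar> \<le> int n \<longrightarrow> Lop V x i = y i"
    proof (intro allI impI)
      fix i assume i: "\<bar>i\<bar> \<le> int n"
      define j where "j = nat (i + int n)"
      have j: "j < d" "- int n + int j = i" using i by (auto simp: j_def d_def)
      show "Lop V x i = y i" using row[OF j(1)] j unfolding h by simp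
    qed
  qed
qed

lemma fsec_invertible_iff:
  "fsec_invertible (Lop V) n \<longleftrightarrow> (\<forall>x. fsec_sol V n (\<lambda>_. 0) x \<longrightarrow> x = (\<lambda>_. 0))"
proof -
  let ?d = "2 * n + 1" and ?A = "block_mat (op_entry (Lop V)) (- int n) (int n)"
  have "nat (int n - - int n + 1) = ?d" by (simp add: nat_eq_iff)
  then have A: "?A \<in> carrier_mat ?d ?d" using block_mat_dim(3)[of _ "- int n" "int n"] by metis
  have "Determinant.det ?A = 0 \<longleftrightarrow> (\<exists>x. fsec_sol V n (\<lambda>_. 0) x \<and> x \<noteq> (\<lambda>_. 0))"
    unfolding det_0_iff_vec_prod_zero[OF A]
  proof
    assume "\<exists>v. v \<in> carrier_vec ?d \<and> v \<noteq> 0\<^sub>v ?d \<and> ?A *\<^sub>v v = 0\<^sub>v ?d"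
    then obtain v where v: "v \<in> carrier_vec ?d" "v \<noteq> 0\<^sub>v ?d" "?A *\<^sub>v v = 0\<^sub>v ?d" by blast
    define x where "x i = (if \<bar>i\<bar> \<le> int n then v $ nat (i + int n) else 0)" for i
    have vx: "v = vec ?d (\<lambda>i. x (- int n + int i))" using v(1) by (intro eq_vecI) (auto simp: x_def)
    have z: "0\<^sub>v ?d = vec ?d (\<lambda>i. 0)" by auto
    have x0: "\<forall>i. int n < \<bar>i\<bar> \<longrightarrow> x i = 0" by (simp add: x_def)
    have "fsec_sol V n (\<lambda>_. 0) x"
      unfolding fsec_sol_def using fsec_sol_vec[OF x0, of V "\<lambda>_. 0"] x0 v(3) vx z by simp
    moreover have "x \<noteq> (\<lambda>_. 0)" using v(2) vx by auto
    ultimately show "\<exists>x. fsec_sol V n (\<lambda>_. 0) x \<and> x \<noteq> (\<lambda>_. 0)" by blast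
  next
    assume "\<exists>x. fsec_sol V n (\<lambda>_. 0) x \<and> x \<noteq> (\<lambda>_. 0)"
    then obtain x where x: "fsec_sol V n (\<lambda>_. 0) x" "x \<noteq> (\<lambda>_. 0)" by blast
    then obtain i where i: "x i \<noteq> 0" by auto
    have x0: "\<forall>i. int n < \<bar>i\<bar> \<longrightarrow> x i = 0" using x(1) by (simp add: fsec_sol_def)
    let ?v = "vec ?d (\<lambda>i. x (- int n + int i))"
    have "\<bar>i\<bar> \<le> int n" using i x0 by force
    then have "0 \<le> i + int n" "nat (i + int n) < ?d" by auto
    then have "?v $ nat (i + int n) \<noteq> 0\<^sub>v ?d $ nat (i + int n)" using i by simp
    then have "?v \<noteq> 0\<^sub>v ?d" by metis
    moreover have "?A *\<^sub>v ?v = 0\<^sub>v ?d"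
      using fsec_sol_vec[OF x0, of V "\<lambda>_. 0"] x(1) unfolding fsec_sol_def by auto
    ultimately show "\<exists>v. v \<in> carrier_vec ?d \<and> v \<noteq> 0\<^sub>v ?d \<and> ?A *\<^sub>v v = 0\<^sub>v ?d" by (intro exI[of _ ?v]) simp
  qed
  then show ?thesis unfolding fsec_invertible_def by blast
qed

lemma fsec_sol_exists:
  assumes "fsec_invertible (Lop V) n"
  shows "\<exists>x. fsec_sol V n y x"
proof -
  let ?d = "2 * n + 1" and ?A = "block_mat (op_entry (Lop V)) (- int n) (int n)"
  have "nat (int n - - int n + 1) = ?d" by (simp add: nat_eq_iff)
  then have A: "?A \<in> carrier_mat ?d ?d" using block_mat_dim(3)[of _ "- int n" "int n"] by metis
  have "?A \<in> Units (ring_mat TYPE(complex) ?d ())"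
    using assms unfolding fsec_invertible_def by (intro det_non_zero_imp_unit[OF A])
  then obtain B where B: "B \<in> carrier_mat ?d ?d" "?A * B = 1\<^sub>m ?d" unfolding Units_def ring_mat_def by auto
  let ?y = "vec ?d (\<lambda>i. y (- int n + int i))"
  define v where "v = B *\<^sub>v ?y"
  have v: "v \<in> carrier_vec ?d" using B by (simp add: v_def)
  have Av: "?A *\<^sub>v v = ?y"
    unfolding v_def using assoc_mult_mat_vec[OF A B(1), of ?y] B(2) by simp
  define x where "x i = (if \<bar>i\<bar> \<le> int n then v $ nat (i + int n) else 0)" for i
  have vx: "v = vec ?d (\<lambda>i. x (- int n + int i))" using v by (intro eq_vecI) (auto simp: x_def)
  have x0: "\<forall>i. int n < \<bar>i\<bar> \<longrightarrow> x i = 0" by (simp add: x_def)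
  have "fsec_sol V n y x"
    unfolding fsec_sol_def using fsec_sol_vec[OF x0, of V y] x0 Av vx by simp
  then show ?thesis by blast
qed

lemma fsec_sol_unique:
  assumes "fsec_invertible (Lop V) n" "fsec_sol V n y x" "fsec_sol V n y x'"
  shows "x = x'"
proof -
  have "fsec_sol V n (\<lambda>_. 0) (\<lambda>j. x j - x' j)"
    using assms(2,3) by (simp add: fsec_sol_def Lop_diff)
  then have "(\<lambda>j. x j - x' j) = (\<lambda>_. 0)" using assms(1) fsec_invertible_iff by blast
  then show ?thesis by (simp add: fun_eq_iff)
qed

lemma fsec_inv_sol:
  assumes "fsec_invertible (Lop V) n"
  shows "fsec_sol V n y (fsec_inv (Lop V) n y)"
proof -
  obtain x where x: "fsec_sol V n y x" using fsec_sol_exists[OF assms] by blast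
  have "\<exists>!x. fsec_sol V n y x" using x fsec_sol_unique[OF assms] by blast
  then show ?thesis unfolding fsec_inv_def fsec_sol_iff by (rule theI')
qed

lemma block_mat_energy:
  "(\<lambda>i j. tri V i j - (if i = j then E else 0)) = tri (\<lambda>j. V j - E)"
  by (intro ext) (simp add: tri_def)

context irrational_slope
begin

lemma pot_approx_period: "2 \<le> m \<Longrightarrow> pot lam (cf_approx \<alpha> m) 0 (j + int (q m)) = pot lam (cf_approx \<alpha> m) 0 j"
  by (simp add: pot_def sturm_v_approx per_word_period)

text \<open>A block of length \<open>q m - 1\<close> has the eigenvalue \<open>E\<close> iff the
  solution vanishing at \<open>k - 1\<close> vanishes again one period later, that is, iff it is a
  Floquet solution. The determinant of the block of length \<open>q m\<close> is then its multiplier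
  up to sign. So \<open>G_set\<close> consists of energies with a decaying half-line Dirichlet
  solution.\<close>

lemma G_set_iff:
  assumes m: "2 \<le> m"
  shows "E \<in> G_set lam \<alpha> m \<longleftrightarrow> (\<exists>k\<in>{1..int (q m)}. \<exists>u z. (\<forall>j. Lop (\<lambda>j. pot lam (cf_approx \<alpha> m) 0 j - E) u j = 0) \<and>
    u (k - 1) = 0 \<and> u k = 1 \<and> (\<forall>j. u (j + int (q m)) = z * u j) \<and> cmod z < 1)"
proof -
  define n where "n = q m"
  define V where "V = pot lam (cf_approx \<alpha> m) 0"
  have e: "Suc (Suc (m - 2)) = m" using m by simp
  have n2: "2 \<le> n" using q_Suc_Suc_ge_2[of "m - 2"] unfolding e n_def .
  have Vb: "cmod (V j - E) \<le> \<bar>lam\<bar> + cmod E" for j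
    using norm_triangle_ineq4[of "V j" E] pot_bound[of lam "cf_approx \<alpha> m" 0 j] by (simp add: V_def)
  have per: "V (j + int n) = V j" for j unfolding V_def n_def using m by (rule pot_approx_period)
  have G: "E \<in> G_set lam \<alpha> m \<longleftrightarrow> (\<exists>k\<in>{1..int n}. E \<in> spectrum (block_mat (tri V) k (int n + k - 2)) \<and>
      cmod (Determinant.det (block_mat (tri (\<lambda>j. V j - E)) k (int n + k - 1))) < 1)"
    unfolding G_set_def Let_def schroedinger_entry_tri block_mat_energy V_def n_def by auto
  have per_u: "u (j + int n) = u (k + int n) * u j"
    if u: "\<And>j. Lop (\<lambda>j. V j - E) u j = 0" "u (k - 1) = 0" "u k = 1" "u (k + int n - 1) = 0" for u k j
  proof (rule sol_eq[where V = "\<lambda>j. V j - E" and x = "\<lambda>j. u (j + int n)" and y = "\<lambda>j. u (k + int n) * u j" and c = "k - 1"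
        and lo = "min k j" and hi = "max k j", OF Vb])
    fix i
    have "Lop (\<lambda>j. V j - E) (\<lambda>j. u (j + int n)) i = Lop (\<lambda>j. V (j + int n) - E) (\<lambda>j. u (j + int n)) i" by (simp add: per)
    also have "\<dots> = Lop (\<lambda>j. V j - E) u (i + int n)" by (rule Lop_shift)
    finally show "Lop (\<lambda>j. V j - E) (\<lambda>j. u (j + int n)) i = Lop (\<lambda>j. V j - E) (\<lambda>j. u (k + int n) * u j) i"
      unfolding Lop_scale by (simp add: u)
  qed (use u in \<open>auto simp: algebra_simps\<close>)
  have key: "(E \<in> spectrum (block_mat (tri V) k (int n + k - 2)) \<and>
      cmod (Determinant.det (block_mat (tri (\<lambda>j. V j - E)) k (int n + k - 1))) < 1) \<longleftrightarrow>
    (\<exists>u z. (\<forall>j. Lop (\<lambda>j. V j - E) u j = 0) \<and> u (k - 1) = 0 \<and> u k = 1 \<and> (\<forall>j. u (j + int n) = z * u j) \<and> cmod z < 1)"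
    (is "?l \<longleftrightarrow> ?r") for k
  proof -
    define d where "d = n - 1"
    have d: "int n + k - 2 = k + int d - 1" "nat (k + int d - 1 - k + 1) = d" "1 \<le> d" "int n + k - 1 = k + int n - 1"
      using n2 by (auto simp: d_def of_nat_diff)
    let ?A = "block_mat (tri V) k (k + int d - 1)"
    have dimA: "dim_row ?A = d" using d(2) by simp
    obtain u where u: "\<And>j. Lop (\<lambda>j. V j - E) u j = 0" "u (k - 1) = 0" "u k = 1"
      using sol_exists[of "\<lambda>j. V j - E" "k - 1" 0 1] by auto
    have uniq: "u' = u" if "\<And>j. Lop (\<lambda>j. V j - E) u' j = 0" "u' (k - 1) = 0" "u' k = 1" for u'
    proof
      fix j
      show "u' j = u j"
        by (rule sol_eq[where V = "\<lambda>j. V j - E" and c = "k - 1" and lo = "min k j" and hi = "max k j", OF Vb])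
          (use that u in auto)
    qed
    have LV: "Lop V x j = Lop (\<lambda>j. V j - E) x j + E * x j" for x j by (simp add: Lop_energy)
    have det: "cmod (Determinant.det (block_mat (tri (\<lambda>j. V j - E)) k (int n + k - 1))) = cmod (u (k + int n))"
      unfolding d(4) using det_tri[of u k n "\<lambda>j. V j - E"] u by (simp add: norm_mult norm_power)
    have spec: "E \<in> spectrum ?A \<longleftrightarrow> u (k + int n - 1) = 0"
    proof
      assume "E \<in> spectrum ?A"
      then obtain v where v: "v \<in> carrier_vec d" "v \<noteq> 0\<^sub>v d" "?A *\<^sub>v v = E \<cdot>\<^sub>v v"
        unfolding spectrum_def eigenvalue_def eigenvector_def dimA by blast
      define f where "f j = (if k \<le> j \<and> j \<le> k + int d - 1 then v $ nat (j - k) else 0)" for j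
      have vf: "v = vec d (\<lambda>i. f (k + int i))" using v(1) by (intro eq_vecI) (auto simp: f_def)
      have Lf: "Lop V f j = E * f j" if j: "k \<le> j" "j \<le> k + int d - 1" for j
      proof -
        define i where "i = nat (j - k)"
        have i: "i < d" "k + int i = j" using j by (auto simp: i_def)
        have "(?A *\<^sub>v vec d (\<lambda>i. f (k + int i))) $ i = Lop V f (k + int i)"
          unfolding block_mat_mult_vec[OF i(1)] using i by (intro tri_sum) (auto simp: f_def)
        then have "Lop V f (k + int i) = (E \<cdot>\<^sub>v v) $ i" using v(3) vf by simp
        also have "\<dots> = E * f (k + int i)" using i(1) v(1) vf by (metis carrier_vecD index_smult_vec(1) index_vec)
        finally show ?thesis unfolding i(2) .
      qed
      have fu: "f j = f k * u j" if "k - 1 \<le> j" "j \<le> k + int d" for j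
      proof (rule sol_eq[where V = "\<lambda>j. V j - E" and x = f and y = "\<lambda>j. f k * u j" and c = "k - 1" and lo = k and hi = "k + int d - 1", OF Vb])
        fix i assume "k \<le> i" "i \<le> k + int d - 1"
        then show "Lop (\<lambda>j. V j - E) f i = Lop (\<lambda>j. V j - E) (\<lambda>j. f k * u j) i"
          unfolding Lop_scale Lop_energy[of V E f] using Lf u(1) by simp
      qed (use that u d in \<open>auto simp: f_def\<close>)
      have "f k \<noteq> 0"
      proof
        assume "f k = 0"
        then have "f (k + int i) = 0" if "i < d" for i using fu[of "k + int i"] that by simp
        then have "v = 0\<^sub>v d" unfolding vf by (intro eq_vecI) auto
        then show False using v(2) by simp
      qed
      moreover have "f (k + int d) = 0" by (simp add: f_def)
      ultimately have "u (k + int d) = 0" using fu[of "k + int d"] by simp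
      moreover have "k + int d = k + int n - 1" using d(1) by simp
      ultimately show "u (k + int n - 1) = 0" by simp
    next
      assume un: "u (k + int n - 1) = 0"
      let ?v = "vec d (\<lambda>i. u (k + int i))"
      have kd: "k + int d - 1 + 1 = k + int n - 1" using d(1) by simp
      have "?A *\<^sub>v ?v = E \<cdot>\<^sub>v ?v"
      proof (rule eq_vecI)
        fix i assume "i < dim_vec (E \<cdot>\<^sub>v ?v)"
        then have i: "i < d" by simp
        have "(?A *\<^sub>v ?v) $ i = Lop V u (k + int i)"
          unfolding block_mat_mult_vec[OF i] using i u(2) un kd by (intro tri_sum) auto
        then show "(?A *\<^sub>v ?v) $ i = (E \<cdot>\<^sub>v ?v) $ i" using i LV[of u] u(1) by simp
      qed (simp add: d(2))
      moreover have "?v $ 0 \<noteq> 0\<^sub>v d $ 0" using d(3) u(3) by simp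
      then have "?v \<noteq> 0\<^sub>v d" by metis
      ultimately show "E \<in> spectrum ?A"
        unfolding spectrum_def eigenvalue_def eigenvector_def dimA by (intro CollectI exI[of _ ?v]) simp
    qed
    show ?thesis unfolding det unfolding d(1) spec
    proof
      assume a: "u (k + int n - 1) = 0 \<and> cmod (u (k + int n)) < 1"
      then have pu: "u (j + int n) = u (k + int n) * u j" for j using per_u[of u k j] u by blast
      show ?r using u a pu by blast
    next
      assume ?r
      then obtain u' z where u': "\<And>j. Lop (\<lambda>j. V j - E) u' j = 0" "u' (k - 1) = 0" "u' k = 1"
        "\<And>j. u' (j + int n) = z * u' j" "cmod z < 1" by blast
      have uu: "u' = u" by (rule uniq[OF u'(1-3)])
      have "u (k - 1 + int n) = 0" "u (k + int n) = z" using u'(4)[of "k - 1"] u'(4)[of k] u unfolding uu by simp_all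
      then show "u (k + int n - 1) = 0 \<and> cmod (u (k + int n)) < 1" using u'(5) by (simp add: algebra_simps)
    qed
  qed
  show ?thesis unfolding G key unfolding V_def n_def ..
qed

end

section \<open>The local inequality in sequence spaces\<close>

text \<open>The ball of radius \<open>c \<ge> 0\<close> of \<open>l^p\<close>; bounding finite sums makes membership survive pointwise limits without
  summability side conditions.\<close>
definition lpb :: "ereal \<Rightarrow> (int \<Rightarrow> complex) \<Rightarrow> real \<Rightarrow> bool" where
  "lpb p x c \<longleftrightarrow> (if p = \<infinity> then \<forall>i. cmod (x i) \<le> c
     else \<forall>F. finite F \<longrightarrow> (\<Sum>i\<in>F. cmod (x i) powr real_of_ereal p) \<le> c powr real_of_ereal p)"

lemma real_of_ereal_ge_1: "1 \<le> p \<Longrightarrow> p \<noteq> \<infinity> \<Longrightarrow> 1 \<le> real_of_ereal p"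
  by (cases p) (auto simp: one_ereal_def)

lemma powr_le_cancel:
  fixes a b p :: real
  assumes "a powr p \<le> b powr p" "0 \<le> a" "0 \<le> b" "1 \<le> p"
  shows "a \<le> b"
proof (rule ccontr)
  assume "\<not> a \<le> b"
  then have "b powr p < a powr p" using assms by (intro powr_less_mono2) auto
  then show False using assms(1) by simp
qed

lemma lpb_iff:
  assumes p: "1 \<le> p" and c: "0 \<le> c"
  shows "lpb p x c \<longleftrightarrow> x \<in> lp_space p \<and> lp_norm p x \<le> c"
proof (cases "p = \<infinity>")
  case True
  show ?thesis
  proof
    assume "lpb p x c"
    then have b: "cmod (x i) \<le> c" for i using True by (simp add: lpb_def)
    then have "bdd_above (range (\<lambda>n. cmod (x n)))" by (intro bdd_aboveI[of _ c]) auto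
    moreover have "(SUP n. cmod (x n)) \<le> c" using b by (intro cSUP_least) auto
    ultimately show "x \<in> lp_space p \<and> lp_norm p x \<le> c" using True by (simp add: lp_space_def lp_norm_def)
  next
    assume "x \<in> lp_space p \<and> lp_norm p x \<le> c"
    then have b: "bdd_above (range (\<lambda>n. cmod (x n)))" "(SUP n. cmod (x n)) \<le> c"
      using True by (auto simp: lp_space_def lp_norm_def)
    have "cmod (x i) \<le> c" for i using cSUP_upper[OF UNIV_I b(1), of i] b(2) by simp
    then show "lpb p x c" using True by (simp add: lpb_def)
  qed
next
  case False
  define r where "r = real_of_ereal p"
  have r: "1 \<le> r" using real_of_ereal_ge_1[OF p False] by (simp add: r_def)
  let ?f = "\<lambda>i. cmod (x i) powr r"
  show ?thesis
  proof
    assume "lpb p x c"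
    then have b: "sum ?f F \<le> c powr r" if "finite F" for F using that False by (simp add: lpb_def r_def)
    have s: "?f summable_on UNIV"
      using b by (intro nonneg_bdd_above_summable_on bdd_aboveI[of _ "c powr r"]) auto
    have "infsum ?f UNIV \<le> c powr r" using s b by (intro infsum_le_finite_sums) auto
    then have "infsum ?f UNIV powr (1 / r) \<le> (c powr r) powr (1 / r)"
      using r by (intro powr_mono2) (auto intro: infsum_nonneg)
    also have "\<dots> = c" using r c by (simp add: powr_powr)
    finally show "x \<in> lp_space p \<and> lp_norm p x \<le> c"
      using s False by (simp add: lp_space_def lp_norm_def r_def)
  next
    assume h: "x \<in> lp_space p \<and> lp_norm p x \<le> c"
    then have s: "?f summable_on UNIV" and n: "infsum ?f UNIV powr (1 / r) \<le> c"
      using False by (auto simp: lp_space_def lp_norm_def r_def)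
    have nn: "0 \<le> infsum ?f UNIV" by (rule infsum_nonneg) simp
    have "sum ?f F \<le> c powr r" if "finite F" for F
    proof -
      have "sum ?f F \<le> infsum ?f UNIV" using s that by (intro finite_sum_le_infsum) auto
      also have "\<dots> = (infsum ?f UNIV powr (1 / r)) powr r" using r nn by (simp add: powr_powr)
      also have "\<dots> \<le> c powr r" using n r by (intro powr_mono2) auto
      finally show ?thesis .
    qed
    then show "lpb p x c" using False by (simp add: lpb_def r_def)
  qed
qed

lemma lpb_lp_norm: "1 \<le> p \<Longrightarrow> x \<in> lp_space p \<Longrightarrow> 0 \<le> lp_norm p x \<and> lpb p x (lp_norm p x)"
proof -
  assume p: "1 \<le> p" and x: "x \<in> lp_space p"
  have "0 \<le> lp_norm p x"
  proof (cases "p = \<infinity>")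
    case True
    then have b: "bdd_above (range (\<lambda>n. cmod (x n)))" using x by (simp add: lp_space_def)
    have "cmod (x 0) \<le> (SUP n. cmod (x n))" by (rule cSUP_upper[OF UNIV_I b])
    then show ?thesis using True by (simp add: lp_norm_def order_trans[OF norm_ge_zero])
  qed (simp add: lp_norm_def)
  then show "0 \<le> lp_norm p x \<and> lpb p x (lp_norm p x)" using lpb_iff[OF p] x by blast
qed

lemma lpb_coord:
  assumes p: "1 \<le> p" and "0 \<le> c" "lpb p x c"
  shows "cmod (x i) \<le> c"
proof (cases "p = \<infinity>")
  case True then show ?thesis using assms by (simp add: lpb_def)
next
  case False
  then have "(\<Sum>i\<in>{i}. cmod (x i) powr real_of_ereal p) \<le> c powr real_of_ereal p"
    using assms(3) unfolding lpb_def by (metis finite.emptyI finite_insert)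
  then show ?thesis using assms real_of_ereal_ge_1[OF p False] by (intro powr_le_cancel[of "cmod (x i)" "real_of_ereal p"]) auto
qed

lemma lpb_mono:
  assumes "1 \<le> p" "lpb p y c" "\<And>i. cmod (x i) \<le> cmod (y i)"
  shows "lpb p x c"
proof (cases "p = \<infinity>")
  case True then show ?thesis using assms order_trans by (fastforce simp: lpb_def)
next
  case False
  have "(\<Sum>i\<in>F. cmod (x i) powr real_of_ereal p) \<le> (\<Sum>i\<in>F. cmod (y i) powr real_of_ereal p)" for F
    using real_of_ereal_ge_1[OF assms(1) False] assms(3) by (intro sum_mono powr_mono2) auto
  then show ?thesis using False assms(2) order_trans by (fastforce simp: lpb_def)
qed

lemma lpb_le: "1 \<le> p \<Longrightarrow> lpb p x c \<Longrightarrow> 0 \<le> c \<Longrightarrow> c \<le> d \<Longrightarrow> lpb p x d"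
  using lpb_iff[of p c x] lpb_iff[of p d x] by simp

lemma lpb_scale:
  assumes "1 \<le> p" "lpb p x c" "0 \<le> c"
  shows "lpb p (\<lambda>i. k * x i) (cmod k * c)"
proof (cases "p = \<infinity>")
  case True then show ?thesis using assms by (simp add: lpb_def norm_mult mult_left_mono)
next
  case False
  have "(\<Sum>i\<in>F. cmod (k * x i) powr real_of_ereal p) \<le> (cmod k * c) powr real_of_ereal p" if "finite F" for F
  proof -
    have "(\<Sum>i\<in>F. cmod (k * x i) powr real_of_ereal p) = cmod k powr real_of_ereal p * (\<Sum>i\<in>F. cmod (x i) powr real_of_ereal p)"
      by (simp add: norm_mult powr_mult sum_distrib_left)
    also have "\<dots> \<le> cmod k powr real_of_ereal p * c powr real_of_ereal p"
      using assms(2) False that by (intro mult_left_mono) (auto simp: lpb_def)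
    finally show ?thesis using assms(3) by (simp add: powr_mult)
  qed
  then show ?thesis using False by (simp add: lpb_def)
qed

lemma lpb_shift:
  assumes "lpb p x c"
  shows "lpb p (\<lambda>i. x (i + s)) c"
proof (cases "p = \<infinity>")
  case True then show ?thesis using assms by (simp add: lpb_def)
next
  case False
  have "(\<Sum>i\<in>F. cmod (x (i + s)) powr real_of_ereal p) = (\<Sum>i\<in>(\<lambda>i. i + s) ` F. cmod (x i) powr real_of_ereal p)" for F
    by (simp add: sum.reindex)
  then show ?thesis using False assms by (simp add: lpb_def)
qed

lemma powr_convex_nonneg:
  fixes s t u v p :: real
  assumes "1 \<le> p" "0 \<le> s" "0 \<le> t" "0 < u" "0 < v" "u + v = 1"
  shows "(u * s + v * t) powr p \<le> u * s powr p + v * t powr p"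
proof -
  have le: "(v * t) powr p \<le> v * t powr p" if "0 < v" "v \<le> 1" "0 \<le> t" for v t :: real
  proof -
    have "v powr p \<le> v powr 1" using that assms(1) by (intro powr_mono') auto
    then show ?thesis using that by (simp add: powr_mult mult_right_mono)
  qed
  consider "s = 0" | "t = 0" | "0 < s" "0 < t" using assms by linarith
  then show ?thesis
  proof cases
    case 1 then show ?thesis using le[of v t] assms by simp
  next
    case 2 then show ?thesis using le[of u s] assms by simp
  next
    case 3
    have "(\<lambda>x. x powr p) ((1 - v) *\<^sub>R s + v *\<^sub>R t) \<le> (1 - v) * s powr p + v * t powr p"
      using 3 assms by (intro convex_onD[OF powr_convex[OF assms(1)]]) auto
    moreover have "1 - v = u" using assms by simp
    ultimately show ?thesis by simp
  qed
qed

text \<open>Minkowski's inequality: \<open>x / a\<close> and \<open>y / b\<close> are mixed with the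
  weights \<open>a / (a + b)\<close> and \<open>b / (a + b)\<close>, and convexity of the power is
  applied termwise.\<close>

lemma lpb_add:
  assumes p: "1 \<le> p" and x: "lpb p x a" "0 \<le> a" and y: "lpb p y b" "0 \<le> b"
  shows "lpb p (\<lambda>i. x i + y i) (a + b)"
proof (cases "p = \<infinity>")
  case True
  then show ?thesis using x y unfolding lpb_def by (auto intro: order_trans[OF norm_triangle_ineq] add_mono)
next
  case False
  define r where "r = real_of_ereal p"
  have r: "1 \<le> r" using real_of_ereal_ge_1[OF p False] by (simp add: r_def)
  show ?thesis
  proof (cases "a = 0 \<or> b = 0")
    case True
    then have "(\<forall>i. x i = 0) \<or> (\<forall>i. y i = 0)" using lpb_coord[OF p x(2,1)] lpb_coord[OF p y(2,1)] by auto
    then show ?thesis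
    proof
      assume "\<forall>i. x i = 0"
      then show ?thesis using lpb_le[OF p y(1,2), of "a + b"] x(2) by simp
    next
      assume "\<forall>i. y i = 0"
      then show ?thesis using lpb_le[OF p x(1,2), of "a + b"] y(2) by simp
    qed
  next
    case nz: False
    then have ab: "0 < a" "0 < b" using x y by auto
    define u v where "u = a / (a + b)" and "v = b / (a + b)"
    have uv: "0 < u" "0 < v" "u + v = 1" using ab by (auto simp: u_def v_def simp flip: add_divide_distrib)
    have "(\<Sum>i\<in>F. cmod (x i + y i) powr r) \<le> (a + b) powr r" if F: "finite F" for F
    proof -
      have pt: "cmod (x i + y i) powr r \<le> (a + b) powr r * (u * (cmod (x i) powr r / a powr r) + v * (cmod (y i) powr r / b powr r))" for i
      proof -
        have "cmod (x i + y i) \<le> (a + b) * (u * (cmod (x i) / a) + v * (cmod (y i) / b))"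
        proof -
          have "(a + b) * (u * (cmod (x i) / a) + v * (cmod (y i) / b)) =
              ((a + b) * u) * (cmod (x i) / a) + ((a + b) * v) * (cmod (y i) / b)"
            by (simp only: distrib_left mult.assoc)
          also have "\<dots> = cmod (x i) + cmod (y i)" using ab by (simp add: u_def v_def)
          finally show ?thesis using norm_triangle_ineq[of "x i" "y i"] by simp
        qed
        then have "cmod (x i + y i) powr r \<le> ((a + b) * (u * (cmod (x i) / a) + v * (cmod (y i) / b))) powr r"
          using r by (intro powr_mono2) auto
        also have "\<dots> = (a + b) powr r * (u * (cmod (x i) / a) + v * (cmod (y i) / b)) powr r"
          by (rule powr_mult)
        also have "\<dots> \<le> (a + b) powr r * (u * (cmod (x i) / a) powr r + v * (cmod (y i) / b) powr r)"
          using r ab uv by (intro mult_left_mono powr_convex_nonneg) auto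
        finally show ?thesis using ab by (simp add: powr_divide)
      qed
      have "(\<Sum>i\<in>F. cmod (x i + y i) powr r) \<le> (\<Sum>i\<in>F. (a + b) powr r * (u * (cmod (x i) powr r / a powr r) + v * (cmod (y i) powr r / b powr r)))"
        by (intro sum_mono pt)
      also have "\<dots> = (a + b) powr r * (u * ((\<Sum>i\<in>F. cmod (x i) powr r) / a powr r) + v * ((\<Sum>i\<in>F. cmod (y i) powr r) / b powr r))"
        by (simp only: sum_distrib_left[symmetric] sum.distrib sum_divide_distrib[symmetric])
      also have "\<dots> \<le> (a + b) powr r * (u * 1 + v * 1)"
      proof -
        have "(\<Sum>i\<in>F. cmod (x i) powr r) / a powr r \<le> 1" "(\<Sum>i\<in>F. cmod (y i) powr r) / b powr r \<le> 1"
          using x(1) y(1) False F ab by (auto simp: lpb_def r_def)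
        then show ?thesis using uv by (intro mult_left_mono add_mono) auto
      qed
      finally show ?thesis using uv by simp
    qed
    then show ?thesis using False by (simp add: lpb_def r_def)
  qed
qed

lemma lpb_sum:
  assumes p: "1 \<le> p" and "finite S" "\<And>s. s \<in> S \<Longrightarrow> lpb p (f s) c" "0 \<le> c"
  shows "lpb p (\<lambda>i. \<Sum>s\<in>S. f s i) (real (card S) * c)"
  using assms(2,3)
proof (induction S rule: finite_induct)
  case empty then show ?case by (simp add: lpb_def)
next
  case (insert s S)
  have "lpb p (\<lambda>i. f s i + (\<Sum>s\<in>S. f s i)) (c + real (card S) * c)"
    using insert assms(4) by (intro lpb_add[OF p]) auto
  then show ?case using insert by (simp add: algebra_simps)
qed

lemma lpb_limit:
  assumes p: "1 \<le> p" and c: "0 \<le> c" and x: "\<forall>\<^sub>F n in sequentially. lpb p (X n) c" and l: "\<And>i. (\<lambda>n. X n i) \<longlonglongrightarrow> x i"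
  shows "lpb p x c"
proof (cases "p = \<infinity>")
  case True
  have "cmod (x i) \<le> c" for i
    using x True by (intro tendsto_upperbound[OF tendsto_norm[OF l[of i]]]) (auto simp: lpb_def elim: eventually_mono)
  then show ?thesis using True by (simp add: lpb_def)
next
  case False
  have r: "1 \<le> real_of_ereal p" using real_of_ereal_ge_1[OF p False] .
  have "(\<Sum>i\<in>F. cmod (x i) powr real_of_ereal p) \<le> c powr real_of_ereal p" if "finite F" for F
  proof (rule tendsto_upperbound)
    show "(\<lambda>n. \<Sum>i\<in>F. cmod (X n i) powr real_of_ereal p) \<longlonglongrightarrow> (\<Sum>i\<in>F. cmod (x i) powr real_of_ereal p)"
      using r by (intro tendsto_sum tendsto_powr' tendsto_norm l tendsto_const) auto
    show "\<forall>\<^sub>F n in sequentially. (\<Sum>i\<in>F. cmod (X n i) powr real_of_ereal p) \<le> c powr real_of_ereal p"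
      using x False that by (auto simp: lpb_def elim: eventually_mono)
  qed simp
  then show ?thesis using False by (simp add: lpb_def)
qed

lemma lpb_finite_support:
  assumes p: "1 \<le> p" and "finite S" "\<And>i. i \<notin> S \<Longrightarrow> x i = 0" "\<And>i. cmod (x i) \<le> c" "0 \<le> c"
  shows "lpb p x (real (card S) * c)"
proof -
  have 1: "lpb p (unit_seq s) 1" for s
  proof (cases "p = \<infinity>")
    case False
    have "(\<Sum>i\<in>F. cmod (unit_seq s i) powr real_of_ereal p) \<le> 1" if "finite F" for F
    proof -
      have "(\<Sum>i\<in>F. cmod (unit_seq s i) powr real_of_ereal p) = (\<Sum>i\<in>F. if i = s then 1 else 0)"
        by (intro sum.cong) (auto simp: unit_seq_def)
      then show ?thesis using that by simp
    qed
    then show ?thesis using False by (simp add: lpb_def)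
  qed (simp add: lpb_def unit_seq_def)
  have "lpb p (\<lambda>i. x s * unit_seq s i) c" for s
    using lpb_le[OF p lpb_scale[OF p 1, of "x s" s] _, of c] assms(4)[of s] by simp
  then have "lpb p (\<lambda>i. \<Sum>s\<in>S. x s * unit_seq s i) (real (card S) * c)"
    using assms by (intro lpb_sum) auto
  moreover have "(\<Sum>s\<in>S. x s * unit_seq s i) = x i" for i
    using assms(2,3) by (simp add: unit_seq_def if_distrib cong: if_cong)
  ultimately show ?thesis by simp
qed

text \<open>For \<open>p = \<infinity>\<close> tails need not become small; there
  \<open>fsm_of_loc_ineq\<close> uses exponential decay instead.\<close>

lemma lp_tail:
  assumes p: "1 \<le> p" "p \<noteq> \<infinity>" and x: "x \<in> lp_space p" and e: "0 < e"
  shows "\<exists>n0. \<forall>n\<ge>n0. lpb p (\<lambda>i. x i - proj n x i) e"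
proof -
  define r where "r = real_of_ereal p"
  have r: "1 \<le> r" using real_of_ereal_ge_1[OF p] by (simp add: r_def)
  let ?f = "\<lambda>i. cmod (x i) powr r"
  have s: "?f summable_on UNIV" using x p by (simp add: lp_space_def r_def)
  have e': "0 < e powr r" using e by simp
  have "\<exists>F. finite F \<and> infsum ?f UNIV - e powr r < sum ?f F"
  proof (rule ccontr)
    assume "\<not> ?thesis"
    then have "infsum ?f UNIV \<le> infsum ?f UNIV - e powr r" using s by (intro infsum_le_finite_sums) (auto simp: not_less)
    then show False using e' by simp
  qed
  then obtain F where F: "finite F" "infsum ?f UNIV - e powr r < sum ?f F" by blast
  define n0 where "n0 = nat (Max (insert 0 ((\<lambda>i. \<bar>i\<bar>) ` F)))"
  have Fn: "\<bar>i\<bar> \<le> int n0" if "i \<in> F" for i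
  proof -
    have "\<bar>i\<bar> \<le> Max (insert 0 ((\<lambda>i. \<bar>i\<bar>) ` F))" using F(1) that by (intro Max_ge) auto
    then show ?thesis unfolding n0_def by linarith
  qed
  show ?thesis
  proof (intro exI[of _ n0] allI impI)
    fix n assume n: "n0 \<le> n"
    have "(\<Sum>i\<in>G. cmod (x i - proj n x i) powr r) \<le> e powr r" if G: "finite G" for G
    proof -
      define G' where "G' = {i\<in>G. int n < \<bar>i\<bar>}"
      have "(\<Sum>i\<in>G. cmod (x i - proj n x i) powr r) = sum ?f G'"
        unfolding G'_def using G r by (intro sum.mono_neutral_cong_right) (auto simp: proj_def)
      also have "sum ?f G' = sum ?f (F \<union> G') - sum ?f F"
      proof -
        have "F \<inter> G' = {}" using Fn n by (fastforce simp: G'_def)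
        then show ?thesis using F G by (simp add: sum.union_disjoint G'_def)
      qed
      also have "sum ?f (F \<union> G') \<le> infsum ?f UNIV" using s F G by (intro finite_sum_le_infsum) (auto simp: G'_def)
      finally show ?thesis using F(2) by simp
    qed
    then show "lpb p (\<lambda>i. x i - proj n x i) e" using p by (simp add: lpb_def r_def)
  qed
qed

text \<open>\<open>2 * k * c + 1\<close> is the number of points in the window of \<open>k\<close>
  iterations with radius \<open>c\<close> each.\<close>

lemma geometric_beats_linear: "\<exists>k. (2 * real k * c + 1) * (3/4) ^ k \<le> 1 / 2"
proof -
  have "(\<lambda>k. 2 * c * (real k * (3/4) ^ k) + (3/4) ^ k) \<longlonglongrightarrow> 2 * c * 0 + 0"
    using powser_times_n_limit_0[of "3/4 :: real"] by (intro tendsto_intros LIMSEQ_power_zero) auto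
  then have "\<forall>\<^sub>F k in sequentially. 2 * c * (real k * (3/4) ^ k) + (3/4) ^ k < 1 / 2"
    by (rule order_tendstoD) simp
  then obtain k where "2 * c * (real k * (3/4) ^ k) + (3/4) ^ k < 1 / 2" by (auto simp: eventually_sequentially)
  then show ?thesis by (intro exI[of _ k]) (simp add: algebra_simps)
qed

text \<open>Iterating the local inequality makes the contraction factor beat the length of the window, so that
  it is inherited by every translation invariant norm.\<close>
lemma loc_ineq_lp:
  assumes N: "1 \<le> N" and C: "1 \<le> C"
  shows "\<exists>K\<ge>0. \<forall>p x y b. 1 \<le> p \<longrightarrow> loc_ineq (3/4) N C x y \<longrightarrow> x \<in> lp_space p \<longrightarrow> lpb p y b \<longrightarrow> 0 \<le> b \<longrightarrow> lpb p x (K * b)"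
proof -
  obtain k where k: "(2 * real k * of_int N + 1) * (3/4) ^ k \<le> 1 / 2" using geometric_beats_linear by blast
  define R where "R = int k * N"
  define w where "w = 2 * real k * of_int N + 1"
  have R0: "0 \<le> R" using N by (simp add: R_def)
  have w: "real (card {-R..R}) = w" using N by (simp add: R_def w_def)
  define K where "K = 2 * (w * (4 * C))"
  have w0: "0 \<le> w" using N by (simp add: w_def)
  have K0: "0 \<le> K" using w0 C by (simp add: K_def)
  show ?thesis
  proof (rule exI[of _ K], intro conjI K0 allI impI)
    fix p x y and b :: real
    assume p: "1 \<le> p" and li: "loc_ineq (3/4) N C x y" and x: "x \<in> lp_space p" and y: "lpb p y b" and b: "0 \<le> b"
    have nx: "0 \<le> lp_norm p x" "lpb p x (lp_norm p x)" using lpb_lp_norm[OF p x] by auto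
    \<comment> \<open>The maximum over the window is bounded by the sum over the window, a sum of
      translates of equal norm.\<close>
    define f where "f i = (\<Sum>s\<in>{-R..R}. complex_of_real ((3/4) ^ k * cmod (x (i + s))))" for i
    define g where "g i = (\<Sum>s\<in>{-R..R}. complex_of_real (4 * C * cmod (y (i + s))))" for i
    have xs: "lpb p (\<lambda>i. complex_of_real ((3/4) ^ k * cmod (x (i + s)))) ((3/4) ^ k * lp_norm p x)" for s
      using lpb_mono[OF p lpb_scale[OF p lpb_shift[OF nx(2)] nx(1), of "(3/4) ^ k" s],
          of "\<lambda>i. complex_of_real ((3/4) ^ k * cmod (x (i + s)))"]
      by (simp add: norm_mult norm_power)
    have ys: "lpb p (\<lambda>i. complex_of_real (4 * C * cmod (y (i + s)))) (4 * C * b)" for s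
      using lpb_mono[OF p lpb_scale[OF p lpb_shift[OF y] b, of "of_real (4 * C)" s],
          of "\<lambda>i. complex_of_real (4 * C * cmod (y (i + s)))"] C
      by (simp add: norm_mult)
    have "lpb p f (w * ((3/4) ^ k * lp_norm p x))" "lpb p g (w * (4 * C * b))"
      unfolding f_def g_def w[symmetric] using xs ys nx b C by (intro lpb_sum[OF p]; simp)+
    then have fg: "lpb p (\<lambda>i. f i + g i) (w * ((3/4) ^ k * lp_norm p x) + w * (4 * C * b))"
      using w0 nx b C by (intro lpb_add[OF p]) auto
    have "lpb p x (w * ((3/4) ^ k * lp_norm p x) + w * (4 * C * b))"
    proof (rule lpb_mono[OF p fg])
      fix i
      define F where "F = (\<Sum>s\<in>{-R..R}. cmod (x (i + s)))"
      define G where "G = (\<Sum>s\<in>{-R..R}. cmod (y (i + s)))"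
      have FG: "0 \<le> F" "0 \<le> G" by (auto simp: F_def G_def intro: sum_nonneg)
      have "cmod (y j) \<le> G \<and> cmod (x j) \<le> F" if "\<bar>j - i\<bar> \<le> int k * N" for j
      proof -
        have "j - i \<in> {-R..R}" using that by (auto simp: R_def abs_le_iff)
        then have "cmod (x (i + (j - i))) \<le> F" "cmod (y (i + (j - i))) \<le> G"
          unfolding F_def G_def by (intro member_le_sum[where f = "\<lambda>s. cmod (_ (i + s))"]; simp)+
        then show ?thesis by simp
      qed
      then have "cmod (x i) \<le> (3/4) ^ k * F + 4 * C * G"
        using N C by (intro loc_ineq_iterate[OF li]) auto
      also have "\<dots> = cmod (f i + g i)"
      proof -
        have "f i + g i = complex_of_real ((3/4) ^ k * F + 4 * C * G)"
          by (simp add: f_def g_def F_def G_def sum_distrib_left)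
        then show ?thesis using FG C by (simp del: of_real_add of_real_mult)
      qed
      finally show "cmod (x i) \<le> cmod (f i + g i)" .
    qed
    \<comment> \<open>By the choice of \<open>k\<close> the first term is at most half the norm of
      \<open>x\<close>; as this norm is finite, it can be absorbed.\<close>
    then have "lp_norm p x \<le> w * ((3/4) ^ k * lp_norm p x) + w * (4 * C * b)"
      using lpb_iff[OF p] w0 nx b C by simp
    also have "w * ((3/4) ^ k * lp_norm p x) = (w * (3/4) ^ k) * lp_norm p x" by simp
    also have "\<dots> \<le> 1 / 2 * lp_norm p x" using k nx unfolding w_def by (intro mult_right_mono) auto
    finally have "lp_norm p x \<le> K * b" by (simp add: K_def)
    then show "lpb p x (K * b)" using lpb_iff[OF p, of "K * b" x] x K0 b by simp
  qed
qed

section \<open>Bounded traces prevent invertibility\<close>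

lemma Lop_lpb:
  assumes p: "1 \<le> p" and x: "lpb p x b" "0 \<le> b" and V: "\<And>j. cmod (V j) \<le> Vb" and Vb: "0 \<le> Vb"
  shows "lpb p (Lop V x) (2 * b + Vb * b)"
proof -
  have "lpb p (\<lambda>i. of_real Vb * x i) (Vb * b)" using lpb_scale[OF p x, of "of_real Vb"] Vb by simp
  then have v: "lpb p (\<lambda>i. V i * x i) (Vb * b)"
    by (rule lpb_mono[OF p]) (simp add: norm_mult mult_right_mono V Vb)
  have s: "lpb p (\<lambda>i. x (i + 1)) b" "lpb p (\<lambda>i. x (i - 1)) b"
    using lpb_shift[OF x(1), of 1] lpb_shift[OF x(1), of "-1"] by simp_all
  have "lpb p (\<lambda>i. x (i + 1) + x (i - 1) + V i * x i) (b + b + Vb * b)"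
    using x Vb by (intro lpb_add[OF p] s v) auto
  then show ?thesis by (simp add: Lop_def[abs_def])
qed

lemma weight_step:
  fixes \<rho> \<kappa> :: real
  assumes \<rho>: "0 < \<rho>" "\<rho> < 1" and \<kappa>: "\<kappa> = 1 / \<rho> - 1" and s: "s = 1 \<or> s = (- 1 :: int)"
  shows "\<bar>\<rho> ^ nat \<bar>j + s\<bar> - \<rho> ^ nat \<bar>j\<bar>\<bar> \<le> \<kappa> * \<rho> ^ nat \<bar>j + s\<bar>"
proof -
  have k1: "1 - \<rho> \<le> \<kappa>"
  proof -
    have "(1 - \<rho>) * \<rho> \<le> (1 - \<rho>) * 1" using \<rho> by (intro mult_left_mono) auto
    then show ?thesis using \<rho> by (simp add: \<kappa> field_simps)
  qed
  have "\<bar>j + s\<bar> = \<bar>j\<bar> + 1 \<or> \<bar>j\<bar> = \<bar>j + s\<bar> + 1" using s by auto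
  then consider "nat \<bar>j + s\<bar> = Suc (nat \<bar>j\<bar>)" | "nat \<bar>j\<bar> = Suc (nat \<bar>j + s\<bar>)" by (auto simp: nat_eq_iff)
  then show ?thesis
  proof cases
    case 1
    have "\<bar>\<rho> ^ nat \<bar>j + s\<bar> - \<rho> ^ nat \<bar>j\<bar>\<bar> = \<rho> ^ nat \<bar>j\<bar> * (1 - \<rho>)"
      unfolding 1 using \<rho> by (simp add: abs_mult algebra_simps mult_left_le abs_if)
    also have "\<dots> = \<kappa> * \<rho> ^ nat \<bar>j + s\<bar>" unfolding 1 \<kappa> using \<rho> by (simp add: field_simps)
    finally show ?thesis by simp
  next
    case 2
    have "\<bar>\<rho> ^ nat \<bar>j + s\<bar> - \<rho> ^ nat \<bar>j\<bar>\<bar> = \<rho> ^ nat \<bar>j + s\<bar> * (1 - \<rho>)"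
      unfolding 2 using \<rho> by (simp add: abs_mult algebra_simps mult_left_le abs_if)
    also have "\<dots> \<le> \<rho> ^ nat \<bar>j + s\<bar> * \<kappa>" using k1 \<rho> by (intro mult_left_mono) auto
    finally show ?thesis by (simp add: mult.commute)
  qed
qed

text \<open>A bounded solution on a long window, damped by an exponential weight, is an approximate null vector
  in every \<open>l^p\<close>.\<close>
lemma damped_solution:
  assumes p: "1 \<le> p" and c: "1 \<le> c" and lam: "0 \<le> Vb"
  shows "\<exists>l. \<forall>V u. (\<forall>j. cmod (V j) \<le> Vb) \<longrightarrow> (\<forall>j. \<bar>j\<bar> \<le> int l \<longrightarrow> Lop V u j = 0) \<longrightarrow> (\<forall>j. cmod (u j) \<le> 2) \<longrightarrow> u 0 = 1 \<longrightarrow>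
    (\<exists>x. x \<in> lp_space p \<and> 0 < lp_norm p x \<and> lpb p (Lop V x) (lp_norm p x / (2 * c)))"
proof -
  \<comment> \<open>With \<open>n\<close> the norm of the damped vector, the weight differences
    contribute \<open>2 * \<kappa> * n = n / (4 * c)\<close> and the four places at the cut
    contribute \<open>4 * \<beta> \<le> 1 / (4 * c)\<close>. As \<open>n \<ge> 1\<close>, the total
    is at most \<open>n / (2 * c)\<close>.\<close>
  define \<kappa> where "\<kappa> = 1 / (8 * c)"
  define \<rho> where "\<rho> = 1 / (1 + \<kappa>)"
  have k0: "0 < \<kappa>" using c by (simp add: \<kappa>_def)
  have \<rho>: "0 < \<rho>" "\<rho> < 1" "\<kappa> = 1 / \<rho> - 1" using k0 by (auto simp: \<rho>_def)
  have "(\<lambda>l. \<rho> ^ l * (2 * (2 + Vb))) \<longlonglongrightarrow> 0 * (2 * (2 + Vb))"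
    using \<rho> by (intro tendsto_intros LIMSEQ_power_zero) auto
  then have "\<forall>\<^sub>F l in sequentially. \<rho> ^ l * (2 * (2 + Vb)) < 1 / (16 * c)"
    using c by (intro order_tendstoD) auto
  then obtain l0 where l0: "\<rho> ^ l0 * (2 * (2 + Vb)) < 1 / (16 * c)" by (auto simp: eventually_sequentially)
  define l where "l = Suc l0"
  define \<beta> where "\<beta> = \<rho> ^ l0 * (2 * (2 + Vb))"
  have \<beta>: "0 \<le> \<beta>" "\<beta> \<le> 1 / (16 * c)" using l0 \<rho> lam by (auto simp: \<beta>_def)
  show ?thesis
  proof (intro exI[of _ l] allI impI)
    fix V u assume V: "\<forall>j. cmod (V j) \<le> Vb" and L: "\<forall>j. \<bar>j\<bar> \<le> int l \<longrightarrow> Lop V u j = 0"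
      and ub: "\<forall>j. cmod (u j) \<le> 2" and u0: "u 0 = 1"
    define w where "w j = \<rho> ^ nat \<bar>j\<bar>" for j :: int
    define x where "x j = (if \<bar>j\<bar> \<le> int l then of_real (w j) * u j else 0)" for j
    have w0: "0 \<le> w j" for j using \<rho> by (simp add: w_def)
    define S where "S = {int l, int l + 1, - int l, - int l - 1}"
    have S: "finite S" "real (card S) \<le> 4" unfolding S_def by (auto simp: card_insert_if)
    define g where "g j = (if j \<in> S then complex_of_real \<beta> else 0)" for j
    have xb: "cmod (x j) \<le> \<rho> ^ l0 * 2" if "int l \<le> \<bar>j\<bar> + 1" for j
    proof -
      have "\<rho> ^ nat \<bar>j\<bar> \<le> \<rho> ^ l0" using that \<rho> by (intro power_decreasing) (auto simp: l_def)
      then have "w j * cmod (u j) \<le> \<rho> ^ l0 * 2" using ub w0 \<rho> by (intro mult_mono) (auto simp: w_def)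
      then show ?thesis using w0[of j] \<rho> by (simp add: x_def norm_mult)
    qed
    have pt: "cmod (Lop V x j) \<le> cmod (of_real (\<kappa> * cmod (x (j + 1))) + of_real (\<kappa> * cmod (x (j - 1))) + g j)" for j
    proof -
      have g0: "0 \<le> Re (g j)" "Im (g j) = 0" using \<beta> by (auto simp: g_def)
      have e: "cmod (of_real (\<kappa> * cmod (x (j + 1))) + of_real (\<kappa> * cmod (x (j - 1))) + g j)
          = \<kappa> * cmod (x (j + 1)) + \<kappa> * cmod (x (j - 1)) + Re (g j)"
      proof -
        have "of_real (\<kappa> * cmod (x (j + 1))) + of_real (\<kappa> * cmod (x (j - 1))) + g j
          = complex_of_real (\<kappa> * cmod (x (j + 1)) + \<kappa> * cmod (x (j - 1)) + Re (g j))"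
          using g0 by (simp add: complex_eq_iff)
        then show ?thesis using k0 g0 by (simp only: norm_of_real) simp
      qed
      consider "\<bar>j\<bar> < int l" | "j \<in> S" | "int l + 1 < \<bar>j\<bar>" unfolding S_def by force
      then show ?thesis
      proof cases
        case 1
        have xj: "x j = of_real (w j) * u j" "x (j + 1) = of_real (w (j + 1)) * u (j + 1)" "x (j - 1) = of_real (w (j - 1)) * u (j - 1)"
          using 1 by (auto simp: x_def)
        \<comment> \<open>Subtracting the weighted equation of \<open>u\<close> leaves only
          differences of weights.\<close>
        have "Lop V x j = Lop V x j - of_real (w j) * Lop V u j" using L 1 by simp
        also have "\<dots> = of_real (w (j + 1) - w j) * u (j + 1) + of_real (w (j - 1) - w j) * u (j - 1)"
          unfolding Lop_def xj by (simp add: algebra_simps)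
        finally have "cmod (Lop V x j) \<le> \<bar>w (j + 1) - w j\<bar> * cmod (u (j + 1)) + \<bar>w (j - 1) - w j\<bar> * cmod (u (j - 1))"
          by (metis norm_mult norm_of_real norm_triangle_ineq)
        also have "\<dots> \<le> (\<kappa> * w (j + 1)) * cmod (u (j + 1)) + (\<kappa> * w (j - 1)) * cmod (u (j - 1))"
          using weight_step[OF \<rho>, of 1 j] weight_step[OF \<rho>, of "-1" j]
          by (intro add_mono mult_right_mono) (auto simp: w_def)
        also have "\<dots> = \<kappa> * cmod (x (j + 1)) + \<kappa> * cmod (x (j - 1))"
          unfolding xj norm_mult norm_of_real using w0 by simp
        finally show ?thesis unfolding e using g0 by simp
      next
        case 2
        then have jj: "int l \<le> \<bar>j\<bar>" "int l \<le> \<bar>j + 1\<bar> + 1" "int l \<le> \<bar>j - 1\<bar> + 1" by (auto simp: S_def)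
        have "cmod (Lop V x j) \<le> cmod (x (j + 1)) + cmod (x (j - 1)) + cmod (V j) * cmod (x j)"
          unfolding Lop_def norm_mult[symmetric] by (intro norm_triangle_le add_mono norm_triangle_ineq order_refl)
        also have "\<dots> \<le> \<rho> ^ l0 * 2 + \<rho> ^ l0 * 2 + Vb * (\<rho> ^ l0 * 2)"
          using jj V lam by (intro add_mono mult_mono xb) auto
        also have "\<dots> = Re (g j)" using 2 by (simp add: g_def \<beta>_def algebra_simps)
        finally show ?thesis unfolding e using k0 by (simp add: add_increasing)
      next
        case 3
        then have "\<not> \<bar>j + 1\<bar> \<le> int l" "\<not> \<bar>j - 1\<bar> \<le> int l" "\<not> \<bar>j\<bar> \<le> int l" by linarith+
        then have "Lop V x j = 0" by (simp add: Lop_def x_def)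
        then show ?thesis by simp
      qed
    qed
    have "lpb p x (real (card {- int l..int l}) * 2)"
    proof (rule lpb_finite_support[OF p])
      fix i
      have "w i * cmod (u i) \<le> 1 * 2" using ub w0 \<rho> by (intro mult_mono) (auto simp: w_def power_le_one)
      then show "cmod (x i) \<le> 2" using w0[of i] by (simp add: x_def norm_mult)
    qed (auto simp: x_def)
    then have x: "x \<in> lp_space p" using lpb_iff[OF p] by (metis mult_nonneg_nonneg of_nat_0_le_iff zero_le_numeral)
    define n where "n = lp_norm p x"
    have n: "0 \<le> n" "lpb p x n" using lpb_lp_norm[OF p x] by (auto simp: n_def)
    have n1: "1 \<le> n" using lpb_coord[OF p n, of 0] u0 by (simp add: x_def w_def)
    have s: "lpb p (\<lambda>j. of_real (\<kappa> * cmod (x (j + t)))) (\<kappa> * n)" for t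
      using lpb_mono[OF p lpb_scale[OF p lpb_shift[OF n(2)] n(1), of "of_real \<kappa>" t],
          of "\<lambda>j. of_real (\<kappa> * cmod (x (j + t)))"] k0 by (simp add: norm_mult)
    have g: "lpb p g (4 * \<beta>)"
    proof -
      have "lpb p g (real (card S) * \<beta>)"
        using \<beta> S by (intro lpb_finite_support[OF p]) (auto simp: g_def)
      then show ?thesis using lpb_le[OF p, of g "real (card S) * \<beta>" "4 * \<beta>"] S \<beta> mult_right_mono[of "real (card S)" 4 \<beta>] by simp
    qed
    have "lpb p (\<lambda>j. of_real (\<kappa> * cmod (x (j + 1))) + of_real (\<kappa> * cmod (x (j - 1))) + g j) (\<kappa> * n + \<kappa> * n + 4 * \<beta>)"
      using s[of 1] s[of "-1"] g k0 n \<beta> by (intro lpb_add[OF p]) auto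
    then have Lb: "lpb p (Lop V x) (\<kappa> * n + \<kappa> * n + 4 * \<beta>)" using pt by (rule lpb_mono[OF p])
    have "\<kappa> * n + \<kappa> * n + 4 * \<beta> \<le> n / (2 * c)"
    proof -
      have "4 * \<beta> \<le> 1 / (4 * c)" using \<beta> by simp
      also have "\<dots> \<le> n / (4 * c)" using n1 c by (intro divide_right_mono) auto
      finally show ?thesis using c by (simp add: \<kappa>_def field_simps)
    qed
    then have "lpb p (Lop V x) (n / (2 * c))" using lpb_le[OF p Lb, of "n / (2 * c)"] k0 n \<beta> by simp
    then show "\<exists>x. x \<in> lp_space p \<and> 0 < lp_norm p x \<and> lpb p (Lop V x) (lp_norm p x / (2 * c))"
      using x n1 unfolding n_def by (intro exI[of _ x]) auto
  qed
qed

lemma elliptic_root: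
  fixes t :: real
  assumes "\<bar>t\<bar> \<le> 2"
  shows "\<exists>z. cmod z = 1 \<and> z * z - of_real t * z + 1 = 0"
proof -
  define s where "s = sqrt (4 - t * t)"
  have "t * t \<le> 4" using assms abs_le_square_iff[of t 2] by (simp add: power2_eq_square)
  then have s: "s * s = 4 - t * t" by (simp add: s_def)
  define z where "z = Complex (t / 2) (s / 2)"
  have "z * z - of_real t * z + 1 = 0" using s by (simp add: z_def complex_eq_iff field_simps)
  moreover have "cmod z = 1" using s by (simp add: z_def cmod_def power2_eq_square field_simps)
  ultimately show ?thesis by blast
qed

lemma transfer_trace_real: "\<exists>t::real. mtr (tmat (pot lam \<beta> \<theta>) 0 n) = of_real t"
  using transfer_M_tmat[of lam \<beta> \<theta> n] by (metis mtr.simps of_real_add)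

context irrational_slope
begin

text \<open>The bounded solution lives on an approximant. \<open>approx_window_is_sturmian\<close>
  finds its window in some phase \<open>y\<close>, and recurrence finds the same word in phase
  \<open>\<theta>\<close>. \<open>damped_solution\<close> needs the equation only inside this
  window.\<close>

lemma not_invertible:
  fixes pe :: ereal
  assumes inf: "\<And>M. \<exists>m\<ge>M. cmod (trc lam m) \<le> 2" and pe: "1 \<le> pe"
  shows "\<not> is_inverse_on pe (schroedinger lam \<alpha> \<theta>) B"
proof
  let ?V = "pot lam \<alpha> \<theta>"
  assume inv: "is_inverse_on pe (schroedinger lam \<alpha> \<theta>) B"
  then obtain C0 where B: "\<And>x. x \<in> lp_space pe \<Longrightarrow> B (Lop ?V x) = x"
    "\<And>x. x \<in> lp_space pe \<Longrightarrow> lp_norm pe (B x) \<le> C0 * lp_norm pe x"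
    unfolding is_inverse_on_def schroedinger_Lop by blast
  define c where "c = max 1 C0"
  have c: "1 \<le> c" "C0 \<le> c" by (auto simp: c_def)
  obtain l where l: "\<And>V u. (\<forall>j. cmod (V j) \<le> \<bar>lam\<bar>) \<Longrightarrow> (\<forall>j. \<bar>j\<bar> \<le> int l \<longrightarrow> Lop V u j = 0) \<Longrightarrow> (\<forall>j. cmod (u j) \<le> 2) \<Longrightarrow> u 0 = 1 \<Longrightarrow>
    (\<exists>x. x \<in> lp_space pe \<and> 0 < lp_norm pe x \<and> lpb pe (Lop V x) (lp_norm pe x / (2 * c)))"
    using damped_solution[OF pe c(1) abs_ge_zero[of lam]] by blast
  define L where "L = 2 * int l + 1"
  obtain m where m: "nat (2 * L) + 3 \<le> m" "cmod (trc lam m) \<le> 2" using inf by blast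
  have m2: "2 \<le> m" using m by simp
  have qL: "2 * L < int (q (Suc m))" "0 \<le> L" using m q_ge[of m] by (auto simp: L_def)
  let ?W = "pot lam (cf_approx \<alpha> m) 0"
  have "trc lam m = mtr (tmat ?W 0 (q m))"
  proof -
    have "Suc (Suc (Suc (m - 3))) = m" using m by simp
    then have "trc lam m = per_trc lam m" using trc_eq_per_trc[of lam "m - 3"] by simp
    also have "\<dots> = mtr (tmat ?W 0 (q m))"
      unfolding per_trc_def using m2 by (simp add: pot_def[abs_def] sturm_v_approx)
    finally show ?thesis .
  qed
  then obtain t :: real where t: "mtr (tmat ?W 0 (q m)) = of_real t" "\<bar>t\<bar> \<le> 2"
    using transfer_trace_real[of lam "cf_approx \<alpha> m" 0 "q m"] m(2) by auto
  obtain z where z: "cmod z = 1" "z * z - of_real t * z + 1 = 0" using elliptic_root[OF t(2)] by blast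
  obtain u where u: "\<And>j. Lop ?W u j = 0" "u 0 \<noteq> 0 \<or> u 1 \<noteq> 0" "\<And>j. u (j + int (q m)) = z * u j"
    using floquet[of ?W "\<bar>lam\<bar>" "q m" z] pot_bound pot_approx_period[OF m2] q_pos z(2) t(1) by metis
  obtain Bd where Bd: "\<And>j. cmod (u j) \<le> Bd" using floquet_bounded[where u = u, OF q_pos u(3) z(1)] by blast
  \<comment> \<open>The supremum need not be attained; a place \<open>j0\<close> with more than half
    of it makes the rescaled solution 1 at the origin and at most 2 everywhere.\<close>
  define s where "s = (SUP j. cmod (u j))"
  have bdd: "bdd_above (range (\<lambda>j. cmod (u j)))" using Bd by (intro bdd_aboveI[of _ Bd]) auto
  have us: "cmod (u j) \<le> s" for j unfolding s_def using bdd by (intro cSUP_upper) auto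
  have s0: "0 < s" using u(2) us[of 0] us[of 1] by (metis less_le_trans zero_less_norm_iff)
  then have "s / 2 < s" by simp
  then have "s / 2 < (SUP j. cmod (u j))" by (fold s_def)
  then obtain j0 where j0: "s / 2 < cmod (u j0)" unfolding less_cSUP_iff[OF UNIV_not_empty bdd] by blast
  have uj0: "u j0 \<noteq> 0" using j0 s0 by auto
  define v where "v j = 1 / u j0 * u (j + j0)" for j
  have v0: "v 0 = 1" using uj0 by (simp add: v_def)
  have vb: "cmod (v j) \<le> 2" for j
  proof -
    have "cmod (u (j + j0)) \<le> 2 * cmod (u j0)" using us[of "j + j0"] j0 by simp
    then show ?thesis using uj0 by (simp add: v_def norm_divide norm_mult field_simps)
  qed
  have vL: "Lop (\<lambda>j. ?W (j + j0)) v j = 0" for j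
    unfolding v_def Lop_scale Lop_shift using u(1) by simp
  obtain y where y: "\<And>j. 0 \<le> j \<Longrightarrow> j < L \<Longrightarrow> sturm_v (cf_approx \<alpha> m) 0 (j0 - int l + j) = sturm_v \<alpha> y j"
    using approx_window_is_sturmian[OF m2 qL, of "j0 - int l"] by blast
  define N where "N = nat L + 2"
  have N: "L \<le> int (q (Suc N)) - 2" using q_ge[of N] qL(2) unfolding N_def by linarith
  obtain n where n: "\<And>j. 0 \<le> j \<Longrightarrow> j \<le> int (q (Suc N)) - 2 \<Longrightarrow> sturm_v \<alpha> \<theta> (- n + j) = sturm_v \<alpha> y j"
    using sturm_v_recurrence[of 0 N \<theta> y] by blast
  define V' where "V' j = ?V (j + (- n + int l))" for j
  have match: "V' j = ?W (j + j0)" if "\<bar>j\<bar> \<le> int l" for j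
    using y[of "j + int l"] n[of "j + int l"] that N by (simp add: V'_def pot_def L_def algebra_simps)
  have "Lop V' v j = 0" if "\<bar>j\<bar> \<le> int l" for j
    using vL[of j] match[OF that] by (simp add: Lop_def)
  then obtain x where x: "x \<in> lp_space pe" "0 < lp_norm pe x" "lpb pe (Lop V' x) (lp_norm pe x / (2 * c))"
    using l[of V' v] vb v0 pot_bound by (auto simp: V'_def)
  define nx where "nx = lp_norm pe x"
  define x' where "x' j = x (j - (- n + int l))" for j
  have xx: "x = (\<lambda>j. x' (j + (- n + int l)))" by (simp add: x'_def)
  have Lx: "lpb pe (Lop ?V x') (nx / (2 * c))"
  proof -
    have "Lop ?V x' = (\<lambda>j. Lop V' x (j + - (- n + int l)))"
    proof
      fix j
      show "Lop ?V x' j = Lop V' x (j + - (- n + int l))"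
        unfolding xx V'_def Lop_shift by simp
    qed
    then show ?thesis using lpb_shift[OF x(3), of "- (- n + int l)"] by (simp add: nx_def)
  qed
  have nx0: "0 < nx" using x by (simp add: nx_def)
  have "lpb pe x nx" using lpb_lp_norm[OF pe x(1)] by (simp add: nx_def)
  then have "lpb pe (\<lambda>j. x (j + - (- n + int l))) nx" by (rule lpb_shift)
  moreover have "x' = (\<lambda>j. x (j + - (- n + int l)))" by (rule ext) (simp add: x'_def algebra_simps)
  ultimately have "lpb pe x' nx" by simp
  then have x': "x' \<in> lp_space pe" using lpb_iff[OF pe] nx0 by (metis less_imp_le)
  have Lx': "Lop ?V x' \<in> lp_space pe" "lp_norm pe (Lop ?V x') \<le> nx / (2 * c)"
    using lpb_iff[OF pe, of "nx / (2 * c)"] Lx nx0 c by auto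
  have "0 \<le> lp_norm pe (Lop ?V x')" using lpb_lp_norm[OF pe Lx'(1)] by blast
  have "lp_norm pe x' \<le> C0 * lp_norm pe (Lop ?V x')" using B(2)[OF Lx'(1)] B(1)[OF x'] by simp
  also have "\<dots> \<le> c * (nx / (2 * c))" using c Lx' \<open>0 \<le> lp_norm pe (Lop ?V x')\<close> by (intro mult_mono) auto
  also have "\<dots> = nx / 2" using c by simp
  finally have h: "lp_norm pe x' \<le> nx / 2" .
  then have "lpb pe x' (nx / 2)" using lpb_iff[OF pe, of "nx / 2"] x' nx0 by simp
  then have "lpb pe (\<lambda>j. x' (j + (- n + int l))) (nx / 2)" by (rule lpb_shift)
  then have "lpb pe x (nx / 2)" by (simp add: x'_def)
  then have "nx \<le> nx / 2" using lpb_iff[OF pe, of "nx / 2" x] nx0 unfolding nx_def by simp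
  then show False using nx0 by simp
qed

end

section \<open>Stability of the finite sections\<close>

locale gapped_sturmian = irrational_slope +
  fixes lam :: real and N :: int and C \<delta> :: real and M0 :: nat
  assumes N_ge_1: "1 \<le> N" and C_ge_1: "1 \<le> C" and \<delta>_pos: "0 < \<delta>"
    and hyperbolic_word: "cmod E \<le> \<delta> \<Longrightarrow> hyperbolic (\<lambda>j. pot lam \<alpha> \<theta> j - E) N C (\<bar>lam\<bar> + 1)"
    and hyperbolic_approx: "M0 \<le> m \<Longrightarrow> cmod E \<le> \<delta> \<Longrightarrow>
      hyperbolic (\<lambda>j. pot lam (cf_approx \<alpha> m) 0 (k + j) - E) N C (\<bar>lam\<bar> + 1)"
begin

abbreviation V :: "real \<Rightarrow> int \<Rightarrow> complex" where "V \<theta> \<equiv> pot lam \<alpha> \<theta>"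

lemma hyperbolic_0: "hyperbolic (V \<theta>) N C (\<bar>lam\<bar> + 1)"
  using hyperbolic_word[of 0 \<theta>] \<delta>_pos by simp

lemma cnj_pot: "cnj (pot lam \<beta> \<theta> j) = pot lam \<beta> \<theta> j"
  by (simp add: pot_def)

text \<open>A Dirichlet solution that stays bounded on a long window is nearly proportional to the decaying solution
  of the periodic approximation, hence forces a Dirichlet eigenvalue near zero there.\<close>
lemma bounded_dirichlet_imp_G:
  assumes \<tau>0: "\<forall>V n Vb \<tau> u0.
    (\<forall>E. cmod E \<le> \<delta> \<longrightarrow> hyperbolic (\<lambda>j. V j - E) N C Vb) \<longrightarrow> (\<forall>j. cnj (V j) = V j) \<longrightarrow>
    (\<forall>j. V (j + int n) = V j) \<longrightarrow> 1 \<le> n \<longrightarrow> 0 \<le> \<tau> \<longrightarrow> \<tau> \<le> \<tau>0 \<longrightarrow>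
    (\<forall>j. Lop V u0 j = 0) \<longrightarrow> (\<exists>B. \<forall>j\<ge>0. cmod (u0 j) \<le> B) \<longrightarrow> u0 0 = 1 \<longrightarrow> cmod (u0 (- 1)) \<le> \<tau> \<longrightarrow>
    (\<exists>E::real. \<bar>E\<bar> \<le> 2 * \<tau> \<and> (\<exists>u z. (\<forall>j. Lop (\<lambda>j. V j - of_real E) u j = 0) \<and> u (- 1) = 0 \<and> u 0 = 1 \<and>
       (\<forall>j. u (j + int n) = z * u j) \<and> cmod z < 1))"
    and \<tau>: "0 \<le> \<tau>" "\<tau> \<le> \<tau>0" "\<tau> < 1" and k: "8 * C * B0 * (3/4) ^ k \<le> \<tau>"
    and \<Phi>: "\<And>j. Lop (V \<theta>) \<Phi> j = 0" "\<Phi> (- 1) = 0" "\<Phi> 0 = 1"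
    and B0: "\<And>j. 0 \<le> j \<Longrightarrow> j \<le> int k * N + 1 \<Longrightarrow> cmod (\<Phi> j) \<le> B0"
    and m: "2 \<le> m" "M0 \<le> m"
    and match: "\<And>j. 0 \<le> j \<Longrightarrow> j \<le> int k * N + 1 \<Longrightarrow> sturm_v (cf_approx \<alpha> m) 0 (k0 + j) = sturm_v \<alpha> \<theta> j"
  shows "\<exists>E::real. \<bar>E\<bar> \<le> 2 * \<tau> \<and> complex_of_real E \<in> G_set lam \<alpha> m"
proof -
  define W where "W j = pot lam (cf_approx \<alpha> m) 0 (k0 + j)" for j
  have hW: "hyperbolic (\<lambda>j. W j - E) N C (\<bar>lam\<bar> + 1)" if "cmod E \<le> \<delta>" for E
    unfolding W_def using hyperbolic_approx[OF m(2) that] .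
  interpret h: hyperbolic W N C "\<bar>lam\<bar> + 1" using hW[of 0] \<delta>_pos by simp
  have per: "W (j + int (q m)) = W j" for j
    using pot_approx_period[OF m(1), of lam "k0 + j"] by (simp add: W_def add.assoc)
  obtain f z where f: "\<And>j. Lop W f j = 0" "\<And>j. f (j + int (q m)) = z * f j" "cmod z < 1" "0 < amp f 0"
    "\<exists>B. \<forall>j\<ge>0. cmod (f j) \<le> B"
    using h.stable_floquet[OF q_pos per] by blast
  obtain B where B: "\<And>j. 0 \<le> j \<Longrightarrow> cmod (f j) \<le> B" using f(5) by blast
  obtain \<Psi> where \<Psi>: "\<And>j. Lop W \<Psi> j = 0" "\<Psi> (- 1) = 0" "\<Psi> 0 = 1" using sol_exists[of W "-1" 0 1] by auto
  let ?L = "int k * N + 1"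
  have kN: "0 \<le> int k * N" using N_ge_1 by simp
  have eq: "\<Psi> j = \<Phi> j" if "-1 \<le> j" "j \<le> ?L + 1" for j
  proof (rule sol_eq[where V = W and c = "-1" and lo = 0 and hi = ?L, OF h.V_bound])
    fix i assume "0 \<le> i" "i \<le> ?L"
    then have "Lop W \<Phi> i = Lop (V \<theta>) \<Phi> i" using match by (simp add: Lop_def W_def pot_def)
    then show "Lop W \<Psi> i = Lop W \<Phi> i" using \<Psi>(1) \<Phi>(1) by simp
  qed (use that \<Psi> \<Phi> kN in auto)
  define n where "n = nat ?L"
  have n: "int n - 1 = int k * N" using kN by (simp add: n_def)
  \<comment> \<open>By the Dirichlet condition the Wronskian at \<open>- 1\<close> is
    \<open>- f (- 1)\<close>. At the far end \<open>f\<close> has decayed while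
    \<open>\<Phi>\<close> is still bounded, so \<open>f\<close> almost satisfies the Dirichlet
    condition.\<close>
  have "wronskian f \<Psi> (- 1) = wronskian f \<Psi> (int n - 1)"
    using wronskian_energy[of W 0 \<Psi> 0 f n] \<Psi>(1) f(1) by simp
  then have fm: "- f (- 1) = f (int k * N + 1) * \<Phi> (int k * N) - f (int k * N) * \<Phi> (int k * N + 1)"
    unfolding n using \<Psi> eq[of "int k * N"] eq[of "int k * N + 1"] kN by (simp add: wronskian_def)
  define D where "D = (3/4) ^ k * (4 * C * amp f 0)"
  have fd: "cmod (f j) \<le> D" if "int k * N \<le> j" for j
    unfolding D_def using that f(1) B by (intro h.forward_decay[of 0 f B]) auto
  have D0: "0 \<le> D" using C_ge_1 amp_nonneg[of f 0] by (simp add: D_def)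
  have "cmod (f (- 1)) = cmod (f (int k * N + 1) * \<Phi> (int k * N) - f (int k * N) * \<Phi> (int k * N + 1))"
    using fm by (metis norm_minus_cancel)
  also have "\<dots> \<le> cmod (f (int k * N + 1)) * cmod (\<Phi> (int k * N)) + cmod (f (int k * N)) * cmod (\<Phi> (int k * N + 1))"
    by (metis norm_mult norm_triangle_ineq4)
  also have "\<dots> \<le> D * B0 + D * B0" using fd B0 kN D0 by (intro add_mono mult_mono) auto
  also have "\<dots> = (8 * C * B0 * (3/4) ^ k) * amp f 0" by (simp add: D_def)
  also have "\<dots> \<le> \<tau> * amp f 0" using k amp_nonneg by (intro mult_right_mono) auto
  finally have f1: "cmod (f (- 1)) \<le> \<tau> * amp f 0" .
  have "\<tau> * amp f 0 < amp f 0" using \<tau> f(4) by simp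
  then have af: "amp f 0 = cmod (f 0)" using f1 unfolding amp_def by auto
  then have f0: "f 0 \<noteq> 0" using f(4) by auto
  define u0 where "u0 j = 1 / f 0 * f j" for j
  have "\<exists>E::real. \<bar>E\<bar> \<le> 2 * \<tau> \<and> (\<exists>u z. (\<forall>j. Lop (\<lambda>j. W j - of_real E) u j = 0) \<and> u (- 1) = 0 \<and> u 0 = 1 \<and>
       (\<forall>j. u (j + int (q m)) = z * u j) \<and> cmod z < 1)"
  proof (rule \<tau>0[rule_format, of W "\<bar>lam\<bar> + 1" "q m" \<tau> u0])
    show "\<exists>B. \<forall>j\<ge>0. cmod (u0 j) \<le> B"
    proof (intro exI allI impI)
      fix j :: int assume "0 \<le> j"
      then show "cmod (u0 j) \<le> B / cmod (f 0)" using B f0 by (simp add: u0_def norm_divide norm_mult divide_right_mono)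
    qed
    show "Lop W u0 j = 0" for j unfolding u0_def Lop_scale using f(1) by simp
    show "cmod (u0 (- 1)) \<le> \<tau>" using f1 f0 af by (simp add: u0_def norm_divide norm_mult field_simps)
    show "cnj (W j) = W j" for j by (simp add: W_def cnj_pot)
  qed (use hW per q_pos \<tau> f0 in \<open>auto simp: u0_def\<close>)
  then obtain E u z where E: "\<bar>E\<bar> \<le> 2 * \<tau>" and u: "\<And>j. Lop (\<lambda>j. W j - of_real E) u j = 0" "u (- 1) = 0" "u 0 = 1"
    "\<And>j. u (j + int (q m)) = z * u j" "cmod z < 1" by blast
  \<comment> \<open>\<open>G_set\<close> lists only the starting places \<open>1, ..., q m\<close>;
    periodicity moves \<open>k0\<close> there.\<close>
  define k1 where "k1 = (k0 - 1) mod int (q m) + 1"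
  define t where "t = (k0 - 1) div int (q m)"
  have k1: "k1 \<in> {1..int (q m)}" using q_pos[of m] by (auto simp: k1_def intro: pos_mod_bound add1_zle_eq[THEN iffD2])
  have k0: "k0 = k1 + t * int (q m)" by (simp add: k1_def t_def)
  have pers: "pot lam (cf_approx \<alpha> m) 0 (j + i * int (q m)) = pot lam (cf_approx \<alpha> m) 0 j" for i j
  proof (induction i rule: int_induct[where k = 0])
    case (step1 i)
    then show ?case using pot_approx_period[OF m(1), of lam "j + i * int (q m)"] by (simp add: algebra_simps)
  next
    case (step2 i)
    then show ?case using pot_approx_period[OF m(1), of lam "j + (i - 1) * int (q m)"] by (simp add: algebra_simps)
  qed simp
  have W1: "W j = pot lam (cf_approx \<alpha> m) 0 (k1 + j)" for j
    using pers[of "k1 + j" t] by (simp add: W_def k0 algebra_simps)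
  have "complex_of_real E \<in> G_set lam \<alpha> m"
    unfolding G_set_iff[OF m(1)]
  proof (intro bexI[OF _ k1] exI[of _ "\<lambda>j. u (j - k1)"] exI[of _ z] conjI allI)
    fix j
    have "Lop (\<lambda>j. pot lam (cf_approx \<alpha> m) 0 j - of_real E) (\<lambda>j. u (j - k1)) j
        = Lop (\<lambda>j. W (j + - k1) - of_real E) (\<lambda>j. u (j + - k1)) j" by (simp add: W1)
    also have "\<dots> = Lop (\<lambda>j. W j - of_real E) u (j + - k1)" by (rule Lop_shift)
    finally show "Lop (\<lambda>j. pot lam (cf_approx \<alpha> m) 0 j - of_real E) (\<lambda>j. u (j - k1)) j = 0" using u(1) by simp
    show "u (j + int (q m) - k1) = z * u (j - k1)" using u(4)[of "j - k1"] by (simp add: algebra_simps)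
  qed (use u in auto)
  then show ?thesis using E by blast
qed

lemma dist0_G_nonneg: "0 \<le> dist0_G lam \<alpha> m"
  unfolding dist0_G_def by (intro INF_greatest) simp

text \<open>Otherwise, for every length some Dirichlet solution stays within twice its initial size,
  and \<open>bounded_dirichlet_imp_G\<close> yields elements of \<open>G_set\<close> near zero for
  all large \<open>m\<close>, so that even the upper limit of the distances vanishes. The comparison
  is with all of \<open>0..N\<close>, the strip where the inequality for the whole line cannot be
  used.\<close>

lemma dirichlet_growth:
  assumes "liminf (\<lambda>m. dist0_G lam \<alpha> m) \<noteq> 0"
  shows "\<exists>L. \<forall>\<theta> \<Phi>. (\<forall>j. Lop (V \<theta>) \<Phi> j = 0) \<longrightarrow> \<Phi> (- 1) = 0 \<longrightarrow> \<Phi> 0 = 1 \<longrightarrow>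
    (\<exists>j. 0 \<le> j \<and> j \<le> L \<and> (\<forall>i. 0 \<le> i \<longrightarrow> i \<le> N \<longrightarrow> 2 * cmod (\<Phi> i) \<le> cmod (\<Phi> j)))"
proof (rule ccontr)
  assume neg: "\<not> ?thesis"
  define ds where "ds \<theta> \<Phi> \<longleftrightarrow> (\<forall>j. Lop (V \<theta>) \<Phi> j = 0) \<and> \<Phi> (- 1) = 0 \<and> \<Phi> 0 = 1" for \<theta> \<Phi>
  define gr where "gr L \<Phi> \<longleftrightarrow> (\<exists>j. 0 \<le> j \<and> j \<le> L \<and> (\<forall>i. 0 \<le> i \<longrightarrow> i \<le> N \<longrightarrow> 2 * cmod (\<Phi> i) \<le> cmod (\<Phi> j)))" for L \<Phi>
  have neg': "\<not> (\<exists>L. \<forall>\<theta> \<Phi>. ds \<theta> \<Phi> \<longrightarrow> gr L \<Phi>)" using neg unfolding ds_def gr_def imp_conjL .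
  obtain \<tau>0 where \<tau>0: "0 < \<tau>0" "\<forall>V n Vb \<tau> u0.
    (\<forall>E. cmod E \<le> \<delta> \<longrightarrow> hyperbolic (\<lambda>j. V j - E) N C Vb) \<longrightarrow> (\<forall>j. cnj (V j) = V j) \<longrightarrow>
    (\<forall>j. V (j + int n) = V j) \<longrightarrow> 1 \<le> n \<longrightarrow> 0 \<le> \<tau> \<longrightarrow> \<tau> \<le> \<tau>0 \<longrightarrow>
    (\<forall>j. Lop V u0 j = 0) \<longrightarrow> (\<exists>B. \<forall>j\<ge>0. cmod (u0 j) \<le> B) \<longrightarrow> u0 0 = 1 \<longrightarrow> cmod (u0 (- 1)) \<le> \<tau> \<longrightarrow>
    (\<exists>E::real. \<bar>E\<bar> \<le> 2 * \<tau> \<and> (\<exists>u z. (\<forall>j. Lop (\<lambda>j. V j - of_real E) u j = 0) \<and> u (- 1) = 0 \<and> u 0 = 1 \<and>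
       (\<forall>j. u (j + int n) = z * u j) \<and> cmod z < 1))"
    using edge_energy[OF N_ge_1 C_ge_1 \<delta>_pos] by blast
  define Q where "Q = (\<bar>lam\<bar> + 1 + 2) ^ nat (N - 0 + 2) * 1"
  define B0 where "B0 = 2 * Q"
  have Q0: "0 \<le> Q" by (simp add: Q_def)
  have small: "\<forall>\<^sub>F m in sequentially. dist0_G lam \<alpha> m \<le> ereal e" if e: "0 < e" for e
  proof -
    define \<tau> where "\<tau> = min (min \<tau>0 (1/2)) (e / 2)"
    have \<tau>: "0 < \<tau>" "\<tau> \<le> \<tau>0" "\<tau> < 1" "2 * \<tau> \<le> e" using \<tau>0(1) e by (auto simp: \<tau>_def)
    have "(\<lambda>k. 8 * C * B0 * (3/4) ^ k) \<longlonglongrightarrow> 8 * C * B0 * 0"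
      by (intro tendsto_intros LIMSEQ_power_zero) simp
    then have "\<forall>\<^sub>F k in sequentially. 8 * C * B0 * (3/4) ^ k < \<tau>" using \<tau> by (intro order_tendstoD) auto
    then obtain k where "8 * C * B0 * (3/4) ^ k < \<tau>" by (auto simp: eventually_sequentially)
    then have k: "8 * C * B0 * (3/4) ^ k \<le> \<tau>" by simp
    define L where "L = int k * N + 1"
    obtain \<theta> \<Phi> where "ds \<theta> \<Phi>" and ng: "\<not> gr L \<Phi>" using neg' by blast
    then have \<Phi>: "\<And>j. Lop (V \<theta>) \<Phi> j = 0" "\<Phi> (- 1) = 0" "\<Phi> 0 = 1" unfolding ds_def by auto
    have nb: "\<exists>i. 0 \<le> i \<and> i \<le> N \<and> \<not> 2 * cmod (\<Phi> i) \<le> cmod (\<Phi> j)" if "0 \<le> j" "j \<le> L" for j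
      using ng that unfolding gr_def by blast
    interpret h: hyperbolic "V \<theta>" N C "\<bar>lam\<bar> + 1" by (rule hyperbolic_0)
    have \<Phi>Q: "cmod (\<Phi> i) \<le> Q" if "0 \<le> i" "i \<le> N" for i
      unfolding Q_def
      by (rule growth_both[where V = "V \<theta>" and c = "-1" and lo = 0 and hi = N, OF h.V_bound])
        (use \<Phi> that N_ge_1 in auto)
    have bd: "cmod (\<Phi> j) \<le> B0" if jj: "0 \<le> j" "j \<le> int k * N + 1" for j
    proof -
      obtain i where "0 \<le> i" "i \<le> N" "\<not> 2 * cmod (\<Phi> i) \<le> cmod (\<Phi> j)" using nb[of j] jj unfolding L_def by blast
      then show ?thesis using \<Phi>Q[of i] unfolding B0_def by linarith
    qed
    obtain M where M: "\<And>m. M \<le> m \<Longrightarrow> \<exists>k0. \<forall>j. 0 \<le> j \<longrightarrow> j < int (nat (L + 1)) \<longrightarrow> sturm_v (cf_approx \<alpha> m) 0 (k0 + j) = sturm_v \<alpha> \<theta> j"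
      using sturmian_window_in_approx[of "nat (L + 1)"] by blast
    have L0: "0 \<le> L" using N_ge_1 by (simp add: L_def)
    show ?thesis
    proof (rule eventually_sequentiallyI[of "max M (max M0 2)"])
      fix m assume m: "max M (max M0 2) \<le> m"
      have mm: "M \<le> m" "M0 \<le> m" "2 \<le> m" using m by auto
      obtain k0 where k0': "\<And>j. 0 \<le> j \<Longrightarrow> j < int (nat (L + 1)) \<Longrightarrow> sturm_v (cf_approx \<alpha> m) 0 (k0 + j) = sturm_v \<alpha> \<theta> j"
        using M[OF mm(1)] by blast
      have k0: "sturm_v (cf_approx \<alpha> m) 0 (k0 + j) = sturm_v \<alpha> \<theta> j" if "0 \<le> j" "j \<le> int k * N + 1" for j
        using k0'[of j] that L0 unfolding L_def by simp
      have "\<exists>E::real. \<bar>E\<bar> \<le> 2 * \<tau> \<and> complex_of_real E \<in> G_set lam \<alpha> m"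
        by (rule bounded_dirichlet_imp_G[OF \<tau>0(2) less_imp_le[OF \<tau>(1)] \<tau>(2,3) k, where \<theta> = \<theta> and \<Phi> = \<Phi> and ?k0.0 = k0])
          (fact \<Phi> bd mm k0)+
      then obtain E :: real where E: "\<bar>E\<bar> \<le> 2 * \<tau>" "complex_of_real E \<in> G_set lam \<alpha> m" by blast
      have "dist0_G lam \<alpha> m \<le> ereal (cmod (complex_of_real E))"
        unfolding dist0_G_def by (rule INF_lower[OF E(2)])
      also have "\<dots> \<le> ereal e" using E(1) \<tau>(4) by simp
      finally show "dist0_G lam \<alpha> m \<le> ereal e" .
    qed
  qed
  have le: "liminf (\<lambda>m. dist0_G lam \<alpha> m) \<le> ereal e" if "0 < e" for e
  proof -
    have "liminf (\<lambda>m. dist0_G lam \<alpha> m) \<le> limsup (\<lambda>m. dist0_G lam \<alpha> m)" by (rule Liminf_le_Limsup) simp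
    also have "\<dots> \<le> ereal e" by (rule Limsup_bounded[OF small[OF that]])
    finally show ?thesis .
  qed
  have "liminf (\<lambda>m. dist0_G lam \<alpha> m) \<le> 0"
  proof (rule ccontr)
    assume "\<not> ?thesis"
    then obtain e where "0 < ereal e" "ereal e < liminf (\<lambda>m. dist0_G lam \<alpha> m)"
      using ereal_dense2[of 0 "liminf (\<lambda>m. dist0_G lam \<alpha> m)"] by (auto simp: not_le)
    then show False using le[of e] by simp
  qed
  moreover have "0 \<le> liminf (\<lambda>m. dist0_G lam \<alpha> m)"
    by (intro Liminf_bounded always_eventually allI dist0_G_nonneg)
  ultimately show False using assms by (simp add: antisym)
qed

text \<open>A sequence vanishing at \<open>- 1\<close> is \<open>x 0\<close> times the Dirichlet
  solution up to an error \<open>Q * \<eta>\<close>. As that solution doubles further inside, its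
  values in the strip are at most half of one that \<open>B\<close> controls.\<close>

lemma boundary_ineq:
  assumes "liminf (\<lambda>m. dist0_G lam \<alpha> m) \<noteq> 0"
  shows "\<exists>L C'. N \<le> L \<and> 1 \<le> C' \<and> (\<forall>\<theta> x \<eta> B. x (- 1) = 0 \<longrightarrow>
    (\<forall>j. 0 \<le> j \<longrightarrow> j \<le> L \<longrightarrow> cmod (Lop (V \<theta>) x j) \<le> \<eta> \<and> cmod (x j) \<le> B) \<longrightarrow>
    (\<forall>i. 0 \<le> i \<longrightarrow> i \<le> N \<longrightarrow> cmod (x i) \<le> 1/2 * B + C' * \<eta>))"
proof -
  obtain L1 where L1: "\<And>\<theta> \<Phi>. (\<forall>j. Lop (V \<theta>) \<Phi> j = 0) \<Longrightarrow> \<Phi> (- 1) = 0 \<Longrightarrow> \<Phi> 0 = 1 \<Longrightarrow>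
    (\<exists>j. 0 \<le> j \<and> j \<le> L1 \<and> (\<forall>i. 0 \<le> i \<longrightarrow> i \<le> N \<longrightarrow> 2 * cmod (\<Phi> i) \<le> cmod (\<Phi> j)))"
    using dirichlet_growth[OF assms] by blast
  define L where "L = max L1 N"
  have L: "\<exists>j. 0 \<le> j \<and> j \<le> L \<and> (\<forall>i. 0 \<le> i \<longrightarrow> i \<le> N \<longrightarrow> 2 * cmod (\<Phi> i) \<le> cmod (\<Phi> j))"
    if "\<forall>j. Lop (V \<theta>) \<Phi> j = 0" "\<Phi> (- 1) = 0" "\<Phi> 0 = 1" for \<theta> \<Phi>
    using L1[OF that] unfolding L_def by (meson max.coboundedI1)
  have L0: "0 \<le> L" "N \<le> L" using N_ge_1 by (auto simp: L_def)
  define Q where "Q = (\<bar>lam\<bar> + 1 + 2) ^ nat (L - 0 + 2)"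
  have Q1: "1 \<le> Q" by (simp add: Q_def)
  have "cmod (x i) \<le> 1/2 * B + 2 * Q * \<eta>"
    if x1: "x (- 1) = 0" and h: "\<forall>j. 0 \<le> j \<longrightarrow> j \<le> L \<longrightarrow> cmod (Lop (V \<theta>) x j) \<le> \<eta> \<and> cmod (x j) \<le> B"
      and i: "0 \<le> i" "i \<le> N" for \<theta> x \<eta> B i
  proof -
    interpret h: hyperbolic "V \<theta>" N C "\<bar>lam\<bar> + 1" by (rule hyperbolic_0)
    have "cmod (Lop (V \<theta>) x 0) \<le> \<eta>" using h L0 by blast
    then have \<eta>0: "0 \<le> \<eta>" using norm_ge_zero order_trans by blast
    obtain \<Phi> where \<Phi>: "\<forall>j. Lop (V \<theta>) \<Phi> j = 0" "\<Phi> (- 1) = 0" "\<Phi> 0 = 1" using sol_exists[of "V \<theta>" "-1" 0 1] by auto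
    obtain j where j: "0 \<le> j" "j \<le> L" "2 * cmod (\<Phi> i) \<le> cmod (\<Phi> j)" using L[OF \<Phi>] i by blast
    have d: "cmod (x k - x 0 * \<Phi> k) \<le> Q * \<eta>" if "0 \<le> k" "k \<le> L" for k
      unfolding Q_def
      by (rule growth_both[where V = "V \<theta>" and c = "-1" and lo = 0 and hi = L and x = "\<lambda>k. x k - x 0 * \<Phi> k", OF h.V_bound])
        (use \<Phi> that h x1 \<eta>0 L0 in \<open>auto simp: Lop_diff Lop_scale\<close>)
    have "cmod (x i) \<le> cmod (x 0 * \<Phi> i) + cmod (x i - x 0 * \<Phi> i)" by (metis norm_triangle_sub add.commute)
    also have "cmod (x 0 * \<Phi> i) \<le> 1/2 * cmod (x 0 * \<Phi> j)"
      unfolding norm_mult using mult_left_mono[OF j(3), of "cmod (x 0)"] by simp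
    also have "cmod (x 0 * \<Phi> j) \<le> cmod (x j) + cmod (x j - x 0 * \<Phi> j)"
      by (metis norm_minus_commute norm_triangle_sub)
    also have "cmod (x j) \<le> B" using h j by blast
    finally have "cmod (x i) \<le> 1/2 * (B + cmod (x j - x 0 * \<Phi> j)) + cmod (x i - x 0 * \<Phi> i)" by simp
    moreover have "cmod (x i - x 0 * \<Phi> i) \<le> Q * \<eta>" using d[of i] i L0 by simp
    moreover have "0 \<le> Q * \<eta>" using Q1 \<eta>0 by simp
    moreover have "2 * Q * \<eta> = 2 * (Q * \<eta>)" by simp
    ultimately show ?thesis using d[OF j(1,2)] unfolding distrib_left by linarith
  qed
  then show ?thesis using L0 Q1 by (intro exI[of _ L] exI[of _ "2 * Q"]) auto
qed

text \<open>Within \<open>N\<close> of an end the inequality for the whole line would reach outside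
  the window, and \<open>boundary_ineq\<close> takes over: at the left end after a change of phase,
  at the right end through \<open>sturm_v_reflect\<close>.\<close>

lemma fsec_loc_ineq:
  assumes "liminf (\<lambda>m. dist0_G lam \<alpha> m) \<noteq> 0"
  shows "\<exists>N2 C2 n0. 1 \<le> N2 \<and> 1 \<le> C2 \<and> (\<forall>n\<ge>n0. \<forall>x y. fsec_sol (V \<theta>) n y x \<longrightarrow> loc_ineq (3/4) N2 C2 x y)"
proof -
  obtain L C' where L: "N \<le> L" and C': "1 \<le> C'" and bi: "\<And>\<theta> x \<eta> B i. x (- 1) = 0 \<Longrightarrow>
    (\<forall>j. 0 \<le> j \<longrightarrow> j \<le> L \<longrightarrow> cmod (Lop (V \<theta>) x j) \<le> \<eta> \<and> cmod (x j) \<le> B) \<Longrightarrow>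
    0 \<le> i \<Longrightarrow> i \<le> N \<Longrightarrow> cmod (x i) \<le> 1/2 * B + C' * \<eta>"
    using boundary_ineq[OF assms] by blast
  \<comment> \<open>A place within \<open>N\<close> of an end must see the stretch of length
    \<open>L\<close> that starts at this end.\<close>
  define N2 where "N2 = L + N"
  define C2 where "C2 = max C C'"
  define n0 where "n0 = nat (L + N)"
  have C2: "1 \<le> C2" "C \<le> C2" "C' \<le> C2" using C_ge_1 by (auto simp: C2_def)
  have "loc_ineq (3/4) N2 C2 x y" if n: "n0 \<le> n" and s: "fsec_sol (V \<theta>) n y x" for n x y
    unfolding loc_ineq_def
  proof (intro allI impI)
    fix i \<eta> B assume h: "\<forall>j. \<bar>j - i\<bar> \<le> N2 \<longrightarrow> cmod (y j) \<le> \<eta> \<and> cmod (x j) \<le> B"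
    have N20: "0 \<le> N2" using L N_ge_1 by (simp add: N2_def)
    have "cmod (y i) \<le> \<eta>" "cmod (x i) \<le> B" using h N20 by auto
    then have \<eta>0: "0 \<le> \<eta>" and B0: "0 \<le> B" using norm_ge_zero order_trans by blast+
    have nL: "L + N \<le> int n" using n L N_ge_1 by (simp add: n0_def)
    have x0: "x j = 0" if "int n < \<bar>j\<bar>" for j using s that by (simp add: fsec_sol_def)
    have Lx: "Lop (V \<theta>) x j = y j" if "\<bar>j\<bar> \<le> int n" for j using s that by (simp add: fsec_sol_def)
    have fin: "cmod (x i) \<le> 3/4 * B + C2 * \<eta>" if "cmod (x i) \<le> 1/2 * B + C' * \<eta>"
    proof -
      have "C' * \<eta> \<le> C2 * \<eta>" using C2 \<eta>0 by (intro mult_right_mono)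
      then show ?thesis using that B0 by simp
    qed
    consider "int n < \<bar>i\<bar>" | "\<bar>i\<bar> \<le> int n - N" | "\<bar>i\<bar> \<le> int n" "i < - int n + N" | "\<bar>i\<bar> \<le> int n" "int n - N < i"
      by linarith
    then show "cmod (x i) \<le> 3/4 * B + C2 * \<eta>"
    proof cases
      case 1
      then show ?thesis using x0[of i] B0 \<eta>0 C2 by simp
    next
      case 2
      interpret h: hyperbolic "V \<theta>" N C "\<bar>lam\<bar> + 1" by (rule hyperbolic_0)
      have "cmod (Lop (V \<theta>) x j) \<le> \<eta> \<and> cmod (x j) \<le> B" if "\<bar>j - i\<bar> \<le> N" for j
      proof -
        have "\<bar>j\<bar> \<le> int n" "\<bar>j - i\<bar> \<le> N2" using that 2 L N_ge_1 by (auto simp: N2_def)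
        then show ?thesis using h Lx by simp
      qed
      then have "cmod (x i) \<le> 3/4 * B + C * \<eta>" using h.loc[of x] unfolding loc_ineq_def by blast
      moreover have "C * \<eta> \<le> C2 * \<eta>" using C2 \<eta>0 by (intro mult_right_mono)
      ultimately show ?thesis by linarith
    next
      case 3
      define x' where "x' j = x (j + - int n)" for j
      have e: "Lop (V (\<theta> + of_int (- int n) * \<alpha>)) x' j = Lop (V \<theta>) x (j + - int n)" for j
      proof -
        have "V (\<theta> + of_int (- int n) * \<alpha>) = (\<lambda>j. V \<theta> (j + - int n))"
          using pot_add[of lam \<alpha> \<theta> "- int n"] by (metis add.commute)
        then show ?thesis unfolding x'_def using Lop_shift[of "V \<theta>" "- int n" x j] by simp
      qed
      have "cmod (x' (i + int n)) \<le> 1/2 * B + C' * \<eta>"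
      proof (rule bi[of x' "\<theta> + of_int (- int n) * \<alpha>"])
        show "x' (- 1) = 0" using x0 by (simp add: x'_def)
        show "\<forall>j. 0 \<le> j \<longrightarrow> j \<le> L \<longrightarrow> cmod (Lop (V (\<theta> + of_int (- int n) * \<alpha>)) x' j) \<le> \<eta> \<and> cmod (x' j) \<le> B"
        proof (intro allI impI)
          fix j assume j: "0 \<le> j" "j \<le> L"
          have "\<bar>j + - int n\<bar> \<le> int n" "\<bar>j + - int n - i\<bar> \<le> N2" using j 3 nL N_ge_1 by (auto simp: N2_def)
          then show "cmod (Lop (V (\<theta> + of_int (- int n) * \<alpha>)) x' j) \<le> \<eta> \<and> cmod (x' j) \<le> B"
            unfolding e x'_def using h Lx by simp
        qed
      qed (use 3 in auto)
      then show ?thesis by (intro fin) (simp add: x'_def)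
    next
      case 4
      obtain \<phi> where \<phi>: "\<And>j. 0 \<le> j \<Longrightarrow> j \<le> int (nat L) \<Longrightarrow> sturm_v \<alpha> (\<theta> + of_int (int n) * \<alpha>) (- j) = sturm_v \<alpha> \<phi> j"
        using sturm_v_reflect by blast
      define x' where "x' j = x (int n - j)" for j
      have e: "Lop (V \<phi>) x' j = Lop (V \<theta>) x (int n - j)" if "0 \<le> j" "j \<le> L" for j
      proof -
        have "V \<phi> j = V \<theta> (int n - j)"
          using \<phi>[of j] that sturm_v_add[of \<alpha> \<theta> "int n" "- j"] by (simp add: pot_def)
        then show ?thesis by (simp add: Lop_def x'_def algebra_simps)
      qed
      have "cmod (x' (int n - i)) \<le> 1/2 * B + C' * \<eta>"
      proof (rule bi[of x' \<phi>])
        show "x' (- 1) = 0" using x0 by (simp add: x'_def)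
        show "\<forall>j. 0 \<le> j \<longrightarrow> j \<le> L \<longrightarrow> cmod (Lop (V \<phi>) x' j) \<le> \<eta> \<and> cmod (x' j) \<le> B"
        proof (intro allI impI)
          fix j assume j: "0 \<le> j" "j \<le> L"
          have "\<bar>int n - j\<bar> \<le> int n" "\<bar>int n - j - i\<bar> \<le> N2" using j 4 nL N_ge_1 by (auto simp: N2_def)
          then show "cmod (Lop (V \<phi>) x' j) \<le> \<eta> \<and> cmod (x' j) \<le> B"
            unfolding e[OF j] x'_def using h Lx by simp
        qed
      qed (use 4 in auto)
      then show ?thesis by (intro fin) (simp add: x'_def)
    qed
  qed
  moreover have "1 \<le> N2" using L N_ge_1 by (simp add: N2_def)
  ultimately show ?thesis using C2(1) by blast
qed

end

section \<open>Strong convergence\<close>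

lemma finite_support_bounded:
  fixes x :: "int \<Rightarrow> complex"
  assumes "\<And>i. int n < \<bar>i\<bar> \<Longrightarrow> x i = 0"
  shows "\<exists>B\<ge>0. \<forall>i. cmod (x i) \<le> B"
proof (intro exI conjI allI)
  let ?B = "\<Sum>i\<in>{- int n..int n}. cmod (x i)"
  show "0 \<le> ?B" by (intro sum_nonneg) auto
  fix i
  show "cmod (x i) \<le> ?B"
  proof (cases "\<bar>i\<bar> \<le> int n")
    case True
    then show ?thesis by (intro member_le_sum) auto
  next
    case False
    then show ?thesis using assms[of i] by (simp add: sum_nonneg)
  qed
qed

lemma finite_support_lp:
  assumes "1 \<le> p" "\<And>i. int n < \<bar>i\<bar> \<Longrightarrow> x i = 0"
  shows "x \<in> lp_space p"
proof -
  obtain B where B: "0 \<le> B" "\<And>i. cmod (x i) \<le> B" using finite_support_bounded[of n x] assms(2) by blast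
  have "lpb p x (real (card {- int n..int n}) * B)"
    using B assms by (intro lpb_finite_support) auto
  then show ?thesis using lpb_iff[OF assms(1)] B by (metis mult_nonneg_nonneg of_nat_0_le_iff)
qed

lemma fsec_sol_proj: "fsec_sol V n (proj n y) x \<longleftrightarrow> fsec_sol V n y x"
  by (auto simp: fsec_sol_def proj_def)

lemma lpb_proj: "1 \<le> p \<Longrightarrow> lpb p y b \<Longrightarrow> lpb p (proj n y) b"
  by (rule lpb_mono) (auto simp: proj_def)

lemma lpb_bounded: "1 \<le> p \<Longrightarrow> lpb p y b \<Longrightarrow> 0 \<le> b \<Longrightarrow> lpb \<infinity> y b"
  using lpb_coord[of p b y] by (simp add: lpb_def)

lemma geometric_eventually_small:
  fixes a e :: real
  assumes "0 < e"
  shows "\<exists>k. (3/4) ^ k * a \<le> e"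
proof -
  have "(\<lambda>k. (3/4) ^ k * a) \<longlonglongrightarrow> 0 * a" by (intro tendsto_intros LIMSEQ_power_zero) simp
  then have "\<forall>\<^sub>F k in sequentially. (3/4) ^ k * a < e" using assms by (intro order_tendstoD) auto
  then obtain k where "(3/4) ^ k * a < e" by (auto simp: eventually_sequentially)
  then show ?thesis by (intro exI[of _ k]) simp
qed

text \<open>The inverse is constructed as the coordinatewise limit of the section solutions. Two of
  these with the same right-hand side differ by a solution of the homogeneous equation on the
  smaller window, which is small far from its ends.\<close>

lemma (in hyperbolic) fsm_of_loc_ineq:
  assumes p: "1 \<le> p" and N2: "1 \<le> N2" and C2: "1 \<le> C2"
    and LI: "\<And>n x y. n0 \<le> n \<Longrightarrow> fsec_sol V n y x \<Longrightarrow> loc_ineq (3/4) N2 C2 x y"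
  shows "fsm_applicable p (Lop V)"
proof -
  obtain K where K0: "0 \<le> K" and K: "\<And>p x y b. 1 \<le> p \<Longrightarrow> loc_ineq (3/4) N2 C2 x y \<Longrightarrow> x \<in> lp_space p \<Longrightarrow> lpb p y b \<Longrightarrow> 0 \<le> b \<Longrightarrow> lpb p x (K * b)"
    using loc_ineq_lp[OF N2 C2] by blast
  have supp: "x i = 0" if "fsec_sol V n y x" "int n < \<bar>i\<bar>" for n x y i using that by (simp add: fsec_sol_def)
  have inv: "fsec_invertible (Lop V) n" if n: "n0 \<le> n" for n
    unfolding fsec_invertible_iff
  proof (intro allI impI)
    fix x assume x: "fsec_sol V n (\<lambda>_. 0) x"
    obtain B where B: "\<And>i. cmod (x i) \<le> B" using finite_support_bounded[of n x] supp[OF x] by blast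
    have "cmod (x i) \<le> 4 * C2 * 0" for i
      using loc_ineq_bound[OF LI[OF n x], of B 0 i] B N2 C2 by simp
    then show "x = (\<lambda>_. 0)" by auto
  qed

  \<comment> \<open>Section solutions and their limit\<close>
  define R where "R n y = fsec_inv (Lop V) n y" for n y
  have Rs: "fsec_sol V n y (R n y)" if "n0 \<le> n" for n y
    unfolding R_def by (rule fsec_inv_sol[OF inv[OF that]])
  have solb: "lpb p' x (K * b)" if n: "n0 \<le> n" and s: "fsec_sol V n y x" and p': "1 \<le> p'" and y: "lpb p' y b" "0 \<le> b" for p' n x y b
  proof (rule K[OF p'])
    have "fsec_sol V n (proj n y) x" using s by (simp add: fsec_sol_proj)
    then show "loc_ineq (3/4) N2 C2 x (proj n y)" by (rule LI[OF n])
    show "x \<in> lp_space p'" using finite_support_lp[OF p'] supp[OF s] by blast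
    show "lpb p' (proj n y) b" by (rule lpb_proj[OF p' y(1)])
  qed (rule y(2))
  have i1: "1 \<le> (\<infinity>::ereal)" by simp
  have bddR: "cmod (R n y i) \<le> K * b" if "n0 \<le> n" "lpb \<infinity> y b" "0 \<le> b" for n y b i
    using solb[OF that(1) Rs[OF that(1)] i1 that(2,3)] by (simp add: lpb_def)
  have diff: "cmod (R n y i - R n' y i) \<le> (3/4) ^ k * (2 * (K * b))"
    if n: "n0 \<le> n" "n \<le> n'" and y: "lpb \<infinity> y b" "0 \<le> b" and i: "\<bar>i\<bar> + int k * N \<le> int n" for n n' y b i k
  proof (rule decay)
    fix j assume "\<bar>j - i\<bar> \<le> int k * N"
    then have j: "\<bar>j\<bar> \<le> int n" "\<bar>j\<bar> \<le> int n'" using i n by linarith+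
    have n': "n0 \<le> n'" using n by simp
    have "Lop V (R n y) j = y j" "Lop V (R n' y) j = y j" using Rs[OF n(1), of y] Rs[OF n', of y] j by (auto simp: fsec_sol_def)
    moreover have "cmod (R n y j - R n' y j) \<le> K * b + K * b"
      using norm_triangle_ineq4[of "R n y j" "R n' y j"] bddR[OF n(1) y, of j] bddR[OF n' y, of j] by linarith
    ultimately show "Lop V (\<lambda>i. R n y i - R n' y i) j = 0 \<and> cmod (R n y j - R n' y j) \<le> 2 * (K * b)"
      by (simp add: Lop_diff)
  qed
  \<comment> \<open>Defined without reference to \<open>p\<close>: every \<open>l^p\<close> sequence
    is bounded, so the limit exists and serves all \<open>p\<close>.\<close>
  define B where "B y i = lim (\<lambda>n. R n y i)" for y i
  have tend: "(\<lambda>n. R n y i) \<longlonglongrightarrow> B y i" if y: "lpb \<infinity> y b" "0 \<le> b" for y b i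
  proof -
    have "Cauchy (\<lambda>n. R n y i)"
    proof (rule CauchyI)
      fix e :: real assume e: "0 < e"
      obtain k where k: "(3/4) ^ k * (2 * (K * b)) \<le> e / 4" using geometric_eventually_small[of "e / 4" "2 * (K * b)"] e by auto
      define n1 where "n1 = max n0 (nat (\<bar>i\<bar> + int k * N))"
      have n1: "n0 \<le> n1" "\<bar>i\<bar> + int k * N \<le> int n1" by (auto simp: n1_def)
      show "\<exists>M. \<forall>m\<ge>M. \<forall>n\<ge>M. norm (R m y i - R n y i) < e"
      proof (intro exI[of _ n1] allI impI)
        fix m n assume mn: "n1 \<le> m" "n1 \<le> n"
        have "cmod (R n1 y i - R m y i) \<le> e / 4" "cmod (R n1 y i - R n y i) \<le> e / 4"
          using diff[OF n1(1) mn(1) y n1(2)] diff[OF n1(1) mn(2) y n1(2)] k by linarith+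
        moreover have "R m y i - R n y i = (R n1 y i - R n y i) - (R n1 y i - R m y i)" by simp
        then have "cmod (R m y i - R n y i) \<le> cmod (R n1 y i - R n y i) + cmod (R n1 y i - R m y i)"
          by (metis norm_triangle_ineq4)
        ultimately show "norm (R m y i - R n y i) < e" using e by linarith
      qed
    qed
    then show ?thesis unfolding B_def using Cauchy_convergent_iff convergent_LIMSEQ_iff by blast
  qed
  have est: "cmod (R n y i - B y i) \<le> (3/4) ^ k * (2 * (K * b))"
    if n: "n0 \<le> n" and y: "lpb \<infinity> y b" "0 \<le> b" and i: "\<bar>i\<bar> + int k * N \<le> int n" for n y b i k
  proof (rule tendsto_upperbound)
    show "(\<lambda>n'. cmod (R n y i - R n' y i)) \<longlonglongrightarrow> cmod (R n y i - B y i)"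
      by (intro tendsto_intros tend[OF y])
    show "\<forall>\<^sub>F n' in sequentially. cmod (R n y i - R n' y i) \<le> (3/4) ^ k * (2 * (K * b))"
      using diff[OF n _ y i] by (intro eventually_sequentiallyI[of n]) blast
  qed simp
  have LB: "Lop V (B y) i = y i" if y: "lpb \<infinity> y b" "0 \<le> b" for y b i
  proof (rule LIMSEQ_unique)
    show "(\<lambda>n. Lop V (R n y) i) \<longlonglongrightarrow> Lop V (B y) i"
      unfolding Lop_def by (intro tendsto_intros tend[OF y])
    show "(\<lambda>n. Lop V (R n y) i) \<longlonglongrightarrow> y i"
    proof (rule tendsto_eventually, rule eventually_sequentiallyI[of "max n0 (nat \<bar>i\<bar>)"])
      fix n assume "max n0 (nat \<bar>i\<bar>) \<le> n"
      then have "n0 \<le> n" "\<bar>i\<bar> \<le> int n" by auto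
      then show "Lop V (R n y) i = y i" using Rs[of n y] by (simp add: fsec_sol_def)
    qed
  qed
  have Bb: "lpb p' (B y) (K * b)" if p': "1 \<le> p'" and y: "lpb p' y b" "0 \<le> b" for p' y b
  proof (rule lpb_limit[OF p'])
    show "0 \<le> K * b" using K0 y by simp
    show "\<forall>\<^sub>F n in sequentially. lpb p' (R n y) (K * b)"
      by (rule eventually_sequentiallyI[of n0]) (rule solb[OF _ Rs p' y], auto)
    show "(\<lambda>n. R n y i) \<longlonglongrightarrow> B y i" for i by (rule tend[OF lpb_bounded[OF p' y] y(2)])
  qed
  define K' where "K' = K * (2 + Vb) + 1"
  have K'0: "0 < K'" using K0 Vb_nonneg by (simp add: K'_def add_nonneg_pos)
  \<comment> \<open>On the window, \<open>R n y\<close> minus the truncation of \<open>B y\<close>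
    is a section solution whose right-hand side comes from the tail of \<open>B y\<close> only.
    Convergence thus reduces to small tails.\<close>
  have conv: "lpb p' (\<lambda>i. R n y i - B y i) (K' * e)"
    if n: "n0 \<le> n" and p': "1 \<le> p'" and y: "lpb \<infinity> y b" "0 \<le> b"
      and t: "lpb p' (\<lambda>i. B y i - proj n (B y) i) e" "0 \<le> e" for p' n y b e
  proof -
    define w where "w i = B y i - proj n (B y) i" for i
    define x where "x i = R n y i - proj n (B y) i" for i
    have tw: "lpb p' w e" using t(1) unfolding w_def[abs_def] .
    have Lw: "lpb p' (Lop V w) (2 * e + Vb * e)" using Lop_lpb[OF p' tw t(2) V_bound Vb_nonneg] .
    have "fsec_sol V n (Lop V w) x"
      unfolding fsec_sol_def
    proof (intro conjI allI impI)
      fix i assume "int n < \<bar>i\<bar>"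
      then show "x i = 0" using supp[OF Rs[OF n]] by (simp add: x_def proj_def)
    next
      fix i assume i: "\<bar>i\<bar> \<le> int n"
      have "Lop V (R n y) i = Lop V (B y) i" using Rs[OF n, of y] i LB[OF y, of i] by (simp add: fsec_sol_def)
      then show "Lop V x i = Lop V w i" by (simp add: x_def[abs_def] w_def[abs_def] Lop_diff)
    qed
    then have xb: "lpb p' x (K * (2 * e + Vb * e))" using t(2) Vb_nonneg by (intro solb[OF n _ p' Lw]) auto
    have wm: "lpb p' (\<lambda>i. (-1) * w i) (1 * e)" using lpb_scale[OF p' tw t(2), of "-1"] by simp
    have "lpb p' (\<lambda>i. x i + (-1) * w i) (K * (2 * e + Vb * e) + 1 * e)"
      using K0 t(2) Vb_nonneg by (intro lpb_add[OF p' xb _ wm]) auto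
    moreover have "(\<lambda>i. x i + (-1) * w i) = (\<lambda>i. R n y i - B y i)" by (auto simp: x_def w_def)
    moreover have "K * (2 * e + Vb * e) + 1 * e = K' * e" by (simp add: K'_def algebra_simps)
    ultimately show ?thesis by simp
  qed

  \<comment> \<open>The limit is the inverse\<close>
  have inverse: "is_inverse_on p (Lop V) B"
    unfolding is_inverse_on_def
  proof (intro conjI ballI exI[of _ K])
    fix x assume x: "x \<in> lp_space p"
    define b where "b = lp_norm p x"
    have b: "0 \<le> b" "lpb p x b" using lpb_lp_norm[OF p x] by (auto simp: b_def)
    have Kb: "0 \<le> K * b" using K0 b by simp
    show "B x \<in> lp_space p" "lp_norm p (B x) \<le> K * lp_norm p x"
      using Bb[OF p b(2,1)] lpb_iff[OF p Kb] by (auto simp: b_def)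
    have xi: "lpb \<infinity> x b" by (rule lpb_bounded[OF p b(2,1)])
    show "Lop V (B x) = x" using LB[OF xi b(1)] by auto
    have yi: "lpb \<infinity> (Lop V x) (2 * b + Vb * b)" using Lop_lpb[OF i1 xi b(1) V_bound Vb_nonneg] .
    have y0: "0 \<le> 2 * b + Vb * b" using b Vb_nonneg by simp
    \<comment> \<open>The difference is bounded and annihilated by \<open>Lop V\<close>, so
      \<open>global_bound\<close> makes it zero.\<close>
    have "cmod (B (Lop V x) i - x i) \<le> 4 * C * 0" for i
    proof (rule global_bound[where x = "\<lambda>i. B (Lop V x) i - x i" and B = "K * (2 * b + Vb * b) + b"])
      fix j
      have "cmod (B (Lop V x) j) \<le> K * (2 * b + Vb * b)" using Bb[OF i1 yi y0] by (simp add: lpb_def)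
      moreover have "cmod (x j) \<le> b" using xi by (simp add: lpb_def)
      ultimately show "cmod (B (Lop V x) j - x j) \<le> K * (2 * b + Vb * b) + b"
        using norm_triangle_ineq4[of "B (Lop V x) j" "x j"] by linarith
      show "cmod (Lop V (\<lambda>i. B (Lop V x) i - x i) j) \<le> 0" unfolding Lop_diff LB[OF yi y0] by simp
    qed
    then show "B (Lop V x) = x" by auto
  qed

  \<comment> \<open>Strong convergence\<close>
  have "strong_conv p R B"
  proof (cases "p = \<infinity>")
    case False
    have "(\<lambda>n. lp_norm p (\<lambda>i. R n x i - B x i)) \<longlonglongrightarrow> 0" if x: "x \<in> lp_space p" for x
    proof (rule LIMSEQ_I)
      fix r :: real assume r: "0 < r"
      define b where "b = lp_norm p x"
      have b: "0 \<le> b" "lpb p x b" using lpb_lp_norm[OF p x] by (auto simp: b_def)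
      have xi: "lpb \<infinity> x b" by (rule lpb_bounded[OF p b(2,1)])
      have Bx: "B x \<in> lp_space p" using inverse x by (simp add: is_inverse_on_def)
      define e where "e = r / (2 * K')"
      have e: "0 < e" using r K'0 by (simp add: e_def)
      obtain n1 where n1: "\<And>n. n1 \<le> n \<Longrightarrow> lpb p (\<lambda>i. B x i - proj n (B x) i) e" using lp_tail[OF p False Bx e] by blast
      show "\<exists>no. \<forall>n\<ge>no. norm (lp_norm p (\<lambda>i. R n x i - B x i) - 0) < r"
      proof (intro exI[of _ "max n0 n1"] allI impI)
        fix n assume "max n0 n1 \<le> n"
        then have "lpb p (\<lambda>i. R n x i - B x i) (K' * e)" using n1 e by (intro conv[OF _ p xi b(1)]) auto
        moreover have "0 \<le> K' * e" using K'0 e by simp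
        ultimately have l: "(\<lambda>i. R n x i - B x i) \<in> lp_space p" "lp_norm p (\<lambda>i. R n x i - B x i) \<le> K' * e"
          using lpb_iff[OF p] by blast+
        moreover have "0 \<le> lp_norm p (\<lambda>i. R n x i - B x i)" using lpb_lp_norm[OF p l(1)] by blast
        moreover have "K' * e < r" using K'0 r by (simp add: e_def)
        ultimately show "norm (lp_norm p (\<lambda>i. R n x i - B x i) - 0) < r" by simp
      qed
    qed
    then show ?thesis using False by (simp add: strong_conv_def)
  next
    case True
    have "\<forall>\<^sub>F n in sequentially. \<forall>x\<in>lp_space p. lp_norm p x \<le> 1 \<longrightarrow>
        lp_norm p (proj k (\<lambda>i. R n x i - B x i)) \<le> e \<and> lp_norm p (\<lambda>i. R n (proj k x) i - B (proj k x) i) \<le> e"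
      if e: "0 < e" for k e
    proof -
      define e1 where "e1 = min e (e / K')"
      have e1: "0 < e1" "e1 \<le> e" "K' * e1 \<le> e"
        using e K'0 by (auto simp: e1_def min_def field_simps)
      obtain l where l: "(3/4) ^ l * (2 * (K * 1)) \<le> e1" using geometric_eventually_small[OF e1(1)] by blast
      have lN: "0 \<le> int l * N" using N_pos by simp
      show ?thesis
      proof (rule eventually_sequentiallyI[of "max n0 (nat (int k + int l * N + 1))"])
        fix n assume "max n0 (nat (int k + int l * N + 1)) \<le> n"
        then have n: "n0 \<le> n" "int k + int l * N + 1 \<le> int n" by auto
        show "\<forall>x\<in>lp_space p. lp_norm p x \<le> 1 \<longrightarrow>
          lp_norm p (proj k (\<lambda>i. R n x i - B x i)) \<le> e \<and> lp_norm p (\<lambda>i. R n (proj k x) i - B (proj k x) i) \<le> e"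
        proof (intro ballI impI conjI)
          fix x assume x: "x \<in> lp_space p" "lp_norm p x \<le> 1"
          have xi: "lpb \<infinity> x 1" using lpb_iff[OF p, of 1 x] x True by simp
          have "cmod (proj k (\<lambda>i. R n x i - B x i) i) \<le> e" for i
            using est[OF n(1) xi, of i l] l e1 n e by (auto simp: proj_def)
          then have "lpb p (proj k (\<lambda>i. R n x i - B x i)) e" using True by (simp add: lpb_def)
          then show "lp_norm p (proj k (\<lambda>i. R n x i - B x i)) \<le> e" using lpb_iff[OF p] e by (metis less_imp_le)
          define y where "y = proj k x"
          have yi: "lpb \<infinity> y 1" unfolding y_def by (rule lpb_proj[OF i1 xi])
          have By: "cmod (B y i) \<le> K * 1" for i using Bb[OF i1 yi] by (simp add: lpb_def)
          \<comment> \<open>\<open>y\<close> vanishes outside \<open>[-k, k]\<close>, so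
            \<open>B y\<close> solves the homogeneous equation there and decays.\<close>
          have tail: "cmod (B y i) \<le> e1" if i: "int n < \<bar>i\<bar>" for i
          proof -
            have "cmod (B y i) \<le> (3/4) ^ l * (K * 1)"
            proof (rule decay)
              fix j assume "\<bar>j - i\<bar> \<le> int l * N"
              then have "int k < \<bar>j\<bar>" using i n by linarith
              then show "Lop V (B y) j = 0 \<and> cmod (B y j) \<le> K * 1"
                using LB[OF yi, of j] By by (simp add: y_def proj_def)
            qed
            also have "\<dots> \<le> (3/4) ^ l * (2 * (K * 1))" using K0 by (intro mult_left_mono) auto
            finally show ?thesis using l by simp
          qed
          have "lpb \<infinity> (\<lambda>i. B y i - proj n (B y) i) e1"
            using tail e1 by (auto simp: lpb_def proj_def)
          then have "lpb \<infinity> (\<lambda>i. R n y i - B y i) (K' * e1)"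
            using e1 by (intro conv[OF n(1) i1 yi]) auto
          then have "lpb p (\<lambda>i. R n y i - B y i) (K' * e1)" using True by simp
          moreover have "0 \<le> K' * e1" using K'0 e1 by simp
          ultimately have "lp_norm p (\<lambda>i. R n y i - B y i) \<le> K' * e1" using lpb_iff[OF p] by blast
          then show "lp_norm p (\<lambda>i. R n (proj k x) i - B (proj k x) i) \<le> e" using e1 unfolding y_def by simp
        qed
      qed
    qed
    then show ?thesis using True by (simp add: strong_conv_def)
  qed
  moreover have "R = fsec_inv (Lop V)" by (intro ext) (simp add: R_def)
  ultimately show ?thesis unfolding fsm_applicable_def using inverse inv by blast
qed

lemma (in gapped_sturmian) fsm_sufficient:
  fixes pe :: ereal
  assumes "1 \<le> pe" "liminf (\<lambda>m. dist0_G lam \<alpha> m) \<noteq> 0"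
  shows "fsm_applicable pe (schroedinger lam \<alpha> \<theta>)"
proof -
  interpret h: hyperbolic "V \<theta>" N C "\<bar>lam\<bar> + 1" by (rule hyperbolic_0)
  obtain N2 C2 n0 where "1 \<le> N2" "1 \<le> C2" "\<And>n x y. n0 \<le> n \<Longrightarrow> fsec_sol (V \<theta>) n y x \<Longrightarrow> loc_ineq (3/4) N2 C2 x y"
    using fsec_loc_ineq[OF assms(2), of \<theta>] by blast
  then show ?thesis unfolding schroedinger_Lop by (rule h.fsm_of_loc_ineq[OF assms(1)])
qed

section \<open>Necessity of the gap condition\<close>

lemma wronskian_const:
  assumes "\<And>j. a < j \<Longrightarrow> j \<le> a + int n \<Longrightarrow> Lop V u j = 0" "\<And>j. a < j \<Longrightarrow> j \<le> a + int n \<Longrightarrow> Lop V y j = 0"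
  shows "wronskian u y (a + int n) = wronskian u y a"
  using assms
proof (induction n)
  case (Suc n)
  let ?j = "a + int n + 1"
  have "Lop V u ?j = 0" "Lop V y ?j = 0" using Suc.prems by auto
  then have uy: "u (?j + 1) = - u (a + int n) - V ?j * u ?j" "y (?j + 1) = - y (a + int n) - V ?j * y ?j"
    unfolding Lop_def by (simp_all add: eq_diff_eq eq_neg_iff_add_eq_0 algebra_simps)
  have "wronskian u y ?j = wronskian u y (a + int n)"
    unfolding wronskian_def uy by (simp add: algebra_simps)
  moreover have "wronskian u y (a + int n) = wronskian u y a" using Suc by simp
  moreover have "a + int (Suc n) = ?j" by simp
  ultimately show ?case by (simp only:)
qed simp

lemma amp_step:
  assumes "Lop V y i = 0" "cmod (V i) \<le> Vb"
  shows "amp y (i + 1) \<le> (Vb + 1) * amp y i"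
proof -
  have Vb: "0 \<le> Vb" using assms(2) norm_ge_zero order_trans by blast
  have "y (i + 1) = - y (i - 1) - V i * y i"
    using assms(1) unfolding Lop_def by (simp add: eq_diff_eq eq_neg_iff_add_eq_0 algebra_simps)
  then have "cmod (y (i + 1)) \<le> cmod (y (i - 1)) + cmod (V i) * cmod (y i)"
    using norm_triangle_ineq4[of "- y (i - 1)" "V i * y i"] by (simp add: norm_mult)
  also have "\<dots> \<le> amp y i + Vb * amp y i"
    using amp_ge[of y i] assms(2) Vb by (intro add_mono mult_mono) auto
  finally have "cmod (y (i + 1)) \<le> (Vb + 1) * amp y i" by (simp add: algebra_simps)
  moreover have "cmod (y i) \<le> (Vb + 1) * amp y i"
    using amp_ge(2)[of y i] mult_right_mono[of 1 "Vb + 1" "amp y i"] Vb amp_nonneg[of y i] by simp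
  ultimately show ?thesis by (simp add: amp_def)
qed

text \<open>The decay of \<open>U\<close> over one quasi-period compensates the growth over the next one, because the next
  word repeats the previous one up to a single exchange of two letters.\<close>
lemma (in hyperbolic) quasi_period_bound:
  fixes U \<Phi> a :: "int \<Rightarrow> complex" and Q I :: int
  assumes LU: "\<And>j. Lop V U j = 0" and BU: "\<And>j. 0 \<le> j \<Longrightarrow> cmod (U j) \<le> B" and U0: "U (- 1) = 0" "U 0 = 1"
    and a: "\<And>j. cmod (a j) \<le> Vb" and L\<Phi>: "\<And>j. Lop a \<Phi> j = 0" and \<Phi>0: "\<Phi> (- 1) = 0" "\<Phi> 0 = 1"
    and match: "\<And>j. 0 \<le> j \<Longrightarrow> j \<le> Q - 2 \<Longrightarrow> a j = V j"
    and rep: "\<And>j. 0 \<le> j \<Longrightarrow> j < I \<Longrightarrow> j \<noteq> \<kappa> - 1 \<Longrightarrow> j \<noteq> \<kappa> \<Longrightarrow> a (j + Q) = a j"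
    and QI: "2 \<le> Q" "I \<le> Q - 2" "0 \<le> \<kappa>" and i: "- 1 \<le> i" "i \<le> Q + I"
  shows "cmod (\<Phi> i) \<le> 4 * C * (((Vb + 1) * (4 * C * (2 + 4 * C))) ^ 2 * ((Vb + 1) * (4 * C)) ^ 2 * (Vb + 1))"
proof -
  define C6 where "C6 = (Vb + 1) * (4 * C * (2 + 4 * C))"
  define G where "G = (Vb + 1) * (4 * C)"
  define C7 where "C7 = 4 * C * (C6 ^ 2 * G ^ 2 * (Vb + 1))"
  have V1: "1 \<le> Vb + 1" using Vb_nonneg by simp
  have C4: "1 \<le> 4 * C" using C_ge_1 by simp
  have G1: "1 \<le> G" using mult_mono[OF V1 C4] C_ge_1 Vb_nonneg by (simp add: G_def)
  have C61: "1 \<le> C6"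
  proof -
    have "1 \<le> 4 * C * (2 + 4 * C)" using C_ge_1 mult_mono[of 1 "4 * C" 1 "2 + 4 * C"] by simp
    then show ?thesis unfolding C6_def using V1 mult_mono[of 1 "Vb + 1" 1 "4 * C * (2 + 4 * C)"] by simp
  qed
  have CG: "1 \<le> C6 ^ 2 * G ^ 2" using one_le_power[OF C61, of 2] one_le_power[OF G1, of 2] mult_mono[of 1 "C6 ^ 2" 1 "G ^ 2"] by simp
  have C7: "4 * C \<le> C7"
  proof -
    have "1 \<le> C6 ^ 2 * G ^ 2 * (Vb + 1)" using CG V1 mult_mono[of 1 "C6 ^ 2 * G ^ 2" 1 "Vb + 1"] by simp
    then show ?thesis unfolding C7_def using C_ge_1 mult_left_mono[of 1 _ "4 * C"] by simp
  qed
  have ampU0: "amp U 0 = 1" using U0 by (simp add: amp_def)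
  have fw: "amp U j \<le> 4 * C * amp U p" if "0 \<le> p" "p \<le> j" for p j
    using that LU BU by (intro amp_forward[of p U B]) auto
  have Upos: "0 < amp U j" for j
  proof (rule ccontr)
    assume "\<not> 0 < amp U j"
    then have a0: "amp U j = 0" using amp_nonneg[of U j] by linarith
    have z: "U (j - 1) = 0" "U j = 0" using amp_ge[of U j] unfolding a0 by simp_all
    have "U 0 = 0"
      by (rule sol_eq[where V = V and x = U and y = "\<lambda>_. 0" and c = "j - 1" and lo = "min 0 j" and hi = "max 0 j", OF V_bound])
        (use LU z in \<open>auto simp: Lop_def\<close>)
    then show False using U0 by simp
  qed
  have eqU: "\<Phi> j = U j" if "-1 \<le> j" "j \<le> Q - 1" for j
  proof (rule sol_eq[where V = V and x = \<Phi> and y = U and c = "-1" and lo = 0 and hi = "Q - 2", OF V_bound])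
    fix i assume "0 \<le> i" "i \<le> Q - 2"
    then have "Lop V \<Phi> i = Lop a \<Phi> i" using match by (simp add: Lop_def)
    then show "Lop V \<Phi> i = Lop V U i" using L\<Phi> LU by simp
  qed (use that \<Phi>0 U0 QI in auto)
  define y where "y j = \<Phi> (j + Q)" for j
  have Ly: "Lop (\<lambda>j. a (j + Q)) y j = 0" for j unfolding y_def Lop_shift by (rule L\<Phi>)
  \<comment> \<open>By \<open>amp_product_bound\<close> this product hardly grows where
    \<open>y\<close> solves the equation of \<open>U\<close>. It starts near
    \<open>amp U (Q - 1)\<close>, and dividing by \<open>amp U j\<close>, which is at least
    \<open>amp U (Q - 1) / (4 * C)\<close>, bounds \<open>y\<close>.\<close>
  define R where "R j = amp U j * amp y j" for j
  have R0: "0 \<le> R j" for j unfolding R_def using amp_nonneg by simp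
  have base: "R 0 \<le> (Vb + 1) * amp U (Q - 1)"
  proof -
    have "amp y 0 \<le> (Vb + 1) * amp y (- 1)" using amp_step[OF Ly[of "-1"] a] by simp
    also have "amp y (- 1) = amp U (Q - 1)"
      unfolding amp_def y_def using eqU[of "Q - 2"] eqU[of "Q - 1"] QI by (simp add: algebra_simps)
    finally show ?thesis by (simp add: R_def ampU0)
  qed
  have step: "R (j + 1) \<le> G * R j" if "0 \<le> j" for j
  proof -
    have "amp U (j + 1) * amp y (j + 1) \<le> (4 * C * amp U j) * ((Vb + 1) * amp y j)"
      using fw[OF that, of "j + 1"] amp_step[OF Ly[of j] a] amp_nonneg C_ge_1 by (intro mult_mono) auto
    then show ?thesis by (simp add: R_def G_def algebra_simps)
  qed
  have run: "R j \<le> C6 * R p" if pj: "0 \<le> p" "p \<le> j" "j \<le> I" and no: "\<And>k. p \<le> k \<Longrightarrow> k < j \<Longrightarrow> k \<noteq> \<kappa> - 1 \<and> k \<noteq> \<kappa>" for p j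
  proof -
    have "Lop V y k = 0" if k: "p \<le> k" "k < j" for k
    proof -
      have "a (k + Q) = V k" using rep[of k] match[of k] no[OF k] k pj QI by simp
      then show ?thesis using Ly[of k] by (simp add: Lop_def)
    qed
    then show ?thesis unfolding R_def C6_def using LU BU pj
      by (intro amp_product_bound[of p U B]) auto
  qed
  have GG: "G * R j \<le> G ^ 2 * R j" "R j \<le> G * R j" "R j \<le> C6 * R j" for j
    using G1 C61 R0[of j] mult_right_mono[of 1 G "R j"] mult_right_mono[of 1 C6 "R j"] mult_right_mono[of G "G ^ 2" "R j"]
      self_le_power[OF G1, of 2] by auto
  have R_all: "R j \<le> C6 ^ 2 * G ^ 2 * R 0" if j: "0 \<le> j" "j \<le> I" for j
  proof -
    have fin: "x \<le> C6 ^ 2 * G ^ 2 * R 0" if "x \<le> C6 * (G ^ 2 * (C6 * R 0))" for x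
      using that by (simp add: power2_eq_square algebra_simps)
    have mC: "C6 * u \<le> C6 * v" if "u \<le> v" for u v using that C61 by (intro mult_left_mono) auto
    have mG: "G * u \<le> G * v" if "u \<le> v" for u v using that G1 by (intro mult_left_mono) auto
    have mG2: "G ^ 2 * u \<le> G ^ 2 * v" if "u \<le> v" for u v using that G1 by (intro mult_left_mono) auto
    \<comment> \<open>Up to \<open>p1\<close> the words agree. The exceptional places
      \<open>\<kappa> - 1\<close> and \<open>\<kappa>\<close> are passed with at most two crude
      steps of factor \<open>G\<close>, and a second run follows; this explains
      \<open>C6 ^ 2 * G ^ 2\<close>.\<close>
    define p1 where "p1 = max 0 (\<kappa> - 1)"
    have c0: "0 \<le> C6 * R 0" using C61 R0 by simp
    have c1: "C6 * R 0 \<le> G ^ 2 * (C6 * R 0)"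
      using mult_right_mono[of 1 "G ^ 2" "C6 * R 0"] one_le_power[OF G1, of 2] c0 by simp
    have c2: "G ^ 2 * (C6 * R 0) \<le> C6 * (G ^ 2 * (C6 * R 0))"
      using mult_right_mono[of 1 C6 "G ^ 2 * (C6 * R 0)"] C61 c0 by simp
    have small: "R k \<le> C6 * R 0" if "0 \<le> k" "k \<le> p1" "k \<le> I" for k
      using that by (intro run) (auto simp: p1_def)
    have G2: "G * (G * v) = G ^ 2 * v" for v by (simp add: power2_eq_square)
    have mid: "R k \<le> G ^ 2 * (C6 * R 0)" if k: "p1 \<le> k" "k \<le> \<kappa> + 1" "k \<le> I" for k
    proof -
      have p1: "0 \<le> p1" "p1 \<le> I" using k by (auto simp: p1_def)
      have s1: "R p1 \<le> C6 * R 0" using small[of p1] p1 by simp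
      have s2: "R (p1 + 1) \<le> G * (C6 * R 0)" using step[OF p1(1)] mG[OF s1] by linarith
      have s3: "R (p1 + 1 + 1) \<le> G ^ 2 * (C6 * R 0)" using step[of "p1 + 1"] p1 mG[OF s2] G2 by (metis add_increasing2 order_trans zero_le_one)
      have s4: "G * (C6 * R 0) \<le> G ^ 2 * (C6 * R 0)"
        using mult_right_mono[of G "G ^ 2" "C6 * R 0"] self_le_power[OF G1, of 2] c0 by simp
      have "k = p1 \<or> k = p1 + 1 \<or> k = p1 + 1 + 1" using k by (auto simp: p1_def)
      then show ?thesis using s1 s2 s3 s4 c1 by auto
    qed
    consider "j \<le> p1" | "p1 \<le> j" "j \<le> \<kappa> + 1" | "\<kappa> + 1 \<le> j" by linarith
    then show ?thesis
    proof cases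
      case 1 then show ?thesis using small[of j] j c1 c2 by (intro fin) linarith
    next
      case 2 then show ?thesis using mid[of j] j c2 by (intro fin) linarith
    next
      case 3
      have "R (\<kappa> + 1) \<le> G ^ 2 * (C6 * R 0)" using mid[of "\<kappa> + 1"] 3 j QI by (simp add: p1_def)
      moreover have "R j \<le> C6 * R (\<kappa> + 1)" using 3 j QI by (intro run) auto
      ultimately show ?thesis using mC[of "R (\<kappa> + 1)"] by (intro fin) (meson order_trans)
    qed
  qed
  have yb: "amp y j \<le> C7" if j: "0 \<le> j" "j \<le> I" for j
  proof -
    have "amp y j * amp U (Q - 1) \<le> amp y j * (4 * C * amp U j)"
      using fw[of j "Q - 1"] j QI amp_nonneg by (intro mult_left_mono) auto
    also have "\<dots> = 4 * C * R j" by (simp add: R_def algebra_simps)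
    also have "\<dots> \<le> 4 * C * (C6 ^ 2 * G ^ 2 * R 0)" using R_all[OF j] C_ge_1 by (intro mult_left_mono) auto
    also have "\<dots> \<le> 4 * C * (C6 ^ 2 * G ^ 2 * ((Vb + 1) * amp U (Q - 1)))"
      using base C_ge_1 CG by (intro mult_left_mono) auto
    also have "\<dots> = C7 * amp U (Q - 1)" by (simp add: C7_def algebra_simps)
    finally show ?thesis using Upos[of "Q - 1"] by simp
  qed
  have "cmod (\<Phi> i) \<le> C7"
  proof (cases "i \<le> Q - 1")
    case True
    have "cmod (U i) \<le> 4 * C * amp U 0"
    proof (cases "i = -1")
      case True then show ?thesis using U0 C_ge_1 ampU0 by simp
    next
      case False then show ?thesis using i LU BU by (intro forward_bound[of 0 U B]) auto
    qed
    then show ?thesis using eqU[of i] i True C7 ampU0 by simp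
  next
    case False
    then show ?thesis using yb[of "i - Q"] i amp_ge(2)[of y "i - Q"] by (simp add: y_def)
  qed
  then show ?thesis unfolding C7_def C6_def G_def .
qed

text \<open>\<open>h0\<close> and \<open>h1\<close> are the columns 0 and 1 of an inverse finite section; they cannot both be small to the left of
  their poles, since to the right they are proportional.\<close>
lemma two_columns_not_small:
  assumes W: "cmod (W 0) \<le> l" "cmod (W 1) \<le> l"
    and h0: "fsec_sol W n (unit_seq 0) h0" and h1: "fsec_sol W n (unit_seq 1) h1" and n: "2 \<le> n"
    and s: "cmod (h0 (- 1)) \<le> \<eta>" "cmod (h0 0) \<le> \<eta>" "cmod (h1 0) \<le> \<eta>" "cmod (h1 1) \<le> \<eta>"
    and \<eta>: "\<eta> * (1 + l) \<le> 1 / 4"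
  shows False
proof -
  have l0: "0 \<le> l" using W(1) norm_ge_zero order_trans by blast
  have \<eta>0: "0 \<le> \<eta>" using s(1) norm_ge_zero order_trans by blast
  have L0: "Lop W h0 j = (if j = 0 then 1 else 0)" if "\<bar>j\<bar> \<le> int n" for j
    using h0 that by (simp add: fsec_sol_def unit_seq_def)
  have L1: "Lop W h1 j = (if j = 1 then 1 else 0)" if "\<bar>j\<bar> \<le> int n" for j
    using h1 that by (simp add: fsec_sol_def unit_seq_def)
  have e0: "h0 1 = 1 - (h0 (- 1) + W 0 * h0 0)" using L0[of 0] by (simp add: Lop_def algebra_simps)
  have e1: "h1 2 = 1 - (h1 0 + W 1 * h1 1)" using L1[of 1] n by (simp add: Lop_def algebra_simps)
  have e2: "h0 2 = - h0 0 - W 1 * h0 1" using L0[of 1] n by (simp add: Lop_def eq_diff_eq eq_neg_iff_add_eq_0 algebra_simps)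
  have b: "cmod (u + w * v) \<le> 1 / 4" if "cmod u \<le> \<eta>" "cmod v \<le> \<eta>" "cmod w \<le> l" for u v w
  proof -
    have "cmod (u + w * v) \<le> cmod u + cmod w * cmod v" by (metis norm_mult norm_triangle_ineq)
    also have "\<dots> \<le> \<eta> + l * \<eta>" using that l0 by (intro add_mono mult_mono) auto
    finally show ?thesis using \<eta> by (simp add: algebra_simps)
  qed
  have b0: "cmod (h0 (- 1) + W 0 * h0 0) \<le> 1 / 4" and b1: "cmod (h1 0 + W 1 * h1 1) \<le> 1 / 4" using b s W by auto
  have g0: "3 / 4 \<le> cmod (h0 1)" "cmod (h0 1) \<le> 5 / 4"
    using norm_triangle_ineq2[of 1 "h0 (- 1) + W 0 * h0 0"] norm_triangle_ineq4[of 1 "h0 (- 1) + W 0 * h0 0"] b0 unfolding e0 by auto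
  have g1: "3 / 4 \<le> cmod (h1 2)" using norm_triangle_ineq2[of 1 "h1 0 + W 1 * h1 1"] b1 unfolding e1 by auto
  have g2: "cmod (h0 2) \<le> \<eta> + l * (5 / 4)"
  proof -
    have "cmod (h0 2) \<le> cmod (h0 0) + cmod (W 1) * cmod (h0 1)"
      unfolding e2 using norm_triangle_ineq4[of "- h0 0" "W 1 * h0 1"] by (simp add: norm_mult)
    also have "\<dots> \<le> \<eta> + l * (5 / 4)" using s W g0 l0 by (intro add_mono mult_mono) auto
    finally show ?thesis .
  qed
  \<comment> \<open>Right of the poles both columns solve the homogeneous equation and vanish at
    \<open>n + 1\<close>, so their Wronskian is already zero at 1. The resulting equality of
    products is impossible, since 9/16 > 5/16.\<close>
  have "wronskian h0 h1 (1 + int (n - 1)) = wronskian h0 h1 1"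
    by (rule wronskian_const[where V = W]) (use L0 L1 n in auto)
  moreover have "wronskian h0 h1 (1 + int (n - 1)) = 0"
    using h0 h1 n by (simp add: wronskian_def fsec_sol_def)
  ultimately have "h0 1 * h1 2 = h0 2 * h1 1" by (simp add: wronskian_def algebra_simps)
  then have "cmod (h0 1) * cmod (h1 2) = cmod (h0 2) * cmod (h1 1)" by (metis norm_mult)
  also have "\<dots> \<le> (\<eta> + l * (5 / 4)) * \<eta>" using g2 s(4) \<eta>0 l0 by (intro mult_mono) auto
  also have "\<dots> \<le> (5 / 4 * (1 + l)) * \<eta>"
  proof -
    have "\<eta> \<le> \<eta> * (1 + l)" using \<eta>0 l0 by (simp add: algebra_simps)
    then have "\<eta> + l * (5 / 4) \<le> 5 / 4 * (1 + l)" using \<eta> by simp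
    then show ?thesis using \<eta>0 by (rule mult_right_mono)
  qed
  also have "\<dots> \<le> 5 / 16" using \<eta> by (simp add: algebra_simps)
  finally have "cmod (h0 1) * cmod (h1 2) \<le> 5 / 16" .
  moreover have "(3 / 4) * (3 / 4) \<le> cmod (h0 1) * cmod (h1 2)" using g0 g1 by (intro mult_mono) auto
  ultimately show False by simp
qed

text \<open>A column of the inverse sections converges in norm to that of the inverse, for
  \<open>p = \<infinity>\<close> by the second half of P-strong convergence with cut-off 1. The
  limit column decays exponentially away from its pole, so both contributions at the left end are
  small.\<close>

lemma (in hyperbolic) columns_vanish_at_boundary:
  assumes p: "1 \<le> p" and inv: "is_inverse_on p (Lop V) B" and si: "\<And>n. n1 \<le> n \<Longrightarrow> fsec_invertible (Lop V) n"
    and conv: "strong_conv p (fsec_inv (Lop V)) B" and jj: "j \<in> {0, 1}" and e: "0 < e"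
  shows "\<exists>X. \<forall>n\<ge>X. cmod (fsec_inv (Lop V) n (unit_seq j) (- int n)) \<le> e"
proof -
  define R where "R n = fsec_inv (Lop V) n (unit_seq j)" for n
  define b where "b = B (unit_seq j)"
  have u1: "lpb p (unit_seq j) 1"
    using lpb_finite_support[OF p, of "{j}" "unit_seq j" 1] by (auto simp: unit_seq_def)
  then have ul: "unit_seq j \<in> lp_space p" "lp_norm p (unit_seq j) \<le> 1" using lpb_iff[OF p, of 1] by auto
  have bl: "b \<in> lp_space p" and Lb: "Lop V b = unit_seq j" using inv ul unfolding is_inverse_on_def b_def by auto
  \<comment> \<open>\<open>lp_norm\<close> controls single entries only for members of
    \<open>lp_space\<close>.\<close>
  have diff_lp: "(\<lambda>i. R n i - b i) \<in> lp_space p" if n: "n1 \<le> n" for n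
  proof -
    have "fsec_sol V n (unit_seq j) (R n)" unfolding R_def by (rule fsec_inv_sol[OF si[OF n]])
    then have "R n \<in> lp_space p" using finite_support_lp[OF p, of n "R n"] by (auto simp: fsec_sol_def)
    then obtain c where c: "0 \<le> c" "lpb p (R n) c" using lpb_lp_norm[OF p] by blast
    obtain d where d: "0 \<le> d" "lpb p b d" using lpb_lp_norm[OF p bl] by blast
    have "lpb p (\<lambda>i. R n i + (-1) * b i) (c + cmod (-1) * d)"
      using c d by (intro lpb_add[OF p] lpb_scale[OF p]) auto
    then have "lpb p (\<lambda>i. R n i - b i) (c + d)" by simp
    then show ?thesis using lpb_iff[OF p, of "c + d"] c d by auto
  qed
  have "\<forall>\<^sub>F n in sequentially. lp_norm p (\<lambda>i. R n i - b i) \<le> e / 2"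
  proof (cases "p = \<infinity>")
    case True
    have pr: "proj 1 (unit_seq j) = unit_seq j" using jj by (auto simp: proj_def unit_seq_def)
    have "0 < e / 2" using e by simp
    then have "\<forall>\<^sub>F n in sequentially. \<forall>x\<in>lp_space p. lp_norm p x \<le> 1 \<longrightarrow>
        lp_norm p (proj 1 (\<lambda>i. fsec_inv (Lop V) n x i - B x i)) \<le> e / 2 \<and>
        lp_norm p (\<lambda>i. fsec_inv (Lop V) n (proj 1 x) i - B (proj 1 x) i) \<le> e / 2"
      using conv True unfolding strong_conv_def by presburger
    then show ?thesis
    proof (rule eventually_mono)
      fix n assume "\<forall>x\<in>lp_space p. lp_norm p x \<le> 1 \<longrightarrow>
        lp_norm p (proj 1 (\<lambda>i. fsec_inv (Lop V) n x i - B x i)) \<le> e / 2 \<and>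
        lp_norm p (\<lambda>i. fsec_inv (Lop V) n (proj 1 x) i - B (proj 1 x) i) \<le> e / 2"
      then show "lp_norm p (\<lambda>i. R n i - b i) \<le> e / 2" using ul pr unfolding R_def b_def by metis
    qed
  next
    case False
    then have "(\<lambda>n. lp_norm p (\<lambda>i. R n i - b i)) \<longlonglongrightarrow> 0"
      using conv ul(1) unfolding strong_conv_def R_def b_def by simp
    then have "\<forall>\<^sub>F n in sequentially. lp_norm p (\<lambda>i. R n i - b i) < e / 2" using e by (intro order_tendstoD) auto
    then show ?thesis by (rule eventually_mono) simp
  qed
  then obtain n2 where n2: "\<And>n. n2 \<le> n \<Longrightarrow> lp_norm p (\<lambda>i. R n i - b i) \<le> e / 2" by (auto simp: eventually_sequentially)
  obtain d where d: "0 \<le> d" "lpb p b d" using lpb_lp_norm[OF p bl] by blast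
  have bd: "cmod (b i) \<le> d" for i by (rule lpb_coord[OF p d])
  obtain k where k: "(3/4) ^ k * d \<le> e / 2" using geometric_eventually_small[of "e / 2" d] e by auto
  have tail: "cmod (b (- int n)) \<le> e / 2" if n: "int k * N + 1 \<le> int n" for n
  proof -
    have "cmod (b (- int n)) \<le> (3/4) ^ k * d"
    proof (rule decay)
      fix i assume "\<bar>i - - int n\<bar> \<le> int k * N"
      then have "i < 0" using n by linarith
      then show "Lop V b i = 0 \<and> cmod (b i) \<le> d" using Lb bd jj by (auto simp: unit_seq_def)
    qed
    then show ?thesis using k by simp
  qed
  show ?thesis
  proof (intro exI[of _ "max n1 (max n2 (nat (int k * N + 1)))"] allI impI)
    fix n assume "max n1 (max n2 (nat (int k * N + 1))) \<le> n"
    then have n: "n1 \<le> n" "n2 \<le> n" "int k * N + 1 \<le> int n" by auto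
    have e2: "0 \<le> e / 2" using e by simp
    then have "lpb p (\<lambda>i. R n i - b i) (e / 2)" using lpb_iff[OF p] diff_lp[OF n(1)] n2[OF n(2)] by blast
    then have "cmod (R n (- int n) - b (- int n)) \<le> e / 2" by (rule lpb_coord[OF p e2])
    then show "cmod (fsec_inv (Lop V) n (unit_seq j) (- int n)) \<le> e"
      using tail[OF n(3)] norm_triangle_sub[of "R n (- int n)" "b (- int n)"] unfolding R_def by linarith
  qed
qed

context gapped_sturmian
begin

lemma liminf_zero_frequently:
  assumes "liminf (\<lambda>m. dist0_G lam \<alpha> m) = 0" "0 < e"
  shows "\<exists>m\<ge>M. \<exists>E\<in>G_set lam \<alpha> m. cmod E < e"
proof (rule ccontr)
  assume neg: "\<not> ?thesis"
  have "ereal e \<le> dist0_G lam \<alpha> m" if "M \<le> m" for m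
    unfolding dist0_G_def
  proof (rule INF_greatest)
    fix E assume "E \<in> G_set lam \<alpha> m"
    then have "\<not> cmod E < e" using neg that by blast
    then show "ereal e \<le> ereal (cmod E)" by simp
  qed
  then have "ereal e \<le> liminf (\<lambda>m. dist0_G lam \<alpha> m)"
    by (intro Liminf_bounded eventually_sequentiallyI[of M]) auto
  then show False using assms by simp
qed

text \<open>The choices are nested: first the precision \<open>e\<close>, then \<open>X\<close>
  beyond which the columns are small at the left end, then the period \<open>Q\<close>. Only then
  the energy tolerance \<open>e'\<close> is fixed, because comparing energy \<open>E\<close> with
  energy 0 costs the growth factor of the whole half section.\<close>

lemma fsm_necessary:
  fixes pe :: ereal
  assumes p1: "1 \<le> pe" and fsm: "fsm_applicable pe (schroedinger lam \<alpha> \<theta>)"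
  shows "liminf (\<lambda>m. dist0_G lam \<alpha> m) \<noteq> 0"
proof
  assume lz: "liminf (\<lambda>m. dist0_G lam \<alpha> m) = 0"
  let ?W = "V \<theta>"
  interpret h: hyperbolic ?W N C "\<bar>lam\<bar> + 1" by (rule hyperbolic_0)
  obtain B n1 where inv: "is_inverse_on pe (Lop ?W) B" and si: "\<And>n. n1 \<le> n \<Longrightarrow> fsec_invertible (Lop ?W) n"
    and conv: "strong_conv pe (fsec_inv (Lop ?W)) B"
    using fsm unfolding fsm_applicable_def schroedinger_Lop by blast
  define Vb where "Vb = \<bar>lam\<bar> + 1"
  define C7 where "C7 = 4 * C * (((Vb + 1) * (4 * C * (2 + 4 * C))) ^ 2 * ((Vb + 1) * (4 * C)) ^ 2 * (Vb + 1))"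
  have C70: "0 < C7" using C_ge_1 by (auto simp: C7_def Vb_def intro!: mult_pos_pos zero_less_power add_pos_pos)
  define \<eta> where "\<eta> = 1 / (4 * (1 + \<bar>lam\<bar>))"
  have \<eta>: "0 < \<eta>" "\<eta> * (1 + \<bar>lam\<bar>) \<le> 1 / 4" by (auto simp: \<eta>_def)
  define e where "e = \<eta> / (C7 + 1)"
  have e: "0 < e" "e * (C7 + 1) = \<eta>" using \<eta> C70 by (auto simp: e_def)
  obtain X0 where X0: "\<And>n. X0 \<le> n \<Longrightarrow> cmod (fsec_inv (Lop ?W) n (unit_seq 0) (- int n)) \<le> e"
    using h.columns_vanish_at_boundary[OF p1 inv si conv, where j = 0 and e = e] e by auto
  obtain X1 where X1: "\<And>n. X1 \<le> n \<Longrightarrow> cmod (fsec_inv (Lop ?W) n (unit_seq 1) (- int n)) \<le> e"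
    using h.columns_vanish_at_boundary[OF p1 inv si conv, where j = 1 and e = e] e by auto
  define X where "X = max (max X0 X1) (max n1 2)"
  have X: "X0 \<le> X" "X1 \<le> X" "n1 \<le> X" "2 \<le> X" by (auto simp: X_def)
  \<comment> \<open>Ensures \<open>q k + X + 3 \<le> Q\<close>, so that the stretch beyond the
    matched word is shorter than one period.\<close>
  define s where "s = X + 3"
  define k where "k = Suc (Suc s)"
  define Q where "Q = int (q (Suc k))"
  have Qk: "int (q k) + int X + 3 \<le> Q"
    using q_Suc_Suc_ge[of "Suc s"] q_ge[of s] unfolding Q_def k_def s_def by linarith
  define e' where "e' = min \<delta> (1 / (C7 * (Vb + 2) ^ nat (int X + 2 * Q + 5)))"
  have e'0: "0 < e'" using \<delta>_pos C70 by (auto simp: e'_def Vb_def)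
  obtain m E where m: "max (max M0 2) (nat (2 * Q)) \<le> m" and E: "E \<in> G_set lam \<alpha> m" "cmod E < e'"
    using liminf_zero_frequently[OF lz e'0] by blast
  have m2: "2 \<le> m" "M0 \<le> m" using m by auto
  have Ed: "cmod E \<le> \<delta>" using E(2) by (simp add: e'_def)
  have Q2: "2 \<le> Q" using Qk X by linarith
  have qL: "2 * (Q - 1) < int (q (Suc m))" "0 \<le> Q - 1" using m q_ge[of m] Q2 by auto
  obtain k1 u z where u: "\<And>j. Lop (\<lambda>j. pot lam (cf_approx \<alpha> m) 0 j - E) u j = 0" "u (k1 - 1) = 0" "u k1 = 1"
    "\<And>j. u (j + int (q m)) = z * u j" "cmod z < 1"
    using E(1) unfolding G_set_iff[OF m2(1)] by blast
  define c where "c j = pot lam (cf_approx \<alpha> m) 0 (k1 + j) - E" for j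
  define U where "U j = u (j + k1)" for j
  have hc: "hyperbolic c N C Vb" unfolding c_def Vb_def by (rule hyperbolic_approx[OF m2(2) Ed])
  have cU: "c = (\<lambda>j. pot lam (cf_approx \<alpha> m) 0 (j + k1) - E)" by (auto simp: c_def add.commute)
  have LU: "Lop c U j = 0" for j
    unfolding cU U_def using Lop_shift[of "\<lambda>j. pot lam (cf_approx \<alpha> m) 0 j - E" k1 u j] u(1) by simp
  have U0: "U (- 1) = 0" "U 0 = 1" using u by (simp_all add: U_def)
  have "U (j + int (q m)) = z * U j" for j using u(4)[of "j + k1"] by (simp add: U_def algebra_simps)
  then obtain BU where BU: "\<And>j. 0 \<le> j \<Longrightarrow> cmod (U j) \<le> BU"
    using floquet_forward_bounded[where u = U, OF q_pos _ less_imp_le[OF u(5)]] by blast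
  obtain y where y: "\<And>j. 0 \<le> j \<Longrightarrow> j < Q - 1 \<Longrightarrow> sturm_v (cf_approx \<alpha> m) 0 (k1 + j) = sturm_v \<alpha> y j"
    using approx_window_is_sturmian[OF m2(1) qL] by blast
  obtain n' where n': "int X \<le> n'" "n' < int X + Q + int (q k)"
    and rec: "\<And>j. 0 \<le> j \<Longrightarrow> j \<le> Q - 2 \<Longrightarrow> sturm_v \<alpha> \<theta> (- n' + j) = sturm_v \<alpha> y j"
    using sturm_v_recurrence[of "int X" k \<theta> y] unfolding Q_def by blast
  define n where "n = nat n'"
  have n: "int n = n'" "X \<le> n" using n' by (auto simp: n_def)
  \<comment> \<open>The equation of the section read from its left end, still at the energy of the
    approximant, so that it coincides with \<open>c\<close> on the matched word.\<close>
  define a where "a j = ?W (j + - int n) - E" for j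
  have ab: "cmod (a j) \<le> Vb" for j
  proof -
    interpret hE: hyperbolic "\<lambda>j. ?W j - E" N C "\<bar>lam\<bar> + 1" by (rule hyperbolic_word[OF Ed])
    show ?thesis unfolding a_def Vb_def by (rule hE.V_bound)
  qed
  have match: "a j = c j" if "0 \<le> j" "j \<le> Q - 2" for j
    using y[of j] rec[of j] that n(1) by (simp add: a_def c_def pot_def algebra_simps)
  define I where "I = int n + 1 - Q"
  have I: "I \<le> Q - 2" using n' n Qk by (simp add: I_def)
  have rep_good: "a (j + Q) = a j" if "\<not> bad (Suc k) \<theta> (j - int n)" "\<not> bad (Suc k) \<theta> (j - int n + 1)" for j
    using sturm_v_period[OF that] by (simp add: a_def pot_def Q_def algebra_simps)
  \<comment> \<open>Bad places of level \<open>Suc k\<close> are farther apart than the stretch is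
    long, so it contains at most one, and one bad place spoils at most two adjacent letters.\<close>
  have "\<exists>\<kappa>\<ge>0. \<forall>j. 0 \<le> j \<longrightarrow> j < I \<longrightarrow> j \<noteq> \<kappa> - 1 \<longrightarrow> j \<noteq> \<kappa> \<longrightarrow> a (j + Q) = a j"
  proof (cases "\<exists>\<kappa>. 0 \<le> \<kappa> \<and> \<kappa> \<le> I \<and> bad (Suc k) \<theta> (\<kappa> - int n)")
    case True
    then obtain \<kappa> where \<kappa>: "0 \<le> \<kappa>" "\<kappa> \<le> I" "bad (Suc k) \<theta> (\<kappa> - int n)" by blast
    have uniq: "\<not> bad (Suc k) \<theta> (j - int n)" if "0 \<le> j" "j \<le> I" "j \<noteq> \<kappa>" for j
    proof
      assume b: "bad (Suc k) \<theta> (j - int n)"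
      have "int (q (Suc (Suc k))) \<le> \<bar>j - \<kappa>\<bar>"
        using bad_gap[OF b \<kappa>(3)] bad_gap[OF \<kappa>(3) b] that(3) by linarith
      moreover have "Q \<le> int (q (Suc (Suc k)))" using q_Suc_mono[of "Suc k"] unfolding Q_def by linarith
      ultimately show False using that \<kappa> I by linarith
    qed
    have "a (j + Q) = a j" if "0 \<le> j" "j < I" "j \<noteq> \<kappa> - 1" "j \<noteq> \<kappa>" for j
    proof (rule rep_good)
      show "\<not> bad (Suc k) \<theta> (j - int n)" using uniq[of j] that by simp
      have "j - int n + 1 = (j + 1) - int n" by simp
      moreover have "\<not> bad (Suc k) \<theta> ((j + 1) - int n)" using uniq[of "j + 1"] that by simp
      ultimately show "\<not> bad (Suc k) \<theta> (j - int n + 1)" by metis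
    qed
    then show ?thesis using \<kappa>(1) by blast
  next
    case False
    have "a (j + Q) = a j" if "0 \<le> j" "j < I" for j
    proof (rule rep_good)
      show "\<not> bad (Suc k) \<theta> (j - int n)" using False that less_imp_le by blast
      have "j - int n + 1 = (j + 1) - int n" by simp
      moreover have "\<not> bad (Suc k) \<theta> ((j + 1) - int n)"
      proof -
        have "0 \<le> j + 1" "j + 1 \<le> I" using that by auto
        then show ?thesis using False by blast
      qed
      ultimately show "\<not> bad (Suc k) \<theta> (j - int n + 1)" by metis
    qed
    then show ?thesis by blast
  qed
  then obtain \<kappa> where \<kappa>: "0 \<le> \<kappa>" "\<And>j. 0 \<le> j \<Longrightarrow> j < I \<Longrightarrow> j \<noteq> \<kappa> - 1 \<Longrightarrow> j \<noteq> \<kappa> \<Longrightarrow> a (j + Q) = a j" by blast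
  obtain \<Phi>E where \<Phi>E: "\<And>j. Lop a \<Phi>E j = 0" "\<Phi>E (- 1) = 0" "\<Phi>E 0 = 1" using sol_exists[of a "-1" 0 1] by auto
  have \<Phi>Eb: "cmod (\<Phi>E j) \<le> C7" if "- 1 \<le> j" "j \<le> int n + 1" for j
    unfolding C7_def
    by (rule hyperbolic.quasi_period_bound[OF hc LU BU U0 ab \<Phi>E match \<kappa>(2) Q2 I \<kappa>(1)])
      (use that in \<open>auto simp: I_def\<close>)
  \<comment> \<open>Return to energy 0: by the choice of \<open>e'\<close> the two Dirichlet
    solutions differ by at most 1 on the half section.\<close>
  define W' where "W' j = ?W (j + - int n)" for j
  obtain \<Phi> where \<Phi>: "\<And>j. Lop W' \<Phi> j = 0" "\<Phi> (- 1) = 0" "\<Phi> 0 = 1" using sol_exists[of W' "-1" 0 1] by auto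
  have W'b: "cmod (W' j) \<le> Vb" for j unfolding W'_def Vb_def by (rule h.V_bound)
  have \<Phi>b: "cmod (\<Phi> j) \<le> C7 + 1" if j: "- 1 \<le> j" "j \<le> int n + 1" for j
  proof -
    have aW: "a = (\<lambda>j. W' j - E)" by (simp add: a_def[abs_def] W'_def)
    have "cmod (\<Phi>E j - \<Phi> j) \<le> (Vb + 2) ^ nat (int n - 0 + 2) * (cmod E * C7)"
    proof (rule growth_both[where V = W' and x = "\<lambda>j. \<Phi>E j - \<Phi> j" and c = "-1" and lo = 0 and hi = "int n", OF W'b])
      fix i assume i: "0 \<le> i" "i \<le> int n"
      have "Lop W' \<Phi>E i = E * \<Phi>E i" using \<Phi>E(1)[of i] unfolding aW Lop_energy by simp
      then have "Lop W' (\<lambda>j. \<Phi>E j - \<Phi> j) i = E * \<Phi>E i" unfolding Lop_diff using \<Phi>(1) by simp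
      then show "cmod (Lop W' (\<lambda>j. \<Phi>E j - \<Phi> j) i) \<le> cmod E * C7"
        using \<Phi>Eb[of i] i by (simp add: norm_mult mult_left_mono)
    qed (use \<Phi> \<Phi>E j C70 in auto)
    also have "\<dots> \<le> (Vb + 2) ^ nat (int X + 2 * Q + 5) * (cmod E * C7)"
    proof -
      have "nat (int n - 0 + 2) \<le> nat (int X + 2 * Q + 5)" using n n' Qk by (intro nat_mono) linarith
      then show ?thesis using C70 by (intro mult_right_mono power_increasing) (auto simp: Vb_def)
    qed
    also have "\<dots> \<le> 1"
    proof -
      let ?Z = "C7 * (Vb + 2) ^ nat (int X + 2 * Q + 5)"
      have Z: "0 < ?Z" using C70 by (simp add: Vb_def)
      have "cmod E * ?Z \<le> 1 / ?Z * ?Z" using E(2) Z by (intro mult_right_mono) (auto simp: e'_def)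
      also have "\<dots> = 1" using Z by (intro nonzero_eq_divide_eq[THEN iffD1, OF _ refl]) linarith
      finally show ?thesis by (metis mult.commute mult.assoc)
    qed
    finally have "cmod (\<Phi>E j - \<Phi> j) \<le> 1" .
    moreover have "cmod (\<Phi> j) \<le> cmod (\<Phi>E j) + cmod (\<Phi>E j - \<Phi> j)" by (metis norm_minus_commute norm_triangle_sub)
    ultimately show ?thesis using \<Phi>Eb[OF j] by linarith
  qed
  define h0 h1 where "h0 = fsec_inv (Lop ?W) n (unit_seq 0)" and "h1 = fsec_inv (Lop ?W) n (unit_seq 1)"
  have s0: "fsec_sol ?W n (unit_seq 0) h0" and s1: "fsec_sol ?W n (unit_seq 1) h1"
    unfolding h0_def h1_def using si[of n] n X by (auto intro: fsec_inv_sol)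
  \<comment> \<open>Left of its pole a column is the Dirichlet solution times its small value at
    \<open>- n\<close>.\<close>
  have left_half: "cmod (g i) \<le> \<eta>"
    if g: "fsec_sol ?W n (unit_seq t) g" "cmod (g (- int n)) \<le> e" and t: "0 \<le> t" "t \<le> 1" and i: "- 1 \<le> i" "i \<le> t" for g i t
  proof -
    have "g (i + int n + - int n) = g (- int n) * \<Phi> (i + int n)"
    proof (rule sol_eq[where V = W' and x = "\<lambda>j. g (j + - int n)" and y = "\<lambda>j. g (- int n) * \<Phi> j" and c = "-1"
          and lo = 0 and hi = "t + int n - 1", OF W'b])
      fix j assume j: "0 \<le> j" "j \<le> t + int n - 1"
      have "Lop W' (\<lambda>j. g (j + - int n)) j = Lop ?W g (j + - int n)" unfolding W'_def by (rule Lop_shift)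
      also have "\<dots> = 0" using g(1) j t n X by (auto simp: fsec_sol_def unit_seq_def)
      finally show "Lop W' (\<lambda>j. g (j + - int n)) j = Lop W' (\<lambda>j. g (- int n) * \<Phi> j) j"
        unfolding Lop_scale using \<Phi>(1) by simp
    next
      show "g (- 1 + - int n) = g (- int n) * \<Phi> (- 1)" using g(1) \<Phi> by (simp add: fsec_sol_def)
    qed (use \<Phi> i t n X in auto)
    then have "cmod (g i) = cmod (g (- int n)) * cmod (\<Phi> (i + int n))" by (simp add: norm_mult)
    also have "\<dots> \<le> e * (C7 + 1)" using g(2) \<Phi>b[of "i + int n"] i t e by (intro mult_mono) auto
    finally show ?thesis using e by simp
  qed
  have l0: "cmod (h0 (- int n)) \<le> e" "cmod (h1 (- int n)) \<le> e"
    unfolding h0_def h1_def using X0[of n] X1[of n] n X by auto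
  have "cmod (h0 (- 1)) \<le> \<eta>" "cmod (h0 0) \<le> \<eta>" "cmod (h1 0) \<le> \<eta>" "cmod (h1 1) \<le> \<eta>"
    using left_half[OF s0 l0(1), of "- 1"] left_half[OF s0 l0(1), of 0] left_half[OF s1 l0(2), of 0] left_half[OF s1 l0(2), of 1] by simp_all
  then show False
    using two_columns_not_small[OF pot_bound pot_bound s0 s1 _ _ _ _ _ \<eta>(2)] n X by auto
qed

end

theorem theorem1p1:
  fixes p :: ereal and lam \<alpha> \<theta> :: real
  assumes "1 \<le> p"
    and "\<alpha> \<in> {0..1}" and "\<alpha> \<notin> \<rat>"
    and "\<theta> \<in> {0..<1}"
  shows "fsm_applicable p (schroedinger lam \<alpha> \<theta>) \<longleftrightarrow>
    ((\<exists>m0. \<bar>trace2 (transfer_M lam \<alpha> 0 (cf_q \<alpha> m0))\<bar> > 2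
          \<and> \<bar>trace2 (transfer_M lam \<alpha> 0 (cf_q \<alpha> (m0 + 1)))\<bar> > 2)
     \<and> liminf (\<lambda>m. dist0_G lam \<alpha> m) \<noteq> 0)"
proof -
  have "\<alpha> \<noteq> 0" "\<alpha> \<noteq> 1" using assms(3) by auto
  then interpret irrational_slope \<alpha> using assms(2,3) by unfold_locales auto
  have tr: "\<bar>trace2 (transfer_M lam \<alpha> 0 (cf_q \<alpha> m))\<bar> = cmod (trc lam m)" for m
    unfolding trace2_transfer_M trc_def ..
  have gap: "\<exists>N C \<delta> M. gapped_sturmian \<alpha> lam N C \<delta> M"
    if t: "2 < cmod (trc lam m0)" "2 < cmod (trc lam (m0 + 1))" for m0
  proof -
    obtain m1 where "\<And>m. m1 \<le> m \<Longrightarrow> 4 \<le> cmod (trc lam m)" using trc_growth[of lam m0 4] t by auto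
    then obtain N C \<delta> M where h: "1 \<le> N" "1 \<le> C" "0 < \<delta>"
      "\<And>\<theta> E. cmod E \<le> \<delta> \<Longrightarrow> hyperbolic (\<lambda>j. pot lam \<alpha> \<theta> j - E) N C (\<bar>lam\<bar> + 1)"
      "\<And>m k E. M \<le> m \<Longrightarrow> cmod E \<le> \<delta> \<Longrightarrow> hyperbolic (\<lambda>j. pot lam (cf_approx \<alpha> m) 0 (k + j) - E) N C (\<bar>lam\<bar> + 1)"
      using uniformly_hyperbolic[of m1 lam] by blast
    have "gapped_sturmian \<alpha> lam N C \<delta> M" by (intro gapped_sturmian.intro gapped_sturmian_axioms.intro irrational_slope_axioms) (fact h)+
    then show ?thesis by blast
  qed
  show ?thesis unfolding tr
  proof
    assume fsm: "fsm_applicable p (schroedinger lam \<alpha> \<theta>)"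
    then obtain B where inv: "is_inverse_on p (schroedinger lam \<alpha> \<theta>) B" unfolding fsm_applicable_def by blast
    \<comment> \<open>If no two consecutive traces were large, one of any two neighbouring levels
      would have a trace of modulus at most 2, hence infinitely many levels would, and
      \<open>not_invertible\<close> applies.\<close>
    have "\<exists>m0. 2 < cmod (trc lam m0) \<and> 2 < cmod (trc lam (m0 + 1))"
    proof (rule ccontr)
      assume neg: "\<not> ?thesis"
      have "\<exists>m\<ge>M. cmod (trc lam m) \<le> 2" for M
        using neg by (metis Suc_eq_plus1 le_SucI linorder_not_le order_refl)
      then show False using not_invertible[OF _ assms(1)] inv by blast
    qed
    then obtain m0 where m0: "2 < cmod (trc lam m0)" "2 < cmod (trc lam (m0 + 1))" by blast
    obtain N C \<delta> M where "gapped_sturmian \<alpha> lam N C \<delta> M" using gap[OF m0] by blast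
    then have "liminf (\<lambda>m. dist0_G lam \<alpha> m) \<noteq> 0" using gapped_sturmian.fsm_necessary[OF _ assms(1) fsm] by blast
    then show "(\<exists>m0. 2 < cmod (trc lam m0) \<and> 2 < cmod (trc lam (m0 + 1))) \<and> liminf (\<lambda>m. dist0_G lam \<alpha> m) \<noteq> 0"
      using m0 by blast
  next
    assume h: "(\<exists>m0. 2 < cmod (trc lam m0) \<and> 2 < cmod (trc lam (m0 + 1))) \<and> liminf (\<lambda>m. dist0_G lam \<alpha> m) \<noteq> 0"
    then obtain N C \<delta> M where "gapped_sturmian \<alpha> lam N C \<delta> M" using gap by blast
    then show "fsm_applicable p (schroedinger lam \<alpha> \<theta>)"
      using gapped_sturmian.fsm_sufficient[OF _ assms(1)] h by blast
  qed
qed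

end
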